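(* Let $N\ge 2$, $q>p-1>1$ and $h\in L^\infty(\mathbb{R}^N)$. If $$2<p<\frac{2N}{N-1},$$ then the problem $$-\Delta_p u+|u|^{q-1}u=h\quad\text{on }\mathbb{R}^N$$ has at most one weak solution.
   Context: $\Delta_p u=\mathrm{div}(|\nabla u|^{p-2}\nabla u)$ is the $p$-Laplacian. $C^1_0(\mathbb{R}^N)$ denotes compactly supported $C^1$ functions. A weak solution is a function $u\in W^{1,p}_{loc}(\mathbb{R}^N)\cap L^q_{loc}(\mathbb{R}^N)$ such that $\int_{\mathbb{R}^N}|\nabla u|^{p-2}\nabla u\cdot\nabla\phi+\int_{\mathbb{R}^N}|u|^{q-1}u\,\phi=\int_{\mathbb{R}^N}h\phi$ for every $\phi\in C^1_0(\mathbb{R}^N)$. *)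

theory Defs
  imports "HOL-Analysis.Analysis"
begin

text \<open>
  Functions are everywhere-defined representatives of almost-everywhere equivalence classes.
\<close>

definition grad :: "('a::euclidean_space \<Rightarrow> real) \<Rightarrow> 'a \<Rightarrow> 'a" where
  "grad \<phi> x = (THE D. GDERIV \<phi> x :> D)"

definition C1_0 :: "('a::euclidean_space \<Rightarrow> real) set" where
  "C1_0 = {\<phi>. (\<forall>x. \<phi> differentiable (at x)) \<and> continuous_on UNIV (grad \<phi>)
               \<and> compact (closure {x. \<phi> x \<noteq> 0})}"

definition L_loc :: "real \<Rightarrow> ('a::euclidean_space \<Rightarrow> 'b::euclidean_space) set" where
  "L_loc r = {f. f \<in> borel_measurable lebesgue \<and>
                 (\<forall>K. compact K \<longrightarrow> set_integrable lebesgue K (\<lambda>x. norm (f x) powr r))}"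

definition L_infty :: "('a::euclidean_space \<Rightarrow> real) set" where
  "L_infty = {f. f \<in> borel_measurable lebesgue \<and> (\<exists>C. AE x in lebesgue. \<bar>f x\<bar> \<le> C)}"

text \<open>
  Test functions for weak derivatives are taken in $C^1_0$, as in Gilbarg--Trudinger, Section 7.3.
  The identity is vector valued; its components are the usual ones for the partial derivatives.
\<close>

definition has_weak_gradient ::
    "('a::euclidean_space \<Rightarrow> real) \<Rightarrow> ('a \<Rightarrow> 'a) \<Rightarrow> bool" where
  "has_weak_gradient u g \<longleftrightarrow> u \<in> L_loc 1 \<and> g \<in> L_loc 1 \<and>
     (\<forall>\<phi>\<in>C1_0. (LINT x|lebesgue. u x *\<^sub>R grad \<phi> x) = - (LINT x|lebesgue. \<phi> x *\<^sub>R g x))"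

text \<open>
  Membership in the local Sobolev space $W^{1,p}_{loc}$ is expressed by the existence of the
  weak gradient \<open>g\<close>, which is unique up to null sets, so the choice of \<open>g\<close> is immaterial.
\<close>

definition weak_solution ::
    "real \<Rightarrow> real \<Rightarrow> ('a::euclidean_space \<Rightarrow> real) \<Rightarrow> ('a \<Rightarrow> real) \<Rightarrow> bool" where
  "weak_solution p q h u \<longleftrightarrow> u \<in> L_loc p \<and> u \<in> L_loc q \<and>
     (\<exists>g. has_weak_gradient u g \<and> g \<in> L_loc p \<and>
        (\<forall>\<phi>\<in>C1_0.
           (LINT x|lebesgue. (norm (g x) powr (p - 2) *\<^sub>R g x) \<bullet> grad \<phi> x)
           + (LINT x|lebesgue. \<bar>u x\<bar> powr (q - 1) * u x * \<phi> x)
           = (LINT x|lebesgue. h x * \<phi> x)))"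

end

theory Submission
  imports Defs
begin

text \<open>
  Let \<open>u\<close>, \<open>v\<close> be two solutions, \<open>w = u - v\<close>, and let \<open>\<phi>\<close> be the \<open>k\<close>-th power of \<open>max 0 (1 - |x|^2/R^2)\<close>
  for large \<open>k\<close>. Testing the equation of \<open>u\<close> with \<open>u \<phi>\<close> and absorbing by Young's inequality, which is
  possible because \<open>q + 1 > p\<close>, gives \<open>\<integral>|\<nabla>u|^p \<le> C R^N\<close> over the ball of radius \<open>R\<close>.
  The difference of the equations is tested with \<open>T(w) \<phi>\<close>, where \<open>T\<close> is bounded, increasing and zero on the
  negative half line. Writing \<open>W = |\<nabla>u|^(p-2) + |\<nabla>v|^(p-2)\<close>, the flux difference is bounded below by
  \<open>W |\<nabla>w|^2 / 2\<close> (after pairing with \<open>\<nabla>w\<close>) and above by a multiple of \<open>W |\<nabla>w|\<close>, so AM-GM leaves the error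
  \<open>C R^(-2) \<integral> W T^2/T'\<close>. For the right \<open>T\<close> Young's inequality absorbs it up to
  \<open>C R^(-2p/(p-2)) \<integral> (|\<nabla>u|^p + |\<nabla>v|^p) \<le> C R^(N - 2p/(p-2))\<close>, which tends to \<open>0\<close> since \<open>N < p/(p-2)\<close>.
  Hence \<open>u \<le> v\<close> almost everywhere, and \<open>u = v\<close> by symmetry.

  Nonlinear test functions \<open>T(w) \<phi>\<close> are justified by mollifying \<open>w\<close> only: \<open>T\<close> of a mollification times \<open>\<phi>\<close>
  is already an admissible test function.
\<close>

section \<open>Elementary inequalities\<close>


text \<open>The weight \<open>W\<close> vanishes where both gradients do and may be unbounded
  elsewhere, so it is never compared with a constant: the lower and the upper bound of the flux
  difference carry the same \<open>W\<close>, which then survives only in front of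
  \<open>T^2/T'\<close>. What is known about \<open>W\<close> is that \<open>W^(p/(p-2))\<close> is
  at most a multiple of \<open>|grad u|^p + |grad v|^p\<close>, the quantity that the energy
  estimate controls. This dictates the Young exponents \<open>p/2\<close> and
  \<open>p/(p-2)\<close>, hence the relation between \<open>T^2/T'\<close> and
  \<open>(s^q T)^(2/p)\<close>, hence the shape of \<open>T\<close>; the condition
  \<open>q > p - 1\<close> is what lets this \<open>T\<close> be glued to zero with a continuous
  derivative. The power \<open>k\<close> is large because each Young step turns the power of the
  bump lost by differentiating the cut-off into a negative power of the bump; \<open>k\<close> has
  to outweigh it, so that the remaining errors are uniform up to the edge of the ball. The datum
  \<open>h\<close> cancels in the difference of the equations. In the energy estimate its
  boundedness makes the error a constant per unit volume, which is where \<open>R^N\<close> comes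
  from.\<close>

lemma young_absorb:
  fixes a b e :: real
  assumes "0 \<le> a" "a < b" "e > 0"
  shows "\<exists>C\<ge>0. \<forall>K s. K \<ge> 0 \<longrightarrow> s \<ge> 0 \<longrightarrow> K * s powr a \<le> e * s powr b + C * K powr (b / (b - a))"
proof (intro exI conjI allI impI)
  show "0 \<le> (1/e) powr (a / (b - a))" by simp
  fix K s :: real assume K: "K \<ge> 0" and s: "s \<ge> 0"
  show "K * s powr a \<le> e * s powr b + (1/e) powr (a / (b - a)) * K powr (b / (b - a))"
  \<comment> \<open>Either \<open>e * s powr (b - a)\<close> dominates \<open>K\<close> and the
    first term suffices, or \<open>s powr a\<close> is at most
    \<open>(K / e) powr (a / (b - a))\<close> and the second one does. The second case fixes the
    constant, which depends on neither \<open>K\<close> nor \<open>s\<close>.\<close>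
  proof (cases "K \<le> e * s powr (b - a)")
    case True
    have "K * s powr a \<le> (e * s powr (b - a)) * s powr a"
      using True by (rule mult_right_mono) simp
    also have "\<dots> = e * s powr b" by (simp add: powr_add[symmetric])
    also have "\<dots> \<le> e * s powr b + (1/e) powr (a / (b - a)) * K powr (b / (b - a))" by simp
    finally show ?thesis .
  next
    case False
    then have Kpos: "K > 0" using assms s
      by (smt (verit) mult_nonneg_nonneg powr_ge_zero)
    have "s powr (b - a) \<le> K / e" using False assms by (simp add: field_simps)
    then have "(s powr (b - a)) powr (a / (b - a)) \<le> (K / e) powr (a / (b - a))"
      using assms by (intro powr_mono2) auto
    then have "s powr a \<le> (K / e) powr (a / (b - a))"
      using assms by (simp add: powr_powr)
    then have "K * s powr a \<le> K * (K / e) powr (a / (b - a))" using K by (rule mult_left_mono)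
    also have "\<dots> = (1/e) powr (a / (b - a)) * (K powr 1 * K powr (a / (b - a)))"
      using K assms powr_mult[of K "1/e" "a / (b-a)"] by simp
    also have "K powr 1 * K powr (a / (b - a)) = K powr (b / (b - a))"
      using assms by (simp only: powr_add[symmetric]) (simp add: field_simps)
    finally show ?thesis using assms by (smt (verit) mult_nonneg_nonneg powr_ge_zero)
  qed
qed

text \<open>The inner product equals the right-hand side plus half of \<open>(norm a powr r - norm b
  powr r) * ((norm a)\<^sup>2 - (norm b)\<^sup>2)\<close>, whose two factors have the same
  sign.\<close>

lemma powr_vector_monotone:
  fixes a b :: "'a::real_inner" and r :: real
  assumes "r \<ge> 0"
  shows "(norm a powr r *\<^sub>R a - norm b powr r *\<^sub>R b) \<bullet> (a - b)
           \<ge> (norm a powr r + norm b powr r) / 2 * (norm (a - b))\<^sup>2"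
proof -
  have "(norm a powr r - norm b powr r) * ((norm a)\<^sup>2 - (norm b)\<^sup>2) \<ge> 0"
  proof (cases "norm a \<le> norm b")
    case True
    then show ?thesis using assms
      by (intro mult_nonpos_nonpos) (auto intro!: powr_mono2 power_mono)
  next
    case False
    then show ?thesis using assms
      by (intro mult_nonneg_nonneg) (auto intro!: powr_mono2 power_mono)
  qed
  moreover have "(norm a powr r *\<^sub>R a - norm b powr r *\<^sub>R b) \<bullet> (a - b)
      = (norm a powr r + norm b powr r) / 2 * (norm (a - b))\<^sup>2
        + (norm a powr r - norm b powr r) * ((norm a)\<^sup>2 - (norm b)\<^sup>2) / 2"
    by (simp add: power2_norm_eq_inner inner_diff_left inner_diff_right inner_commute field_simps)
  ultimately show ?thesis by simp
qed

text \<open>Mean value theorem. For \<open>r < 1\<close> the derivative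
  \<open>r * z powr (r - 1)\<close> is unbounded near 0; the extra factor \<open>s < z\<close> turns
  it into at most \<open>z powr r\<close>.\<close>

lemma powr_diff_mult_le:
  fixes s t r :: real
  assumes "0 \<le> s" "s \<le> t" "r \<ge> 0"
  shows "(t powr r - s powr r) * s \<le> r * (t powr r + s powr r) * (t - s)"
proof (cases "s = 0 \<or> s = t")
  case True
  then show ?thesis using assms by auto
next
  case False
  with assms have st: "0 < s" "s < t" by auto
  have "\<exists>z>s. z < t \<and> t powr r - s powr r = (t - s) * (r * z powr (r - 1))"
    by (rule MVT2) (use st in \<open>auto intro!: derivative_eq_intros\<close>)
  then obtain z where z: "s < z" "z < t" "t powr r - s powr r = (t - s) * (r * z powr (r - 1))"
    by blast
  have "z powr (r - 1) * s \<le> z powr (r - 1) * z" using z by (intro mult_left_mono) auto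
  also have "\<dots> = z powr r" using z st by (simp add: powr_diff)
  also have "\<dots> \<le> t powr r" using z st assms by (intro powr_mono2) auto
  also have "\<dots> \<le> t powr r + s powr r" by simp
  finally have "(t - s) * r * (z powr (r - 1) * s) \<le> (t - s) * r * (t powr r + s powr r)"
    using st assms by (intro mult_left_mono) auto
  moreover have "(t powr r - s powr r) * s = (t - s) * r * (z powr (r - 1) * s)"
    unfolding z(3) by simp
  ultimately have "(t powr r - s powr r) * s \<le> (t - s) * r * (t powr r + s powr r)" by (simp only:)
  then show ?thesis by (simp add: mult_ac)
qed

text \<open>The change of the scalar coefficient is charged to the shorter vector, where
  \<open>powr_diff_mult_le\<close> applies. The weight is that of
  \<open>powr_vector_monotone\<close>; for \<open>r = p - 2\<close> the constant is
  \<open>p - 1\<close>.\<close>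

lemma powr_vector_lipschitz:
  fixes a b :: "'a::real_inner" and r :: real
  assumes "r \<ge> 0"
  shows "norm (norm a powr r *\<^sub>R a - norm b powr r *\<^sub>R b)
           \<le> (1 + r) * (norm a powr r + norm b powr r) * norm (a - b)"
proof -
  have *: "norm (norm a powr r *\<^sub>R a - norm b powr r *\<^sub>R b)
           \<le> (1 + r) * (norm a powr r + norm b powr r) * norm (a - b)"
    if "norm b \<le> norm a" for a b :: 'a
  proof -
    have "norm a powr r *\<^sub>R a - norm b powr r *\<^sub>R b
        = norm a powr r *\<^sub>R (a - b) + (norm a powr r - norm b powr r) *\<^sub>R b"
      by (simp add: algebra_simps)
    then have "norm (norm a powr r *\<^sub>R a - norm b powr r *\<^sub>R b)
        \<le> norm a powr r * norm (a - b) + \<bar>norm a powr r - norm b powr r\<bar> * norm b"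
      using norm_triangle_ineq by (metis abs_of_nonneg norm_scaleR powr_ge_zero)
    also have "\<bar>norm a powr r - norm b powr r\<bar> = norm a powr r - norm b powr r"
      using that assms by (simp add: powr_mono2)
    also have "(norm a powr r - norm b powr r) * norm b
        \<le> r * (norm a powr r + norm b powr r) * (norm a - norm b)"
      using that assms by (intro powr_diff_mult_le) auto
    also have "\<dots> \<le> r * (norm a powr r + norm b powr r) * norm (a - b)"
      using assms norm_triangle_ineq2 by (intro mult_left_mono) auto
    also have "norm a powr r * norm (a - b) \<le> (norm a powr r + norm b powr r) * norm (a - b)"
      by (intro mult_right_mono) auto
    finally show ?thesis by (simp add: algebra_simps)
  qed
  show ?thesis
  proof (cases "norm b \<le> norm a")
    case True then show ?thesis by (rule *)
  next
    case False
    then show ?thesis using *[of a b] by (simp add: norm_minus_commute add.commute)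
  qed
qed

section \<open>Gradients and cut-off functions\<close>

lemma grad_eqI: "GDERIV f x :> D \<Longrightarrow> grad f x = D"
proof -
  assume D: "GDERIV f x :> D"
  show "grad f x = D" unfolding grad_def
  proof (rule the_equality)
    fix D' assume "GDERIV f x :> D'"
    with D have "(\<lambda>h. h \<bullet> D) = (\<lambda>h. h \<bullet> D')"
      unfolding gderiv_def by (rule has_derivative_unique)
    then show "D' = D" by (metis inner_commute vector_eq_ldot)
  qed (rule D)
qed

lemma differentiable_imp_GDERIV:
  fixes f :: "'a::euclidean_space \<Rightarrow> real"
  assumes "f differentiable (at x)"
  shows "GDERIV f x :> grad f x"
proof -
  obtain f' where f': "(f has_derivative f') (at x)" using assms by (auto simp: differentiable_def)
  then have lin: "linear f'" by (rule has_derivative_linear)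
  define D where "D = (\<Sum>b\<in>Basis. f' b *\<^sub>R b)"
  have "f' h = h \<bullet> D" for h
  proof -
    have "f' h = f' (\<Sum>b\<in>Basis. (h \<bullet> b) *\<^sub>R b)" by (simp add: euclidean_representation)
    also have "\<dots> = (\<Sum>b\<in>Basis. (h \<bullet> b) * f' b)"
      using lin by (simp add: linear_sum linear_cmul)
    also have "\<dots> = h \<bullet> D" by (simp add: D_def inner_sum_right mult.commute)
    finally show ?thesis .
  qed
  then have "f' = (\<lambda>h. h \<bullet> D)" by auto
  then have "GDERIV f x :> D" using f' by (simp add: gderiv_def)
  then show ?thesis using grad_eqI by metis
qed

lemma C1_0I:
  assumes "\<And>x. GDERIV \<phi> x :> D x" "continuous_on UNIV D" "\<And>x. x \<notin> K \<Longrightarrow> \<phi> x = 0" "compact K"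
  shows "\<phi> \<in> C1_0"
proof -
  have "grad \<phi> = D" using grad_eqI assms(1) by blast
  moreover have "\<phi> differentiable (at x)" for x
    using assms(1) unfolding gderiv_def differentiable_def by blast
  moreover have "closure {x. \<phi> x \<noteq> 0} \<subseteq> K"
    using assms(3,4) by (intro closure_minimal) (auto dest: compact_imp_closed)
  then have "compact (closure {x. \<phi> x \<noteq> 0})"
    using compact_Int_closed[OF assms(4), of "closure {x. \<phi> x \<noteq> 0}"] by (simp add: Int_absorb1)
  ultimately show ?thesis using assms(2) by (auto simp: C1_0_def)
qed

lemma C1_0_GDERIV: "\<phi> \<in> C1_0 \<Longrightarrow> GDERIV \<phi> x :> grad \<phi> x"
  by (auto simp: C1_0_def intro: differentiable_imp_GDERIV)

lemma C1_0_continuous: "\<phi> \<in> C1_0 \<Longrightarrow> continuous_on UNIV \<phi>"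
  by (auto simp: C1_0_def intro!: differentiable_imp_continuous_on differentiable_at_imp_differentiable_on)

lemma C1_0_grad_continuous: "\<phi> \<in> C1_0 \<Longrightarrow> continuous_on UNIV (grad \<phi>)"
  by (auto simp: C1_0_def)

lemma C1_0_support:
  assumes "\<phi> \<in> C1_0"
  obtains K where "compact K" "\<And>x. x \<notin> K \<Longrightarrow> \<phi> x = 0" "\<And>x. x \<notin> K \<Longrightarrow> grad \<phi> x = 0"
proof
  let ?K = "closure {x. \<phi> x \<noteq> 0}"
  show "compact ?K" using assms by (simp add: C1_0_def)
  show z: "\<phi> x = 0" if "x \<notin> ?K" for x
    using that closure_subset[of "{x. \<phi> x \<noteq> 0}"] by blast
  show "grad \<phi> x = 0" if "x \<notin> ?K" for x
  proof (rule grad_eqI)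
    have "GDERIV (\<lambda>_. 0) x :> 0" by (rule GDERIV_const)
    moreover have "open (- ?K)" by (rule open_Compl) (rule closed_closure)
    moreover have "x \<in> - ?K" using that by (simp only: Compl_iff not_False_eq_True)
    moreover have "\<And>y. y \<in> - ?K \<Longrightarrow> 0 = \<phi> y" using z by (metis ComplD)
    ultimately show "GDERIV \<phi> x :> 0" unfolding gderiv_def
      by (rule has_derivative_transform_within_open)
  qed
qed

text \<open>The squared norm makes it differentiable at the origin, and the kink on the sphere of
  radius \<open>R\<close> disappears in powers of at least 2. High powers serve as cut-offs, the
  square as mollifier.\<close>

definition bump :: "real \<Rightarrow> 'a::euclidean_space \<Rightarrow> real" where
  "bump R x = max 0 (1 - (norm x)\<^sup>2 / R\<^sup>2)"

lemma bump_nonneg [simp]: "0 \<le> bump R x" and bump_le_1 [simp]: "bump R x \<le> 1"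
  by (auto simp: bump_def)

lemma bump_eq_0: "norm x \<ge> R \<Longrightarrow> R > 0 \<Longrightarrow> bump R x = 0"
  by (auto simp: bump_def intro!: max_absorb1 power_mono)

lemma continuous_bump [continuous_intros]: "continuous_on S (bump R)"
  unfolding bump_def divide_inverse by (intro continuous_intros)

lemma bump_ge: "R > 0 \<Longrightarrow> norm x \<le> R / 2 \<Longrightarrow> bump R x \<ge> 3 / 4"
proof -
  assume R: "R > 0" "norm x \<le> R / 2"
  then have "(norm x)\<^sup>2 \<le> (R/2)\<^sup>2" by (intro power_mono) auto
  then have "(norm x)\<^sup>2 / R\<^sup>2 \<le> 1/4" using R by (simp add: field_simps power2_eq_square)
  then have "1 - (norm x)\<^sup>2 / R\<^sup>2 \<ge> 3/4" by linarith
  then show ?thesis unfolding bump_def by linarith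
qed

lemma DERIV_max_power:
  fixes t :: real
  assumes "k \<ge> 2"
  shows "((\<lambda>t. max 0 t ^ k) has_real_derivative (k * max 0 t ^ (k - 1))) (at t)"
proof -
  consider "t < 0" | "t = 0" | "t > 0" by linarith
  then show ?thesis
  proof cases
    case 1
    have "((\<lambda>t::real. 0) has_real_derivative 0) (at t)" by simp
    then have "((\<lambda>t. max 0 t ^ k) has_real_derivative 0) (at t)"
      by (rule has_field_derivative_transform_within_open[where S="{..<0}"]) (use 1 assms in \<open>auto simp: max_def\<close>)
    moreover have "real k * max 0 t ^ (k - 1) = 0" using 1 assms by simp
    ultimately show ?thesis by (simp only:)
  next
    case 3
    have "((\<lambda>t. t ^ k) has_real_derivative (k * t ^ (k - 1))) (at t)"
      by (auto intro!: derivative_eq_intros)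
    then have "((\<lambda>t. max 0 t ^ k) has_real_derivative (k * t ^ (k - 1))) (at t)"
      by (rule has_field_derivative_transform_within_open[where S="{0<..}"]) (use 3 assms in \<open>auto simp: max_def\<close>)
    then show ?thesis using 3 by simp
  next
    case 2
    \<comment> \<open>At the kink the difference quotient is at most
      \<open>\<bar>h\<bar> ^ (k - 1)\<close>, which tends to 0 because \<open>k\<close> is at least
      2.\<close>
    have "((\<lambda>h::real. max 0 h ^ k / h) \<longlongrightarrow> 0) (at 0)"
    proof (rule Lim_null_comparison[where g="\<lambda>h. \<bar>h\<bar> ^ (k - 1)"])
      show "\<forall>\<^sub>F h in at 0. norm (max 0 h ^ k / h) \<le> \<bar>h\<bar> ^ (k - 1)"
      proof (rule always_eventually, rule allI)
        fix h :: real
        have "\<bar>h\<bar> ^ k = \<bar>h\<bar> * \<bar>h\<bar> ^ (k - 1)" using assms by (simp add: power_eq_if)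
        then show "norm (max 0 h ^ k / h) \<le> \<bar>h\<bar> ^ (k - 1)"
          using assms by (cases "h > 0") (auto simp: max_def power_0_left)
      qed
      have "((\<lambda>h::real. \<bar>h\<bar> ^ (k - 1)) \<longlongrightarrow> \<bar>0\<bar> ^ (k - 1)) (at 0)" by (intro tendsto_intros)
      moreover have "\<bar>0::real\<bar> ^ (k - 1) = 0" using assms by (auto simp: power_0_left)
      ultimately show "((\<lambda>h::real. \<bar>h\<bar> ^ (k - 1)) \<longlongrightarrow> 0) (at 0)" by (simp only:)
    qed
    moreover have "max 0 (0::real) ^ k = 0" "real k * max 0 0 ^ (k - 1) = 0"
      using assms by (auto simp: power_0_left)
    ultimately show ?thesis unfolding DERIV_def 2 by (simp only: diff_zero add_0_left)
  qed
qed

lemma GDERIV_bump_power: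
  assumes "k \<ge> 2"
  shows "GDERIV (\<lambda>x. bump R x ^ k) x :> (- (2 * real k / R\<^sup>2) * bump R x ^ (k - 1)) *\<^sub>R x"
proof -
  have "((\<lambda>x. 1 - c * (x \<bullet> x)) has_derivative (\<lambda>h. h \<bullet> ((- 2 * c) *\<^sub>R x))) (at x)" for c :: real
    by (auto intro!: derivative_eq_intros simp: inner_commute fun_eq_iff)
  from this[of "inverse (R\<^sup>2)"]
  have "GDERIV (\<lambda>x. 1 - (norm x)\<^sup>2 / R\<^sup>2) x :> (- 2 / R\<^sup>2) *\<^sub>R x"
    by (simp add: gderiv_def power2_norm_eq_inner divide_inverse mult.commute)
  from GDERIV_DERIV_compose[OF this DERIV_max_power[OF assms]]
  have "GDERIV (\<lambda>x. bump R x ^ k) x :> (real k * bump R x ^ (k - 1)) *\<^sub>R ((- 2 / R\<^sup>2) *\<^sub>R x)"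
    unfolding bump_def .
  moreover have "(real k * m) *\<^sub>R ((- 2 / R\<^sup>2) *\<^sub>R x) = (- (2 * real k / R\<^sup>2) * m) *\<^sub>R x" for m
    by (simp add: mult_ac)
  ultimately show ?thesis by (simp only:)
qed

lemma grad_bump_power:
  "k \<ge> 2 \<Longrightarrow> grad (\<lambda>x. bump R x ^ k) x = (- (2 * real k / R\<^sup>2) * bump R x ^ (k - 1)) *\<^sub>R x"
  by (rule grad_eqI) (rule GDERIV_bump_power)

lemma bump_power_C1_0:
  assumes "k \<ge> 2" "R > 0"
  shows "(\<lambda>x::'a::euclidean_space. bump R x ^ k) \<in> C1_0"
proof (rule C1_0I[OF GDERIV_bump_power[OF assms(1)]])
  show "bump R x ^ k = 0" if "x \<notin> cball 0 R" for x :: 'a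
    using that assms by (auto simp: bump_eq_0)
  show "continuous_on UNIV (\<lambda>x. (- (2 * real k / R\<^sup>2) * bump R x ^ (k - 1)) *\<^sub>R x)"
    by (intro continuous_intros)
qed simp

text \<open>On the support \<open>norm x\<close> is at most \<open>R\<close>, which cancels one
  factor \<open>R\<close>. Differentiation thus gains \<open>1 / R\<close> and costs one power of
  the bump.\<close>

lemma norm_grad_bump_power_le:
  fixes x :: "'a::euclidean_space"
  assumes "k \<ge> 2" "R > 0"
  shows "norm (grad (\<lambda>x. bump R x ^ k) x) \<le> 2 * real k / R * bump R x ^ (k - 1)"
proof (cases "norm x \<le> R")
  case True
  have "norm (grad (\<lambda>x. bump R x ^ k) x) = 2 * real k / R\<^sup>2 * bump R x ^ (k - 1) * norm x"
    unfolding grad_bump_power[OF assms(1)] norm_scaleR by (simp only: abs_mult abs_minus) simp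
  also have "\<dots> \<le> 2 * real k / R\<^sup>2 * bump R x ^ (k - 1) * R"
    using True by (intro mult_left_mono) auto
  also have "\<dots> = 2 * real k / R * bump R x ^ (k - 1)"
    using assms by (simp add: power2_eq_square)
  finally show ?thesis .
next
  case False
  then have "bump R x ^ (k - 1) = 0" using assms by (simp add: bump_eq_0)
  then show ?thesis unfolding grad_bump_power[OF assms(1)] by (simp only: mult_zero_right scaleR_zero_left norm_zero)
qed


section \<open>Mollification\<close>

lemma L_loc_1_iff:
  "f \<in> L_loc 1 \<longleftrightarrow> f \<in> borel_measurable lebesgue \<and> (\<forall>K. compact K \<longrightarrow> set_integrable lebesgue K f)"
proof -
  have "set_integrable lebesgue K (\<lambda>x. norm (f x) powr 1) \<longleftrightarrow> set_integrable lebesgue K f"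
    if "f \<in> borel_measurable lebesgue" "compact K" for K
  proof -
    have [measurable]: "f \<in> borel_measurable lebesgue" "K \<in> sets lebesgue"
      using that by (auto simp: borel_compact)
    show ?thesis
      unfolding set_integrable_def
      by (subst integrable_norm_iff[symmetric, of "\<lambda>x. indicator K x *\<^sub>R f x"]) auto
  qed
  then show ?thesis by (auto simp: L_loc_def)
qed

lemma L_loc_measurable: "f \<in> L_loc r \<Longrightarrow> f \<in> borel_measurable lebesgue"
  by (simp add: L_loc_def)

lemma L_loc_1_integrable_mult:
  fixes f :: "'a::euclidean_space \<Rightarrow> 'b::euclidean_space"
  assumes f: "f \<in> L_loc 1" and b: "b \<in> borel_measurable lebesgue" "\<And>x. \<bar>b x\<bar> \<le> C"
    and K: "compact K" "\<And>x. x \<notin> K \<Longrightarrow> b x = 0"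
  shows "integrable lebesgue (\<lambda>x. b x *\<^sub>R f x)"
proof (rule Bochner_Integration.integrable_bound)
  show "integrable lebesgue (\<lambda>x. C *\<^sub>R (indicator K x *\<^sub>R f x))"
    using f K by (intro integrable_scaleR_right) (auto simp: L_loc_1_iff set_integrable_def)
  show "(\<lambda>x. b x *\<^sub>R f x) \<in> borel_measurable lebesgue"
    using f b by (auto simp: L_loc_1_iff)
  have "0 \<le> C" using b(2) abs_ge_zero order_trans by blast
  then show "AE x in lebesgue. norm (b x *\<^sub>R f x) \<le> norm (C *\<^sub>R (indicator K x *\<^sub>R f x))"
    using b(2) K(2) by (intro AE_I2) (auto simp: indicator_def intro!: mult_right_mono)
qed

lemma continuous_imp_lebesgue_measurable:
  fixes f :: "'a::euclidean_space \<Rightarrow> 'b::euclidean_space"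
  shows "continuous_on UNIV f \<Longrightarrow> f \<in> borel_measurable lebesgue"
  by (intro measurable_completion) (simp add: borel_measurable_continuous_onI)

lemma integrable_imp_L_loc_1:
  fixes f :: "'a::euclidean_space \<Rightarrow> 'b::euclidean_space"
  assumes "integrable lebesgue f"
  shows "f \<in> L_loc 1"
  unfolding L_loc_1_iff set_integrable_def
  using assms by (auto simp: borel_compact intro!: integrable_mult_indicator)

lemma L_loc_1_indicator_integrable:
  "f \<in> L_loc 1 \<Longrightarrow> compact K \<Longrightarrow> integrable lebesgue (\<lambda>x. indicator K x *\<^sub>R f x)"
  by (auto simp: L_loc_1_iff set_integrable_def)

lemma integrable_bump_power:
  assumes "e > 0" "k \<ge> 1"
  shows "integrable lebesgue (\<lambda>x::'a::euclidean_space. bump e x ^ k)"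
proof (rule Bochner_Integration.integrable_bound)
  show "integrable lebesgue (indicator (cball 0 e) :: 'a \<Rightarrow> real)"
    by (simp add: integrable_indicator_iff emeasure_bounded_finite[unfolded infinity_ennreal_def])
  show "(\<lambda>x. bump e x ^ k) \<in> borel_measurable lebesgue"
    by (intro continuous_imp_lebesgue_measurable continuous_intros)
  show "AE x in lebesgue. norm (bump e x ^ k) \<le> norm (indicator (cball (0::'a) e) x :: real)"
    using assms by (intro AE_I2) (auto simp: indicator_def bump_eq_0 power_le_one power_0_left)
qed

text \<open>The type argument carries the space, on which the mass depends and which
  \<open>e\<close> does not determine.\<close>

definition bump_mass :: "'a::euclidean_space itself \<Rightarrow> real \<Rightarrow> real" where
  "bump_mass _ e = (LINT z|lebesgue. bump e (z::'a) ^ 2)"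

lemma bump_mass_pos:
  assumes "e > 0"
  shows "bump_mass TYPE('a::euclidean_space) e > 0"
proof -
  \<comment> \<open>\<open>9/16\<close> is the square of the lower bound \<open>3/4\<close> that
    holds on the ball of half the radius.\<close>
  have "0 < (9/16) * measure lebesgue (ball (0::'a) (e/2))"
    using assms by (simp add: content_ball_pos)
  also have "\<dots> = (LINT z|lebesgue. (9/16) * indicator (ball (0::'a) (e/2)) z)"
    by simp
  also have "\<dots> \<le> bump_mass TYPE('a) e" unfolding bump_mass_def
  proof (rule integral_mono)
    show "integrable lebesgue (\<lambda>z. (9/16) * indicator (ball (0::'a) (e/2)) z :: real)"
      by (intro integrable_mult_right) (simp add: integrable_indicator_iff emeasure_bounded_finite[unfolded infinity_ennreal_def])
    show "integrable lebesgue (\<lambda>x::'a. bump e x ^ 2)"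
      using assms by (intro integrable_bump_power) auto
    show "(9/16) * indicator (ball (0::'a) (e/2)) z \<le> bump e z ^ 2" for z :: 'a
    proof (cases "z \<in> ball 0 (e/2)")
      case True
      then have "(3/4)^2 \<le> bump e z ^ 2" using assms by (intro power_mono bump_ge) auto
      then show ?thesis using True by (simp add: power2_eq_square)
    qed simp
  qed
  finally show ?thesis .
qed

text \<open>A kernel that is only C^1 is enough, since weak gradients are tested against all of
  \<open>C1_0\<close>.\<close>

definition mollifier :: "real \<Rightarrow> 'a::euclidean_space \<Rightarrow> real" where
  "mollifier e z = bump e z ^ 2 / bump_mass TYPE('a) e"

definition mollify :: "real \<Rightarrow> ('a::euclidean_space \<Rightarrow> 'b::euclidean_space) \<Rightarrow> 'a \<Rightarrow> 'b" where
  "mollify e f x = (LINT y|lebesgue. mollifier e (x - y) *\<^sub>R f y)"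

lemma mollifier_nonneg: "e > 0 \<Longrightarrow> 0 \<le> mollifier e z"
  using bump_mass_pos by (auto simp: mollifier_def intro!: divide_nonneg_pos)

lemma mollifier_eq_0: "e > 0 \<Longrightarrow> norm z \<ge> e \<Longrightarrow> mollifier e z = 0"
  by (simp add: mollifier_def bump_eq_0)

lemma mollifier_minus: "mollifier e (x - y) = mollifier e (y - x)"
  by (simp add: mollifier_def bump_def norm_minus_commute)

lemma mollifier_le: "e > 0 \<Longrightarrow> \<bar>mollifier e (z::'a::euclidean_space)\<bar> \<le> 1 / bump_mass TYPE('a) e"
  using bump_mass_pos[where 'a='a, of e] by (simp add: mollifier_def power_le_one divide_right_mono)

lemma continuous_mollifier:
  assumes "continuous_on S f"
  shows "continuous_on S (\<lambda>x. mollifier e (f x))"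
  unfolding mollifier_def divide_inverse bump_def
  using assms by (intro continuous_intros)

lemma measurable_mollifier_diff: "(\<lambda>y. mollifier e (x - y)) \<in> borel_measurable lebesgue"
  by (intro continuous_imp_lebesgue_measurable continuous_mollifier continuous_intros)

lemma integrable_mollifier_scaleR:
  fixes f :: "'a::euclidean_space \<Rightarrow> 'b::euclidean_space"
  assumes "f \<in> L_loc 1" "e > 0"
  shows "integrable lebesgue (\<lambda>y. mollifier e (x - y) *\<^sub>R f y)"
proof (rule L_loc_1_integrable_mult[where K="cball x e"])
  show "mollifier e (x - y) = 0" if "y \<notin> cball x e" for y
    using that assms by (auto simp: dist_norm intro!: mollifier_eq_0)
qed (use assms mollifier_le measurable_mollifier_diff in auto)

lemma nn_integral_lborel_diff:
  fixes f :: "'a::euclidean_space \<Rightarrow> ennreal"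
  assumes [measurable]: "f \<in> borel_measurable borel"
  shows "(\<integral>\<^sup>+x. f (x - y) \<partial>lborel) = (\<integral>\<^sup>+x. f x \<partial>lborel)"
proof -
  have "(\<integral>\<^sup>+x. f x \<partial>lborel) = (\<integral>\<^sup>+x. f x \<partial>distr lborel borel ((+) (- y)))"
    by (simp add: lborel_distr_plus)
  also have "\<dots> = (\<integral>\<^sup>+x. f (- y + x) \<partial>lborel)"
    by (rule nn_integral_distr) auto
  finally show ?thesis by simp
qed

lemma borel_mollifier [measurable]: "mollifier e \<in> borel_measurable borel"
  using continuous_mollifier[of UNIV "\<lambda>x. x" e] by (auto intro: borel_measurable_continuous_onI)

lemma nn_integral_mollifier:
  assumes "e > 0"
  shows "(\<integral>\<^sup>+x. mollifier e (x - y) \<partial>lborel) = 1"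
proof -
  have "(\<integral>\<^sup>+x. ennreal (mollifier e (x - y)) \<partial>lborel) = (\<integral>\<^sup>+x. ennreal (mollifier e (x::'a)) \<partial>lborel)"
    by (rule nn_integral_lborel_diff) simp
  also have "\<dots> = (\<integral>\<^sup>+x. ennreal (mollifier e (x::'a)) \<partial>lebesgue)"
    by (simp add: nn_integral_completion)
  also have "\<dots> = ennreal (LINT x|lebesgue. mollifier e (x::'a))"
  proof (rule nn_integral_eq_integral)
    show "integrable lebesgue (mollifier e :: 'a \<Rightarrow> real)"
      unfolding mollifier_def using assms by (intro integrable_divide integrable_bump_power) auto
  qed (use assms mollifier_nonneg in auto)
  also have "(LINT x|lebesgue. mollifier e (x::'a)) = 1"
    unfolding mollifier_def using bump_mass_pos[where 'a='a, OF assms]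
    by (simp add: bump_mass_def)
  finally show ?thesis by simp
qed

lemma integral_mollifier:
  assumes "e > 0"
  shows "integrable lebesgue (\<lambda>y. mollifier e (x - y))" "(LINT y|lebesgue. mollifier e (x - y)) = 1"
proof -
  have "(\<integral>\<^sup>+y. mollifier e (x - y) \<partial>lebesgue) = ennreal 1"
    using nn_integral_mollifier[OF assms, of x]
    by (simp add: nn_integral_completion mollifier_minus[of e x])
  then show "integrable lebesgue (\<lambda>y. mollifier e (x - y))" "(LINT y|lebesgue. mollifier e (x - y)) = 1"
    using nn_integral_eq_integrable[of "\<lambda>y. mollifier e (x - y)" lebesgue 1] measurable_mollifier_diff assms
    by (auto simp: mollifier_nonneg)
qed

section \<open>Continuity, gradient and L1 bound of mollifications\<close>

definition mollifier_grad :: "real \<Rightarrow> 'a::euclidean_space \<Rightarrow> 'a" where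
  "mollifier_grad e z = (- (4 / e\<^sup>2) * bump e z / bump_mass TYPE('a) e) *\<^sub>R z"

lemma GDERIV_mollifier_diff:
  "GDERIV (\<lambda>y. mollifier e (x - y)) y :> - mollifier_grad e (x - y)"
proof -
  have "((\<lambda>z. bump e z ^ 2) has_derivative (\<lambda>h. h \<bullet> ((- (2 * real 2 / e\<^sup>2) * bump e (x - y) ^ (2 - 1)) *\<^sub>R (x - y)))) (at (x - y))"
    using GDERIV_bump_power[of 2 e "x - y"] by (simp add: gderiv_def)
  moreover have "((\<lambda>y. x - y) has_derivative (\<lambda>h. - h)) (at y)"
    by (auto intro!: derivative_eq_intros)
  ultimately have "((\<lambda>y. bump e (x - y) ^ 2) has_derivative
      (\<lambda>h. (- h) \<bullet> ((- (2 * real 2 / e\<^sup>2) * bump e (x - y) ^ (2 - 1)) *\<^sub>R (x - y)))) (at y)"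
    using has_derivative_compose[of "\<lambda>y. x - y" "\<lambda>h. - h" y UNIV "\<lambda>z. bump e z ^ 2"] by blast
  then have "((\<lambda>y. inverse (bump_mass TYPE('a) e) * bump e (x - y) ^ 2) has_derivative
      (\<lambda>h. inverse (bump_mass TYPE('a) e) * ((- h) \<bullet> ((- (2 * real 2 / e\<^sup>2) * bump e (x - y) ^ (2 - 1)) *\<^sub>R (x - y))))) (at y)"
    by (rule has_derivative_mult_right)
  then show ?thesis
    by (simp add: gderiv_def mollifier_def mollifier_grad_def divide_inverse mult_ac)
qed

lemma continuous_mollifier_grad: "continuous_on S f \<Longrightarrow> continuous_on S (\<lambda>x. mollifier_grad e (f x))"
  unfolding mollifier_grad_def divide_inverse bump_def by (intro continuous_intros)

lemma mollifier_diff_C1_0: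
  assumes "e > 0"
  shows "(\<lambda>y. mollifier e (x - y)) \<in> C1_0"
proof (rule C1_0I[OF GDERIV_mollifier_diff])
  show "mollifier e (x - y) = 0" if "y \<notin> cball x e" for y
    using that assms by (auto simp: dist_norm intro!: mollifier_eq_0)
  show "continuous_on UNIV (\<lambda>y. - mollifier_grad e (x - y))"
    by (intro continuous_intros continuous_mollifier_grad)
qed simp

lemma norm_mollifier_grad_le:
  assumes "e > 0"
  shows "norm (mollifier_grad e (z::'a::euclidean_space)) \<le> 4 / e / bump_mass TYPE('a) e"
proof (cases "norm z \<le> e")
  case True
  have "bump e z * norm z \<le> 1 * e" using True assms by (intro mult_mono) auto
  then have "4 / e\<^sup>2 / bump_mass TYPE('a) e * (bump e z * norm z) \<le> 4 / e\<^sup>2 / bump_mass TYPE('a) e * e"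
    using bump_mass_pos[where 'a='a, OF assms] by (intro mult_left_mono) auto
  moreover have "norm (mollifier_grad e z) = 4 / e\<^sup>2 / bump_mass TYPE('a) e * (bump e z * norm z)"
    using bump_mass_pos[where 'a='a, OF assms] by (simp add: mollifier_grad_def abs_mult)
  moreover have "4 / e\<^sup>2 / bump_mass TYPE('a) e * e = 4 / e / bump_mass TYPE('a) e"
    using assms by (simp add: power2_eq_square)
  ultimately show ?thesis by simp
next
  case False
  then show ?thesis using assms bump_mass_pos[where 'a='a, OF assms]
    by (simp add: mollifier_grad_def bump_eq_0)
qed

text \<open>The derivative \<open>2 * max 0 t\<close> is Lipschitz with constant 2, so the
  first-order Taylor error stays below \<open>s\<^sup>2\<close> even across the kink.\<close>

lemma max_square_remainder:
  fixes s t :: real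
  shows "\<bar>max 0 (t + s) ^ 2 - max 0 t ^ 2 - 2 * max 0 t * s\<bar> \<le> s\<^sup>2"
proof -
  consider "0 \<le> t" "0 \<le> t + s" | "0 \<le> t" "t + s < 0" | "t < 0" "0 \<le> t + s" | "t < 0" "t + s < 0"
    by linarith
  then show ?thesis
  proof cases
    case 1 then show ?thesis by (simp add: max_def power2_eq_square algebra_simps)
  next
    case 2
    have "0 \<le> (t + s)\<^sup>2" by simp
    then have a: "- s\<^sup>2 \<le> t\<^sup>2 + 2 * t * s" by (simp add: power2_eq_square algebra_simps)
    have "t * (t + 2 * s) \<le> 0" using 2 by (intro mult_nonneg_nonpos) auto
    then have b: "t\<^sup>2 + 2 * t * s \<le> 0" by (simp add: power2_eq_square algebra_simps)
    have "max 0 (t + s) = 0" "max 0 t = t" using 2 by auto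
    then show ?thesis using a b by simp
  next
    case 3
    have "(t + s)\<^sup>2 \<le> s\<^sup>2" using 3 by (intro power_mono) auto
    then show ?thesis using 3 by (simp add: max_def)
  next
    case 4 then show ?thesis by (simp add: max_def)
  qed
qed

text \<open>A Taylor error that is quadratic in \<open>h\<close>, uniform in \<open>z\<close> and
  supported in a fixed ball. Integrated against a locally integrable function, it differentiates the
  mollification directly. The radius \<open>e + 1\<close> accommodates shifts of norm at most
  1.\<close>

lemma mollifier_remainder:
  assumes e: "e > 0"
  obtains C where "C \<ge> 0" "\<And>z h::'a::euclidean_space. norm h \<le> 1 \<Longrightarrow>
    \<bar>mollifier e (z + h) - mollifier e z - h \<bullet> mollifier_grad e z\<bar> \<le> C * (norm h)\<^sup>2 * indicator (cball 0 (e + 1)) z"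
proof
  define c where "c = bump_mass TYPE('a) e"
  have c: "c > 0" using bump_mass_pos e unfolding c_def by blast
  \<comment> \<open>The first summand bounds \<open>s\<^sup>2\<close> below through
    \<open>norm z \<le> e + 1\<close> and \<open>norm h \<le> 1\<close>; the second pays for the
    quadratic part of \<open>s\<close>, which the gradient term does not contain.\<close>
  define B where "B = ((2 * (e + 1) + 1) / e\<^sup>2)\<^sup>2 + 2 / e\<^sup>2"
  show "0 \<le> B / c" using c by (simp add: B_def)
  fix z h :: 'a assume h: "norm h \<le> 1"
  show "\<bar>mollifier e (z + h) - mollifier e z - h \<bullet> mollifier_grad e z\<bar> \<le> B / c * (norm h)\<^sup>2 * indicator (cball 0 (e + 1)) z"
  proof (cases "z \<in> cball 0 (e + 1)")
    case False
    then have "norm z > e + 1" by simp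
    moreover then have "norm (z + h) \<ge> e" using h norm_triangle_ineq4[of "z + h" h] by simp
    ultimately show ?thesis using e by (simp add: mollifier_eq_0 mollifier_grad_def bump_eq_0)
  next
    case True
    \<comment> \<open>Before truncation the bump has value \<open>t\<close> at \<open>z\<close> and
      \<open>t + s\<close> at \<open>z + h\<close>, so the remainder becomes that of the
      one-variable function \<open>max 0 t ^ 2\<close>.\<close>
    define t where "t = 1 - (norm z)\<^sup>2 / e\<^sup>2"
    define s where "s = - (2 * (z \<bullet> h) + (norm h)\<^sup>2) / e\<^sup>2"
    have ts: "t + s = 1 - (norm (z + h))\<^sup>2 / e\<^sup>2"
      by (simp add: t_def s_def power2_norm_eq_inner inner_add_left inner_add_right inner_commute
          add_divide_distrib diff_divide_distrib)
    have zh: "\<bar>z \<bullet> h\<bar> \<le> (e + 1) * norm h"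
      using True Cauchy_Schwarz_ineq2[of z h] mult_right_mono[of "norm z" "e + 1" "norm h"] by simp
    have hh: "(norm h)\<^sup>2 \<le> norm h" using h by (simp add: power2_eq_square mult_left_le)
    have "\<bar>2 * (z \<bullet> h) + (norm h)\<^sup>2\<bar> \<le> 2 * \<bar>z \<bullet> h\<bar> + (norm h)\<^sup>2"
      using abs_triangle_ineq[of "2 * (z \<bullet> h)" "(norm h)\<^sup>2"] by (simp add: abs_mult)
    also have "\<dots> \<le> 2 * ((e + 1) * norm h) + norm h" using zh hh by simp
    also have "\<dots> = (2 * (e + 1) + 1) * norm h" by (simp add: algebra_simps)
    finally have "\<bar>2 * (z \<bullet> h) + (norm h)\<^sup>2\<bar> \<le> (2 * (e + 1) + 1) * norm h" .
    then have "\<bar>s\<bar> \<le> (2 * (e + 1) + 1) / e\<^sup>2 * norm h"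
      by (simp add: s_def abs_divide divide_right_mono)
    then have s2: "s\<^sup>2 \<le> ((2 * (e + 1) + 1) / e\<^sup>2)\<^sup>2 * (norm h)\<^sup>2"
      using power_mono[of "\<bar>s\<bar>" "(2 * (e + 1) + 1) / e\<^sup>2 * norm h" 2]
      by (simp only: power_mult_distrib power2_abs abs_ge_zero)
    have bt: "bump e z = max 0 t" "bump e (z + h) = max 0 (t + s)"
      unfolding ts by (simp_all add: bump_def t_def)
    have hg: "h \<bullet> mollifier_grad e z = (2 * max 0 t * s + 2 * max 0 t * ((norm h)\<^sup>2 / e\<^sup>2)) / c"
      using e by (simp add: mollifier_grad_def bt c_def[symmetric] s_def inner_commute add_divide_distrib
          diff_divide_distrib algebra_simps)
    have "mollifier e (z + h) - mollifier e z - h \<bullet> mollifier_grad e z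
        = ((max 0 (t + s) ^ 2 - max 0 t ^ 2 - 2 * max 0 t * s) - 2 * max 0 t * ((norm h)\<^sup>2 / e\<^sup>2)) / c"
      unfolding hg mollifier_def bt c_def[symmetric] by (simp add: diff_divide_distrib add_divide_distrib)
    also have "\<bar>\<dots>\<bar> = \<bar>(max 0 (t + s) ^ 2 - max 0 t ^ 2 - 2 * max 0 t * s) - 2 * max 0 t * ((norm h)\<^sup>2 / e\<^sup>2)\<bar> / c"
      using c by (simp add: abs_divide)
    also have "\<dots> \<le> (B * (norm h)\<^sup>2) / c"
    proof (rule divide_right_mono)
      have "2 * max 0 t * ((norm h)\<^sup>2 / e\<^sup>2) \<le> 2 * 1 * ((norm h)\<^sup>2 / e\<^sup>2)"
        unfolding bt(1)[symmetric] by (intro mult_right_mono mult_left_mono bump_le_1) auto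
      moreover have "0 \<le> 2 * max 0 t * ((norm h)\<^sup>2 / e\<^sup>2)" by simp
      moreover have "B * (norm h)\<^sup>2 = ((2 * (e + 1) + 1) / e\<^sup>2)\<^sup>2 * (norm h)\<^sup>2 + 2 * 1 * ((norm h)\<^sup>2 / e\<^sup>2)"
        by (simp add: B_def algebra_simps)
      ultimately show "\<bar>(max 0 (t + s) ^ 2 - max 0 t ^ 2 - 2 * max 0 t * s) - 2 * max 0 t * ((norm h)\<^sup>2 / e\<^sup>2)\<bar> \<le> B * (norm h)\<^sup>2"
        using max_square_remainder[of t s] s2 by linarith
    qed (use c in simp)
    finally show ?thesis using True by simp
  qed
qed


lemma mollify_shift_diff:
  fixes f :: "'a::euclidean_space \<Rightarrow> 'b::euclidean_space"
  assumes f: "f \<in> L_loc 1" and e: "e > 0"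
  shows "mollify e f (x + h) - mollify e f x = (LINT y|lebesgue. (mollifier e (x - y + h) - mollifier e (x - y)) *\<^sub>R f y)"
proof -
  have "mollify e f (x + h) - mollify e f x
      = (LINT y|lebesgue. mollifier e (x + h - y) *\<^sub>R f y - mollifier e (x - y) *\<^sub>R f y)"
    unfolding mollify_def
    by (rule Bochner_Integration.integral_diff[symmetric]; rule integrable_mollifier_scaleR[OF f e])
  also have "\<dots> = (LINT y|lebesgue. (mollifier e (x - y + h) - mollifier e (x - y)) *\<^sub>R f y)"
    by (rule Bochner_Integration.integral_cong) (simp_all add: scaleR_diff_left algebra_simps)
  finally show ?thesis .
qed

lemma indicator_cball_diff: "indicator (cball 0 r) (x - y) = (indicator (cball x r) y :: real)"
  for x y :: "'a::euclidean_space"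
  by (simp add: indicator_def dist_norm norm_minus_commute)

lemma integrable_mollifier_grad_scaleR:
  fixes w :: "'a::euclidean_space \<Rightarrow> real"
  assumes w: "w \<in> L_loc 1" and e: "e > 0"
  shows "integrable lebesgue (\<lambda>y. w y *\<^sub>R mollifier_grad e (x - y))"
proof (rule Bochner_Integration.integrable_bound)
  show "integrable lebesgue (\<lambda>y. (4 / e / bump_mass TYPE('a) e) *\<^sub>R (indicator (cball x e) y *\<^sub>R w y))"
    using w by (intro integrable_scaleR_right L_loc_1_indicator_integrable) auto
  have "(\<lambda>y. mollifier_grad e (x - y)) \<in> borel_measurable lebesgue"
    by (intro continuous_imp_lebesgue_measurable continuous_mollifier_grad continuous_intros)
  then show "(\<lambda>y. w y *\<^sub>R mollifier_grad e (x - y)) \<in> borel_measurable lebesgue"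
    using w by (auto simp: L_loc_1_iff)
  have "norm (w y *\<^sub>R mollifier_grad e (x - y)) \<le> norm ((4 / e / bump_mass TYPE('a) e) *\<^sub>R (indicator (cball x e) y *\<^sub>R w y))" for y
  proof (cases "y \<in> cball x e")
    case True
    have "\<bar>w y\<bar> * norm (mollifier_grad e (x - y)) \<le> \<bar>w y\<bar> * (4 / e / bump_mass TYPE('a) e)"
      by (intro mult_left_mono norm_mollifier_grad_le e) auto
    then show ?thesis using True e bump_mass_pos[where 'a='a, OF e] by (simp add: abs_mult mult.commute)
  next
    case False
    then have "bump e (x - y) = 0" using e by (intro bump_eq_0) (auto simp: dist_norm)
    then show ?thesis by (simp add: mollifier_grad_def)
  qed
  then show "AE y in lebesgue. norm (w y *\<^sub>R mollifier_grad e (x - y))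
      \<le> norm ((4 / e / bump_mass TYPE('a) e) *\<^sub>R (indicator (cball x e) y *\<^sub>R w y))"
    by (rule AE_I2)
qed

text \<open>For shifts of norm at most 1 the kernel is Lipschitz with constant \<open>D\<close>, the
  Taylor error plus the gradient bound. Hence the mollification is Lipschitz near each point, with
  the integral of \<open>norm f\<close> over a ball as a factor.\<close>

lemma continuous_mollify:
  fixes f :: "'a::euclidean_space \<Rightarrow> 'b::euclidean_space"
  assumes f: "f \<in> L_loc 1" and e: "e > 0"
  shows "continuous_on UNIV (mollify e f)"
proof -
  obtain C where C: "C \<ge> 0" "\<And>z h::'a. norm h \<le> 1 \<Longrightarrow>
    \<bar>mollifier e (z + h) - mollifier e z - h \<bullet> mollifier_grad e z\<bar> \<le> C * (norm h)\<^sup>2 * indicator (cball 0 (e + 1)) z"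
    by (rule mollifier_remainder[OF e]) blast
  define D where "D = C + 4 / e / bump_mass TYPE('a) e"
  have bound: "\<bar>mollifier e (z + h) - mollifier e z\<bar> \<le> D * norm h * indicator (cball 0 (e + 1)) z"
    if h: "norm h \<le> 1" for z h :: 'a
  proof (cases "z \<in> cball 0 (e + 1)")
    case True
    have "(norm h)\<^sup>2 \<le> norm h" using h by (simp add: power2_eq_square mult_left_le)
    then have "C * (norm h)\<^sup>2 \<le> C * norm h" using C by (intro mult_left_mono)
    moreover have "\<bar>h \<bullet> mollifier_grad e z\<bar> \<le> norm h * (4 / e / bump_mass TYPE('a) e)"
      using Cauchy_Schwarz_ineq2[of h "mollifier_grad e z"]
        mult_left_mono[OF norm_mollifier_grad_le[OF e, of z] norm_ge_zero[of h]] by linarith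
    moreover have "\<bar>mollifier e (z + h) - mollifier e z - h \<bullet> mollifier_grad e z\<bar> \<le> C * (norm h)\<^sup>2"
      using C(2)[OF h, of z] True by simp
    ultimately have "\<bar>mollifier e (z + h) - mollifier e z\<bar> \<le> C * norm h + norm h * (4 / e / bump_mass TYPE('a) e)"
      by linarith
    then show ?thesis using True by (simp add: D_def algebra_simps)
  next
    case False
    then have "norm z > e + 1" by simp
    moreover then have "norm (z + h) \<ge> e" using h norm_triangle_ineq4[of "z + h" h] by simp
    ultimately show ?thesis using e False by (simp add: mollifier_eq_0)
  qed
  have "isCont (mollify e f) x" for x
  proof -
    define I where "I = (LINT y|lebesgue. indicator (cball x (e + 1)) y * norm (f y))"
    have int: "integrable lebesgue (\<lambda>y. indicator (cball x (e + 1)) y * norm (f y))"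
      using integrable_norm[OF L_loc_1_indicator_integrable[OF f compact_cball[of x "e + 1"]]] by simp
    have "norm (mollify e f (x + h) - mollify e f x) \<le> D * I * norm h" if h: "norm h \<le> 1" for h
    proof -
      have "norm (mollify e f (x + h) - mollify e f x)
          \<le> (LINT y|lebesgue. D * norm h * (indicator (cball x (e + 1)) y * norm (f y)))"
        unfolding mollify_shift_diff[OF f e]
      proof (rule Bochner_Integration.integral_norm_bound_integral)
        have "integrable lebesgue (\<lambda>y. mollifier e (x + h - y) *\<^sub>R f y - mollifier e (x - y) *\<^sub>R f y)"
          by (rule Bochner_Integration.integrable_diff; rule integrable_mollifier_scaleR[OF f e])
        then show "integrable lebesgue (\<lambda>y. (mollifier e (x - y + h) - mollifier e (x - y)) *\<^sub>R f y)"
          by (simp add: scaleR_diff_left algebra_simps)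
        show "integrable lebesgue (\<lambda>y. D * norm h * (indicator (cball x (e + 1)) y * norm (f y)))"
          using int by (rule integrable_mult_right)
        show "norm ((mollifier e (x - y + h) - mollifier e (x - y)) *\<^sub>R f y)
            \<le> D * norm h * (indicator (cball x (e + 1)) y * norm (f y))" for y
          using mult_right_mono[OF bound[OF h, of "x - y"] norm_ge_zero[of "f y"]]
          by (simp add: indicator_cball_diff mult_ac)
      qed
      then show ?thesis unfolding integral_mult_right_zero I_def[symmetric] by (simp add: mult_ac)
    qed
    then have "\<forall>\<^sub>F h in at 0. norm (mollify e f (x + h) - mollify e f x) \<le> D * I * norm h"
      unfolding eventually_at by (intro exI[of _ 1]) auto
    moreover have "((\<lambda>h::'a. D * I * norm h) \<longlongrightarrow> 0) (at 0)"
      by (intro tendsto_mult_right_zero tendsto_norm_zero tendsto_ident_at)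
    ultimately have "((\<lambda>h. mollify e f (x + h) - mollify e f x) \<longlongrightarrow> 0) (at 0)"
      by (rule Lim_null_comparison)
    then have "((\<lambda>h. mollify e f (x + h)) \<longlongrightarrow> mollify e f x) (at 0)"
      by (simp add: LIM_zero_iff)
    then show ?thesis by (simp add: isCont_iff)
  qed
  then show ?thesis by (simp add: continuous_on_eq_continuous_at)
qed

text \<open>The kernel \<open>\<lambda>y. mollifier e (x - y)\<close> is itself in
  \<open>C1_0\<close>. Testing the weak gradient with it moves the derivative onto \<open>w\<close>;
  the sign from integration by parts cancels the one from differentiating in \<open>y\<close>. The
  Taylor error then shows that this integral is the classical gradient.\<close>

lemma GDERIV_mollify:
  fixes w :: "'a::euclidean_space \<Rightarrow> real"
  assumes wg: "has_weak_gradient w g" and e: "e > 0"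
  shows "GDERIV (mollify e w) x :> mollify e g x"
proof -
  have w: "w \<in> L_loc 1" and g: "g \<in> L_loc 1" using wg by (auto simp: has_weak_gradient_def)
  obtain C where C: "C \<ge> 0" "\<And>z h::'a. norm h \<le> 1 \<Longrightarrow>
    \<bar>mollifier e (z + h) - mollifier e z - h \<bullet> mollifier_grad e z\<bar> \<le> C * (norm h)\<^sup>2 * indicator (cball 0 (e + 1)) z"
    by (rule mollifier_remainder[OF e]) blast
  have "grad (\<lambda>y. mollifier e (x - y)) y = - mollifier_grad e (x - y)" for y
    by (rule grad_eqI) (rule GDERIV_mollifier_diff)
  moreover have "(LINT y|lebesgue. w y *\<^sub>R grad (\<lambda>y. mollifier e (x - y)) y) = - (LINT y|lebesgue. mollifier e (x - y) *\<^sub>R g y)"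
    using wg mollifier_diff_C1_0[OF e, of x] unfolding has_weak_gradient_def by (elim conjE) (erule bspec)
  ultimately have "(LINT y|lebesgue. w y *\<^sub>R (- mollifier_grad e (x - y))) = - mollify e g x"
    unfolding mollify_def by (simp only:)
  then have D: "mollify e g x = (LINT y|lebesgue. w y *\<^sub>R mollifier_grad e (x - y))"
    by simp
  define I where "I = (LINT y|lebesgue. indicator (cball x (e + 1)) y * \<bar>w y\<bar>)"
  have int: "integrable lebesgue (\<lambda>y. indicator (cball x (e + 1)) y * \<bar>w y\<bar>)"
    using integrable_norm[OF L_loc_1_indicator_integrable[OF w compact_cball[of x "e + 1"]]] by (simp add: abs_mult)
  have est: "\<bar>mollify e w (x + h) - mollify e w x - h \<bullet> mollify e g x\<bar> \<le> C * I * (norm h)\<^sup>2" if h: "norm h \<le> 1" for h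
  proof -
    have i1: "integrable lebesgue (\<lambda>y. (mollifier e (x - y + h) - mollifier e (x - y)) *\<^sub>R w y)"
    proof -
      have "integrable lebesgue (\<lambda>y. mollifier e (x + h - y) *\<^sub>R w y - mollifier e (x - y) *\<^sub>R w y)"
        by (rule Bochner_Integration.integrable_diff; rule integrable_mollifier_scaleR[OF w e])
      then show ?thesis by (simp add: scaleR_diff_left algebra_simps)
    qed
    have i2: "integrable lebesgue (\<lambda>y. h \<bullet> (w y *\<^sub>R mollifier_grad e (x - y)))"
      by (intro integrable_inner_right integrable_mollifier_grad_scaleR[OF w e])
    have hg: "h \<bullet> mollify e g x = (LINT y|lebesgue. h \<bullet> (w y *\<^sub>R mollifier_grad e (x - y)))"
      unfolding D by (rule integral_inner_right[symmetric]) (rule integrable_mollifier_grad_scaleR[OF w e])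
    have eq: "mollify e w (x + h) - mollify e w x - h \<bullet> mollify e g x
        = (LINT y|lebesgue. (mollifier e (x - y + h) - mollifier e (x - y)) *\<^sub>R w y - h \<bullet> (w y *\<^sub>R mollifier_grad e (x - y)))"
      unfolding mollify_shift_diff[OF w e] hg
      by (rule Bochner_Integration.integral_diff[symmetric, OF i1 i2])
    have "norm (mollify e w (x + h) - mollify e w x - h \<bullet> mollify e g x)
        \<le> (LINT y|lebesgue. C * (norm h)\<^sup>2 * (indicator (cball x (e + 1)) y * \<bar>w y\<bar>))"
      unfolding eq
    proof (rule Bochner_Integration.integral_norm_bound_integral)
      show "integrable lebesgue (\<lambda>y. (mollifier e (x - y + h) - mollifier e (x - y)) *\<^sub>R w y - h \<bullet> (w y *\<^sub>R mollifier_grad e (x - y)))"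
        by (rule Bochner_Integration.integrable_diff[OF i1 i2])
      show "integrable lebesgue (\<lambda>y. C * (norm h)\<^sup>2 * (indicator (cball x (e + 1)) y * \<bar>w y\<bar>))"
        using int by (rule integrable_mult_right)
      show "norm ((mollifier e (x - y + h) - mollifier e (x - y)) *\<^sub>R w y - h \<bullet> (w y *\<^sub>R mollifier_grad e (x - y)))
          \<le> C * (norm h)\<^sup>2 * (indicator (cball x (e + 1)) y * \<bar>w y\<bar>)" for y
      proof -
        have "(mollifier e (x - y + h) - mollifier e (x - y)) *\<^sub>R w y - h \<bullet> (w y *\<^sub>R mollifier_grad e (x - y))
            = (mollifier e (x - y + h) - mollifier e (x - y) - h \<bullet> mollifier_grad e (x - y)) * w y"
          by (simp add: algebra_simps)
        then show ?thesis
          using mult_right_mono[OF C(2)[OF h, of "x - y"] abs_ge_zero[of "w y"]]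
          by (simp add: indicator_cball_diff abs_mult mult_ac)
      qed
    qed
    then show ?thesis unfolding integral_mult_right_zero I_def[symmetric] by (simp add: mult_ac)
  qed
  show ?thesis unfolding gderiv_def has_derivative_at
  proof (intro conjI)
    show "bounded_linear (\<lambda>h. h \<bullet> mollify e g x)" by (rule bounded_linear_inner_left)
    have "norm (norm (mollify e w (x + h) - mollify e w x - h \<bullet> mollify e g x) / norm h) \<le> C * I * norm h"
      if h: "norm h \<le> 1" "h \<noteq> 0" for h
    proof -
      have "norm (mollify e w (x + h) - mollify e w x - h \<bullet> mollify e g x) / norm h \<le> C * I * (norm h)\<^sup>2 / norm h"
        using est[OF h(1)] by (intro divide_right_mono) auto
      then show ?thesis using h by (simp add: power2_eq_square)
    qed
    then have "\<forall>\<^sub>F h in at 0. norm (norm (mollify e w (x + h) - mollify e w x - h \<bullet> mollify e g x) / norm h) \<le> C * I * norm h"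
      unfolding eventually_at by (intro exI[of _ 1]) auto
    moreover have "((\<lambda>h::'a. C * I * norm h) \<longlongrightarrow> 0) (at 0)"
      by (intro tendsto_mult_right_zero tendsto_norm_zero tendsto_ident_at)
    ultimately show "(\<lambda>h. norm (mollify e w (x + h) - mollify e w x - h \<bullet> mollify e g x) / norm h) \<midarrow>0\<rightarrow> 0"
      by (rule Lim_null_comparison)
  qed
qed

text \<open>Tonelli's theorem together with the unit mass of the kernel.\<close>

lemma mollify_L1_bound:
  fixes f :: "'a::euclidean_space \<Rightarrow> 'b::euclidean_space"
  assumes f: "integrable lebesgue f" and e: "e > 0"
  shows "integrable lebesgue (mollify e f)"
    and "(LINT x|lebesgue. norm (mollify e f x)) \<le> (LINT x|lebesgue. norm (f x))"
proof -
  have f1: "f \<in> L_loc 1" using f by (rule integrable_imp_L_loc_1)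
  have "(\<lambda>x. norm (f x)) \<in> borel_measurable lebesgue" using f by auto
  \<comment> \<open>Tonelli is applied on \<open>lborel\<close>, so the Lebesgue measurable norm is
    replaced by a Borel function equal to it almost everywhere.\<close>
  then obtain N where N[measurable]: "N \<in> borel_measurable lborel" and ae: "AE x in lborel. norm (f x) = N x"
    using completion_ex_borel_measurable_real by blast
  have ae': "AE x in lebesgue. norm (f x) = N x" using ae by (rule AE_completion)
  have cont: "mollify e f \<in> borel_measurable lebesgue"
    by (rule continuous_imp_lebesgue_measurable) (rule continuous_mollify[OF f1 e])
  have "ennreal (norm (mollify e f x)) \<le> (\<integral>\<^sup>+y. ennreal (mollifier e (x - y)) * ennreal (N y) \<partial>lborel)" for x
  proof -
    have "ennreal (norm (mollify e f x)) \<le> ennreal (LINT y|lebesgue. norm (mollifier e (x - y) *\<^sub>R f y))"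
      unfolding mollify_def by (intro ennreal_leI integral_norm_bound)
    also have "\<dots> = (\<integral>\<^sup>+y. ennreal (norm (mollifier e (x - y) *\<^sub>R f y)) \<partial>lebesgue)"
      by (rule nn_integral_eq_integral[symmetric, OF integrable_norm[OF integrable_mollifier_scaleR[OF f1 e]]]) simp
    also have "\<dots> = (\<integral>\<^sup>+y. ennreal (mollifier e (x - y)) * ennreal (N y) \<partial>lebesgue)"
    proof (rule nn_integral_cong_AE)
      show "AE y in lebesgue. ennreal (norm (mollifier e (x - y) *\<^sub>R f y)) = ennreal (mollifier e (x - y)) * ennreal (N y)"
        using ae'
      proof eventually_elim
        case (elim y)
        have "N y \<ge> 0" using elim by (metis norm_ge_zero)
        then show ?case using mollifier_nonneg[OF e, of "x - y"] by (simp add: elim ennreal_mult)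
      qed
    qed
    finally show ?thesis by (simp add: nn_integral_completion)
  qed
  then have "(\<integral>\<^sup>+x. ennreal (norm (mollify e f x)) \<partial>lebesgue)
      \<le> (\<integral>\<^sup>+x. (\<integral>\<^sup>+y. ennreal (mollifier e (x - y)) * ennreal (N y) \<partial>lborel) \<partial>lebesgue)"
    by (intro nn_integral_mono)
  also have "\<dots> = (\<integral>\<^sup>+x. (\<integral>\<^sup>+y. ennreal (mollifier e (x - y)) * ennreal (N y) \<partial>lborel) \<partial>lborel)"
    by (simp add: nn_integral_completion)
  also have "\<dots> = (\<integral>\<^sup>+y. (\<integral>\<^sup>+x. ennreal (mollifier e (x - y)) * ennreal (N y) \<partial>lborel) \<partial>lborel)"
    by (rule lborel_pair.Fubini') measurable
  also have "\<dots> = (\<integral>\<^sup>+y. ennreal (N y) \<partial>lborel)"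
  proof (rule nn_integral_cong)
    fix y :: 'a
    have "(\<integral>\<^sup>+x. ennreal (mollifier e (x - y)) * ennreal (N y) \<partial>lborel)
        = (\<integral>\<^sup>+x. ennreal (mollifier e (x - y)) \<partial>lborel) * ennreal (N y)"
      by (rule nn_integral_multc) measurable
    then show "(\<integral>\<^sup>+x. ennreal (mollifier e (x - y)) * ennreal (N y) \<partial>lborel) = ennreal (N y)"
      by (simp add: nn_integral_mollifier[OF e])
  qed
  also have "\<dots> = (\<integral>\<^sup>+y. ennreal (N y) \<partial>lebesgue)" by (simp add: nn_integral_completion)
  also have "\<dots> = (\<integral>\<^sup>+y. ennreal (norm (f y)) \<partial>lebesgue)"
    using ae' by (intro nn_integral_cong_AE) (auto elim!: eventually_mono)
  also have "\<dots> = ennreal (LINT y|lebesgue. norm (f y))"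
    using f by (intro nn_integral_eq_integral) auto
  finally have *: "(\<integral>\<^sup>+x. ennreal (norm (mollify e f x)) \<partial>lebesgue) \<le> ennreal (LINT y|lebesgue. norm (f y))" .
  show i: "integrable lebesgue (mollify e f)"
    by (rule integrableI_bounded[OF cont]) (use * in \<open>auto simp: top_unique less_top[symmetric]\<close>)
  have "ennreal (LINT x|lebesgue. norm (mollify e f x)) \<le> ennreal (LINT y|lebesgue. norm (f y))"
    using * i by (subst nn_integral_eq_integral[symmetric]) auto
  then show "(LINT x|lebesgue. norm (mollify e f x)) \<le> (LINT x|lebesgue. norm (f x))"
    by (simp add: ennreal_le_iff)
qed


lemma mollify_diff:
  fixes f g :: "'a::euclidean_space \<Rightarrow> 'b::euclidean_space"
  assumes "f \<in> L_loc 1" "g \<in> L_loc 1" "e > 0"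
  shows "mollify e (\<lambda>x. f x - g x) x = mollify e f x - mollify e g x"
  unfolding mollify_def scaleR_diff_right
  by (intro Bochner_Integration.integral_diff integrable_mollifier_scaleR assms)

lemma mollify_add:
  fixes f g :: "'a::euclidean_space \<Rightarrow> 'b::euclidean_space"
  assumes "f \<in> L_loc 1" "g \<in> L_loc 1" "e > 0"
  shows "mollify e (\<lambda>x. f x + g x) x = mollify e f x + mollify e g x"
  unfolding mollify_def scaleR_add_right
  by (intro Bochner_Integration.integral_add integrable_mollifier_scaleR assms)

section \<open>Convergence of mollifications in L1\<close>

definition mollify_L1_error :: "('a::euclidean_space \<Rightarrow> 'b::euclidean_space) \<Rightarrow> nat \<Rightarrow> real" where
  "mollify_L1_error f n = (LINT x|lebesgue. norm (mollify (inverse (real (Suc n))) f x - f x))"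

text \<open>The distance of \<open>f\<close> and \<open>g\<close> is paid twice, once directly and
  once after mollification, which contracts L1. The bound is uniform in \<open>n\<close>, so the
  functions whose error tends to 0 are closed under L1 limits.\<close>

lemma mollify_L1_error_le:
  fixes f g :: "'a::euclidean_space \<Rightarrow> 'b::euclidean_space"
  assumes f: "integrable lebesgue f" and g: "integrable lebesgue g"
  shows "mollify_L1_error f n \<le> mollify_L1_error g n + 2 * (LINT x|lebesgue. norm (f x - g x))"
proof -
  define e where "e = inverse (real (Suc n))"
  have e: "e > 0" by (simp add: e_def)
  have fg: "integrable lebesgue (\<lambda>x. f x - g x)" using f g by simp
  note i = mollify_L1_bound(1)[OF f e] mollify_L1_bound(1)[OF g e] mollify_L1_bound(1)[OF fg e]
  have eq: "mollify e f x = mollify e g x + mollify e (\<lambda>x. f x - g x) x" for x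
    using mollify_diff[OF integrable_imp_L_loc_1[OF f] integrable_imp_L_loc_1[OF g] e, of x] by simp
  have "mollify_L1_error f n \<le> (LINT x|lebesgue. norm (mollify e g x - g x)
      + (norm (mollify e (\<lambda>x. f x - g x) x) + norm (f x - g x)))"
    unfolding mollify_L1_error_def e_def[symmetric]
  proof (rule integral_mono)
    show "norm (mollify e f x - f x) \<le> norm (mollify e g x - g x)
      + (norm (mollify e (\<lambda>x. f x - g x) x) + norm (f x - g x))" for x
      unfolding eq[of x] by norm
  qed (use f g fg i in \<open>auto intro!: Bochner_Integration.integrable_add integrable_norm Bochner_Integration.integrable_diff\<close>)
  also have "\<dots> = mollify_L1_error g n + ((LINT x|lebesgue. norm (mollify e (\<lambda>x. f x - g x) x)) + (LINT x|lebesgue. norm (f x - g x)))"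
    unfolding mollify_L1_error_def e_def[symmetric] using f g fg i
    by (simp add: Bochner_Integration.integral_add)
  also have "\<dots> \<le> mollify_L1_error g n + 2 * (LINT x|lebesgue. norm (f x - g x))"
    using mollify_L1_bound(2)[OF fg e] by simp
  finally show ?thesis .
qed

lemma mollify_L1_error_nonneg: "0 \<le> mollify_L1_error f n"
  by (simp add: mollify_L1_error_def)

lemma mollify_L1_error_tendsto_approx:
  fixes f :: "'a::euclidean_space \<Rightarrow> 'b::euclidean_space"
  assumes f: "integrable lebesgue f"
    and approx: "\<And>d. d > 0 \<Longrightarrow> \<exists>g. integrable lebesgue g \<and> mollify_L1_error g \<longlonglongrightarrow> 0
                     \<and> (LINT x|lebesgue. norm (f x - g x)) < d"
  shows "mollify_L1_error f \<longlonglongrightarrow> 0"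
proof (rule LIMSEQ_I)
  fix r :: real assume r: "r > 0"
  then obtain g where g: "integrable lebesgue g" "mollify_L1_error g \<longlonglongrightarrow> 0"
    "(LINT x|lebesgue. norm (f x - g x)) < r / 4" using approx[of "r / 4"] by auto
  obtain N where N: "\<And>n. n \<ge> N \<Longrightarrow> norm (mollify_L1_error g n - 0) < r / 2"
    using LIMSEQ_D[OF g(2), of "r / 2"] r by auto
  have "norm (mollify_L1_error f n - 0) < r" if "n \<ge> N" for n
    using N[OF that] mollify_L1_error_le[OF f g(1), of n] g(3) mollify_L1_error_nonneg[of f n] by simp
  then show "\<exists>N. \<forall>n\<ge>N. norm (mollify_L1_error f n - 0) < r" by blast
qed

text \<open>L1 closedness restated for dominated pointwise limits, the form in which every
  approximating sequence below arises.\<close>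

lemma mollify_L1_error_tendsto_dominated:
  fixes f :: "'a::euclidean_space \<Rightarrow> 'b::euclidean_space"
  assumes s: "\<And>i. integrable lebesgue (s i)" "\<And>i. mollify_L1_error (s i) \<longlonglongrightarrow> 0"
    and lim: "\<And>x. (\<lambda>i. s i x) \<longlonglongrightarrow> f x" and f: "f \<in> borel_measurable lebesgue"
    and b: "integrable lebesgue b" "\<And>i x. norm (s i x) \<le> b x"
  shows "mollify_L1_error f \<longlonglongrightarrow> 0"
proof (rule mollify_L1_error_tendsto_approx)
  show intf: "integrable lebesgue f"
    by (rule integrable_dominated_convergence[of f lebesgue s b]) (use s lim f b in auto)
  fix d :: real assume "d > 0"
  have bf: "norm (f x) \<le> b x" for x
    by (rule LIMSEQ_le_const2[OF tendsto_norm[OF lim]]) (use b in auto)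
  have "(\<lambda>i. LINT x|lebesgue. norm (f x - s i x)) \<longlonglongrightarrow> (LINT x|(lebesgue :: 'a measure). (0::real))"
  proof (rule integral_dominated_convergence[where w="\<lambda>x. 2 * b x"])
    show "AE x in lebesgue. (\<lambda>i. norm (f x - s i x)) \<longlonglongrightarrow> 0"
    proof (rule AE_I2)
      fix x
      have "(\<lambda>i. norm (f x - s i x)) \<longlonglongrightarrow> norm (f x - f x)" by (intro tendsto_intros lim)
      then show "(\<lambda>i. norm (f x - s i x)) \<longlonglongrightarrow> 0" by simp
    qed
    show "AE x in lebesgue. norm (norm (f x - s i x)) \<le> 2 * b x" for i
    proof (rule AE_I2)
      fix x show "norm (norm (f x - s i x)) \<le> 2 * b x"
        using bf[of x] b(2)[of i x] norm_triangle_ineq4[of "f x" "s i x"] by simp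
    qed
  qed (use s f b in auto)
  then have "(\<lambda>i. LINT x|lebesgue. norm (f x - s i x)) \<longlonglongrightarrow> 0" by simp
  then obtain i where "(LINT x|lebesgue. norm (f x - s i x)) < d"
    using \<open>d > 0\<close> order_tendstoD(2) eventually_happens trivial_limit_sequentially by blast
  then show "\<exists>g. integrable lebesgue g \<and> mollify_L1_error g \<longlonglongrightarrow> 0 \<and> (LINT x|lebesgue. norm (f x - g x)) < d"
    using s by blast
qed

lemma integrable_indicator_cball: "integrable lebesgue (indicator (cball (c::'a::euclidean_space) r) :: 'a \<Rightarrow> real)"
  by (simp add: integrable_indicator_iff emeasure_bounded_finite[unfolded infinity_ennreal_def])

text \<open>Averaging over distance \<open>e\<close> changes \<open>f\<close> by at most
  \<open>L * e\<close>, and for \<open>e \<le> 1\<close> the change is confined to the ball of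
  radius \<open>r + 1\<close>.\<close>

lemma mollify_L1_error_tendsto_lipschitz:
  fixes f :: "'a::euclidean_space \<Rightarrow> 'b::euclidean_space"
  assumes lip: "\<And>x y. norm (f x - f y) \<le> L * norm (x - y)" and supp: "\<And>x. norm x > r \<Longrightarrow> f x = 0"
    and f: "integrable lebesgue f"
  shows "mollify_L1_error f \<longlonglongrightarrow> 0"
proof -
  define V where "V = (LINT x|lebesgue. indicator (cball (0::'a) (r + 1)) x :: real)"
  have f1: "f \<in> L_loc 1" using f by (rule integrable_imp_L_loc_1)
  have L: "L \<ge> 0"
  proof -
    obtain x :: 'a where "norm x = 1" using vector_choose_size[of 1] by auto
    then show ?thesis using order_trans[OF norm_ge_zero lip[of x 0]] by simp
  qed
  have bound: "mollify_L1_error f n \<le> L * V * inverse (real (Suc n))" for n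
  proof -
    define e where "e = inverse (real (Suc n))"
    have e: "e > 0" "e \<le> 1" by (simp_all add: e_def inverse_le_1_iff)
    have *: "norm (mollify e f x - f x) \<le> L * e * indicator (cball 0 (r + 1)) x" for x
    proof -
      note i = integrable_mollifier_scaleR[OF f1 e(1), of x]
        integrable_scaleR_left[OF integral_mollifier(1)[OF e(1), of x], of "f x"]
      have "mollify e f x - f x = (LINT y|lebesgue. mollifier e (x - y) *\<^sub>R f y) - (LINT y|lebesgue. mollifier e (x - y) *\<^sub>R f x)"
        using integral_mollifier[OF e(1), of x] by (simp add: mollify_def)
      also have "\<dots> = (LINT y|lebesgue. mollifier e (x - y) *\<^sub>R f y - mollifier e (x - y) *\<^sub>R f x)"
        by (rule Bochner_Integration.integral_diff[symmetric, OF i])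
      also have "norm \<dots> \<le> (LINT y|lebesgue. (L * e * indicator (cball 0 (r + 1)) x) * mollifier e (x - y))"
      proof (rule Bochner_Integration.integral_norm_bound_integral)
        show "integrable lebesgue (\<lambda>y. mollifier e (x - y) *\<^sub>R f y - mollifier e (x - y) *\<^sub>R f x)"
          by (rule Bochner_Integration.integrable_diff[OF i])
        show "integrable lebesgue (\<lambda>y. (L * e * indicator (cball 0 (r + 1)) x) * mollifier e (x - y))"
          using integral_mollifier[OF e(1), of x] by (intro integrable_mult_right)
        fix y
        have eq: "norm (mollifier e (x - y) *\<^sub>R f y - mollifier e (x - y) *\<^sub>R f x) = mollifier e (x - y) * norm (f y - f x)"
          using mollifier_nonneg[OF e(1), of "x - y"] by (simp add: scaleR_diff_right[symmetric])
        show "norm (mollifier e (x - y) *\<^sub>R f y - mollifier e (x - y) *\<^sub>R f x)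
            \<le> (L * e * indicator (cball 0 (r + 1)) x) * mollifier e (x - y)"
        proof (cases "norm (x - y) \<ge> e")
          case True
          then show ?thesis using e by (simp add: mollifier_eq_0)
        next
          case False
          have "norm (f y - f x) \<le> L * e * indicator (cball 0 (r + 1)) x"
          proof (cases "x \<in> cball 0 (r + 1)")
            case True
            have "norm (f y - f x) \<le> L * norm (y - x)" by (rule lip)
            also have "\<dots> \<le> L * e" using False L by (intro mult_left_mono) (auto simp: norm_minus_commute)
            finally show ?thesis using True by simp
          next
            case out: False
            then have "norm x > r + 1" by simp
            moreover have "norm y > r" using calculation False e(2) norm_triangle_ineq2[of x y] by linarith
            ultimately have "f y = 0" "f x = 0" by (auto intro!: supp)
            then show ?thesis using out by simp
          qed
          then show ?thesis unfolding eq using mollifier_nonneg[OF e(1), of "x - y"]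
            by (simp only: mult.commute[of _ "mollifier e (x - y)"] mult_left_mono)
        qed
      qed
      also have "\<dots> = L * e * indicator (cball 0 (r + 1)) x"
        using integral_mollifier[OF e(1), of x] by simp
      finally show ?thesis .
    qed
    have "mollify_L1_error f n \<le> (LINT x|lebesgue. L * e * indicator (cball (0::'a) (r + 1)) x)"
      unfolding mollify_L1_error_def e_def[symmetric]
    proof (rule integral_mono)
      show "integrable lebesgue (\<lambda>x. norm (mollify e f x - f x))"
        using f mollify_L1_bound(1)[OF f e(1)] by auto
      show "integrable lebesgue (\<lambda>x. L * e * indicator (cball (0::'a) (r + 1)) x)"
        by (intro integrable_mult_right integrable_indicator_cball)
    qed (use * in auto)
    then show ?thesis unfolding integral_mult_right_zero V_def[symmetric] e_def[symmetric] by (simp add: mult_ac)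
  qed
  have "(\<lambda>n. L * V * inverse (real (Suc n))) \<longlonglongrightarrow> 0"
    by (intro tendsto_mult_right_zero LIMSEQ_inverse_real_of_nat)
  then show ?thesis
    by (rule tendsto_sandwich[OF always_eventually always_eventually tendsto_const, rotated 2])
       (use bound mollify_L1_error_nonneg in auto)
qed

lemma mollify_L1_error_tendsto_compact:
  fixes c :: "'b::euclidean_space" and T :: "'a::euclidean_space set"
  assumes T: "compact T"
  shows "mollify_L1_error (\<lambda>x. indicator T x *\<^sub>R c) \<longlonglongrightarrow> 0"
\<comment> \<open>The distance \<open>infdist\<close> to the empty set is 0 by convention, so the
  ramps used below would not vanish anywhere.\<close>
proof (cases "T = {}")
  case True
  then show ?thesis
    by (simp add: mollify_L1_error_def[abs_def] mollify_def)
next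
  case False
  obtain r where r: "\<And>x. x \<in> T \<Longrightarrow> norm x \<le> r"
    using compact_imp_bounded[OF T] by (auto simp: bounded_iff)
  \<comment> \<open>Lipschitz ramps that decrease to the indicator because \<open>T\<close> is
    closed. Slope at least 1 makes all of them vanish at distance 1 from \<open>T\<close>.\<close>
  define s where "s = (\<lambda>i x. max 0 (1 - real (Suc i) * infdist x T) *\<^sub>R c)"
  have supp: "s i x = 0" if "norm x > r + 1" for i x
  proof -
    obtain y where y: "y \<in> T" "infdist x T = dist x y"
      using infdist_attains_inf[OF compact_imp_closed[OF T] False] by blast
    have "dist x y \<ge> 1" using that r[OF y(1)] norm_triangle_ineq2[of x y] by (simp add: dist_norm)
    then have "real (Suc i) * infdist x T \<ge> 1 * 1" unfolding y(2) by (intro mult_mono) auto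
    then show ?thesis by (simp add: s_def)
  qed
  have sn: "norm (s i x) \<le> norm c * indicator (cball 0 (r + 1)) x" for i x
  proof (cases "x \<in> cball 0 (r + 1)")
    case True
    have "max 0 (1 - real (Suc i) * infdist x T) \<le> 1" using infdist_nonneg[of x T] by simp
    then show ?thesis using True mult_right_mono[of "max 0 (1 - real (Suc i) * infdist x T)" 1 "norm c"]
      by (simp add: s_def)
  next
    case False
    then show ?thesis using supp by simp
  qed
  have smeas: "s i \<in> borel_measurable lebesgue" for i
    unfolding s_def by (intro continuous_imp_lebesgue_measurable continuous_intros)
  have sint: "integrable lebesgue (s i)" for i
  proof (rule Bochner_Integration.integrable_bound)
    show "integrable lebesgue (\<lambda>x. norm c * indicator (cball (0::'a) (r + 1)) x)"
      by (intro integrable_mult_right integrable_indicator_cball)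
    show "AE x in lebesgue. norm (s i x) \<le> norm (norm c * indicator (cball 0 (r + 1)) x)"
      using sn[of i] by (intro AE_I2) (simp add: order_trans[OF _ abs_ge_self])
  qed (rule smeas)
  show ?thesis
  proof (rule mollify_L1_error_tendsto_dominated[where s=s])
    show "mollify_L1_error (s i) \<longlonglongrightarrow> 0" for i
    proof (rule mollify_L1_error_tendsto_lipschitz[where L="real (Suc i) * norm c" and r="r + 1"])
      fix x y :: 'a
      have "\<bar>infdist x T - infdist y T\<bar> \<le> dist x y" by (rule infdist_triangle_abs)
      then have "real (Suc i) * \<bar>infdist x T - infdist y T\<bar> \<le> real (Suc i) * norm (x - y)"
        by (intro mult_left_mono) (auto simp: dist_norm)
      moreover have "\<bar>max 0 (1 - real (Suc i) * infdist x T) - max 0 (1 - real (Suc i) * infdist y T)\<bar>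
          \<le> real (Suc i) * \<bar>infdist x T - infdist y T\<bar>"
      proof -
        have "\<bar>max 0 a - max 0 b\<bar> \<le> \<bar>a - b\<bar>" for a b :: real by linarith
        note this[of "1 - real (Suc i) * infdist x T" "1 - real (Suc i) * infdist y T"]
        moreover have "(1 - real (Suc i) * infdist x T) - (1 - real (Suc i) * infdist y T)
            = - (real (Suc i) * (infdist x T - infdist y T))" by (simp add: right_diff_distrib)
        ultimately show ?thesis by (simp only: abs_minus_cancel abs_mult abs_of_nat)
      qed
      ultimately have "\<bar>max 0 (1 - real (Suc i) * infdist x T) - max 0 (1 - real (Suc i) * infdist y T)\<bar> * norm c
          \<le> real (Suc i) * norm (x - y) * norm c"
        by (intro mult_right_mono[OF _ norm_ge_zero]) (rule order_trans)
      then show "norm (s i x - s i y) \<le> real (Suc i) * norm c * norm (x - y)"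
        by (simp only: s_def scaleR_diff_left[symmetric] norm_scaleR mult_ac)
    qed (use supp sint in auto)
    show "integrable lebesgue (\<lambda>x. norm c * indicator (cball (0::'a) (r + 1)) x)"
      by (intro integrable_mult_right integrable_indicator_cball)
    show "(\<lambda>i. s i x) \<longlonglongrightarrow> indicator T x *\<^sub>R c" for x
    proof (cases "x \<in> T")
      case True
      then show ?thesis by (simp add: s_def)
    next
      case out: False
      then have pos: "infdist x T > 0"
        using False T by (metis compact_imp_closed in_closed_iff_infdist_zero infdist_nonneg less_eq_real_def)
      obtain N where N: "1 / infdist x T < real N" using reals_Archimedean2 by blast
      have "s i x = 0" if "i \<ge> N" for i
      proof -
        have "1 / infdist x T \<le> real (Suc i)" using N that by simp
        then have "1 \<le> real (Suc i) * infdist x T" using pos by (simp only: pos_divide_le_eq)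
        then show ?thesis by (simp add: s_def)
      qed
      then have "\<forall>\<^sub>F i in sequentially. s i x = indicator T x *\<^sub>R c"
        using out by (auto simp: eventually_sequentially)
      then show ?thesis by (rule tendsto_eventually)
    qed
    have "T \<in> sets lebesgue" using T by (simp add: borel_compact)
    then show "(\<lambda>x. indicator T x *\<^sub>R c) \<in> borel_measurable lebesgue" by measurable
  qed (use sint sn in auto)
qed

theorem mollify_L1_tendsto:
  fixes f :: "'a::euclidean_space \<Rightarrow> 'b::euclidean_space"
  assumes "integrable lebesgue f"
  shows "mollify_L1_error f \<longlonglongrightarrow> 0"
  using assms
proof (induction rule: integrable_induct)
  case (base A c)
  have A: "A \<in> sets lebesgue" using base by simp
  have fin: "emeasure lebesgue A < \<infinity>" using base by simp
  have intA: "integrable lebesgue (\<lambda>x. indicator B x *\<^sub>R c)" if "B \<in> sets lebesgue" "B \<subseteq> A" for B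
    using that fin emeasure_mono[OF that(2) A]
    by (intro integrable_scaleR_left integrable_real_indicator) (auto simp: less_top[symmetric] top_unique)
  show ?case
  \<comment> \<open>Cutting \<open>A\<close> to balls makes the closed sets supplied by inner
    regularity compact.\<close>
  proof (rule mollify_L1_error_tendsto_dominated[where s="\<lambda>i x. indicator (A \<inter> cball 0 (real i)) x *\<^sub>R c"])
    fix i :: nat
    have Ai: "A \<inter> cball 0 (real i) \<in> sets lebesgue" using A by auto
    show inti: "integrable lebesgue (\<lambda>x. indicator (A \<inter> cball 0 (real i)) x *\<^sub>R c)"
      by (rule intA[OF Ai]) auto
    show "mollify_L1_error (\<lambda>x. indicator (A \<inter> cball 0 (real i)) x *\<^sub>R c) \<longlonglongrightarrow> 0"
    proof (rule mollify_L1_error_tendsto_approx[OF inti])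
      fix d :: real assume d: "d > 0"
      \<comment> \<open>Adding 1 covers \<open>c = 0\<close> and keeps the final inequality
        strict.\<close>
      define d' where "d' = d / (norm c + 1)"
      have d': "d' > 0" using d by (simp add: d'_def add_nonneg_pos)
      obtain T where T: "closed T" "T \<subseteq> A \<inter> cball 0 (real i)" "A \<inter> cball 0 (real i) - T \<in> lmeasurable"
        "emeasure lebesgue (A \<inter> cball 0 (real i) - T) < ennreal d'"
        using sets_lebesgue_inner_closed[OF Ai d'] by blast
      have cT: "compact T" using T(1,2) compact_cball[of 0 "real i"]
        by (metis closed_Int_compact inf.absorb1 le_inf_iff)
      have mT: "measure lebesgue (A \<inter> cball 0 (real i) - T) < d'"
        using T(3,4) d' by (simp add: emeasure_eq_measure2 ennreal_less_iff)
      have "norm (indicator (A \<inter> cball 0 (real i)) x *\<^sub>R c - indicator T x *\<^sub>R c)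
          = norm c * indicator (A \<inter> cball 0 (real i) - T) x" for x
        using T(2) by (auto simp: indicator_def)
      then have "(LINT x|lebesgue. norm (indicator (A \<inter> cball 0 (real i)) x *\<^sub>R c - indicator T x *\<^sub>R c))
          = norm c * measure lebesgue (A \<inter> cball 0 (real i) - T)" by simp
      also have "\<dots> \<le> norm c * d'" using mT by (intro mult_left_mono) auto
      also have "\<dots> < d" using d
        by (simp add: d'_def pos_divide_less_eq add_nonneg_pos add_pos_nonneg distrib_left)
      finally have "(LINT x|lebesgue. norm (indicator (A \<inter> cball 0 (real i)) x *\<^sub>R c - indicator T x *\<^sub>R c)) < d" .
      moreover have "integrable lebesgue (\<lambda>x. indicator T x *\<^sub>R c)"
        using cT T(2) by (intro intA) (auto simp: borel_compact)
      ultimately show "\<exists>g. integrable lebesgue g \<and> mollify_L1_error g \<longlonglongrightarrow> 0 \<and>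
          (LINT x|lebesgue. norm (indicator (A \<inter> cball 0 (real i)) x *\<^sub>R c - g x)) < d"
        using mollify_L1_error_tendsto_compact[OF cT, of c] by blast
    qed
  next
    fix x :: 'a
    obtain N where N: "norm x \<le> real N" using real_arch_simple by blast
    have "indicator (A \<inter> cball 0 (real i)) x *\<^sub>R c = indicator A x *\<^sub>R c" if "i \<ge> N" for i
      using N that by (auto simp: indicator_def)
    then have "\<forall>\<^sub>F i in sequentially. indicator (A \<inter> cball 0 (real i)) x *\<^sub>R c = indicator A x *\<^sub>R c"
      by (auto simp: eventually_sequentially)
    then show "(\<lambda>i. indicator (A \<inter> cball 0 (real i)) x *\<^sub>R c) \<longlonglongrightarrow> indicator A x *\<^sub>R c"
      by (rule tendsto_eventually)
  next
    show "(\<lambda>x. indicator A x *\<^sub>R c) \<in> borel_measurable lebesgue" using A by measurable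
    show "integrable lebesgue (\<lambda>x. norm (indicator A x *\<^sub>R c))"
      using intA[OF A] by (intro integrable_norm) auto
    show "norm (indicator (A \<inter> cball 0 (real i)) x *\<^sub>R c) \<le> norm (indicator A x *\<^sub>R c)" for i :: nat and x
      by (auto simp: indicator_def)
  qed
next
  case (add f g)
  note add = add.hyps(1) add.IH(1) add.hyps(2) add.IH(2)
  have "mollify_L1_error (\<lambda>x. f x + g x) n \<le> mollify_L1_error f n + mollify_L1_error g n" (is "?l n \<le> ?r n") for n
  proof -
    define e where "e = inverse (real (Suc n))"
    have e: "e > 0" by (simp add: e_def)
    note i = mollify_L1_bound(1)[OF add(1) e] mollify_L1_bound(1)[OF add(3) e]
    have fg: "integrable lebesgue (\<lambda>x. f x + g x)" using add by simp
    have "mollify_L1_error (\<lambda>x. f x + g x) n \<le> (LINT x|lebesgue. norm (mollify e f x - f x) + norm (mollify e g x - g x))"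
      unfolding mollify_L1_error_def e_def[symmetric]
    proof (rule integral_mono)
      show "integrable lebesgue (\<lambda>x. norm (mollify e (\<lambda>x. f x + g x) x - (f x + g x)))"
        using mollify_L1_bound(1)[OF fg e] fg by auto
      show "integrable lebesgue (\<lambda>x. norm (mollify e f x - f x) + norm (mollify e g x - g x))"
        using i add by auto
      show "norm (mollify e (\<lambda>x. f x + g x) x - (f x + g x)) \<le> norm (mollify e f x - f x) + norm (mollify e g x - g x)" for x
        unfolding mollify_add[OF integrable_imp_L_loc_1[OF add(1)] integrable_imp_L_loc_1[OF add(3)] e] by norm
    qed
    also have "\<dots> = mollify_L1_error f n + mollify_L1_error g n"
      unfolding mollify_L1_error_def e_def[symmetric] using i add by (intro Bochner_Integration.integral_add) auto
    finally show ?thesis .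
  qed
  then have le: "\<forall>\<^sub>F n in sequentially. ?l n \<le> ?r n" by (intro always_eventually allI)
  have ge: "\<forall>\<^sub>F n in sequentially. 0 \<le> ?l n"
    by (intro always_eventually allI mollify_L1_error_nonneg)
  have "?r \<longlonglongrightarrow> 0" using tendsto_add[OF add(2,4)] by simp
  then show ?case by (rule tendsto_sandwich[OF ge le tendsto_const])
next
  case (lim f s)
  show ?case
    by (rule mollify_L1_error_tendsto_dominated[where s=s and b="\<lambda>x. 2 * norm (f x)"]) (use lim in auto)
qed


text \<open>For radii at most 1, the mollification on \<open>K\<close> sees only values of
  \<open>f\<close> in a ball one unit larger, where \<open>f\<close> may be replaced by an
  integrable truncation.\<close>

lemma mollify_L1_local:
  fixes f :: "'a::euclidean_space \<Rightarrow> 'b::euclidean_space"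
  assumes f: "f \<in> L_loc 1" and K: "compact K"
  shows "integrable lebesgue (\<lambda>x. indicator K x *\<^sub>R (mollify (inverse (real (Suc n))) f x - f x))"
    and "(\<lambda>n. LINT x|lebesgue. norm (indicator K x *\<^sub>R (mollify (inverse (real (Suc n))) f x - f x))) \<longlonglongrightarrow> 0"
proof -
  obtain r where r: "\<And>x. x \<in> K \<Longrightarrow> norm x \<le> r"
    using compact_imp_bounded[OF K] by (auto simp: bounded_iff)
  have Ks[measurable]: "K \<in> sets lebesgue" using K by (simp add: borel_compact)
  define f1 where "f1 = (\<lambda>x. indicator (cball 0 (r + 1)) x *\<^sub>R f x)"
  have f1: "integrable lebesgue f1" unfolding f1_def by (intro L_loc_1_indicator_integrable f compact_cball)
  have eq: "mollify e f x = mollify e f1 x" if e: "0 < e" "e \<le> 1" and x: "x \<in> K" for e x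
    unfolding mollify_def
  proof (rule Bochner_Integration.integral_cong)
    fix y
    show "mollifier e (x - y) *\<^sub>R f y = mollifier e (x - y) *\<^sub>R f1 y"
    proof (cases "norm y \<le> r + 1")
      case True then show ?thesis by (simp add: f1_def)
    next
      case False
      then have "norm (x - y) \<ge> e" using r[OF x] e norm_triangle_ineq2[of y x] by (simp add: norm_minus_commute)
      then show ?thesis using e by (simp add: mollifier_eq_0)
    qed
  qed simp
  have eqf: "f x = f1 x" if "x \<in> K" for x using r[OF that] by (simp add: f1_def)
  have e: "0 < inverse (real (Suc n))" "inverse (real (Suc n)) \<le> 1" for n
    by (simp_all add: inverse_le_1_iff)
  have eq2: "indicator K x *\<^sub>R (mollify (inverse (real (Suc n))) f x - f x)
      = indicator K x *\<^sub>R (mollify (inverse (real (Suc n))) f1 x - f1 x)" for x n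
    using eq[OF e, of x n] eqf[of x] by (cases "x \<in> K") auto
  have int1: "integrable lebesgue (\<lambda>x. mollify (inverse (real (Suc n))) f1 x - f1 x)" for n
    using mollify_L1_bound(1)[OF f1 e(1)] f1 by auto
  show int: "integrable lebesgue (\<lambda>x. indicator K x *\<^sub>R (mollify (inverse (real (Suc n))) f x - f x))" for n
    unfolding eq2 by (rule integrable_mult_indicator[OF Ks int1])
  have "(LINT x|lebesgue. norm (indicator K x *\<^sub>R (mollify (inverse (real (Suc n))) f x - f x))) \<le> mollify_L1_error f1 n" for n
    unfolding mollify_L1_error_def
  proof (rule integral_mono)
    show "norm (indicator K x *\<^sub>R (mollify (inverse (real (Suc n))) f x - f x)) \<le> norm (mollify (inverse (real (Suc n))) f1 x - f1 x)" for x
      unfolding eq2 by (simp add: indicator_def)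
  qed (use int int1 in \<open>auto intro!: integrable_norm simp del: norm_scaleR\<close>)
  then have le: "\<forall>\<^sub>F n in sequentially. (LINT x|lebesgue. norm (indicator K x *\<^sub>R (mollify (inverse (real (Suc n))) f x - f x))) \<le> mollify_L1_error f1 n"
    by (intro always_eventually allI)
  have ge: "\<forall>\<^sub>F n in sequentially. 0 \<le> (LINT x|lebesgue. norm (indicator K x *\<^sub>R (mollify (inverse (real (Suc n))) f x - f x)))"
    by (intro always_eventually allI) simp
  show "(\<lambda>n. LINT x|lebesgue. norm (indicator K x *\<^sub>R (mollify (inverse (real (Suc n))) f x - f x))) \<longlonglongrightarrow> 0"
    by (rule tendsto_sandwich[OF ge le tendsto_const mollify_L1_tendsto[OF f1]])
qed

text \<open>The convex function \<open>t powr p\<close> lies above its tangent at \<open>s\<close>.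
  Young's inequality with exponents \<open>p\<close> and \<open>p / (p - 1)\<close> gives this
  without derivatives.\<close>

lemma powr_above_tangent:
  fixes s t p :: real
  assumes "p > 1" "s \<ge> 0" "t \<ge> 0"
  shows "p * s powr (p - 1) * t \<le> t powr p + (p - 1) * s powr p"
proof -
  have "t * s powr (p - 1) \<le> t powr p / p + (s powr (p - 1)) powr (p / (p - 1)) / (p / (p - 1))"
    by (rule Youngs_inequality) (use assms in \<open>auto simp: field_simps\<close>)
  also have "(s powr (p - 1)) powr (p / (p - 1)) = s powr p" using assms by (simp add: powr_powr)
  finally have "p * (t * s powr (p - 1)) \<le> p * (t powr p / p + s powr p / (p / (p - 1)))"
    using assms by (intro mult_left_mono) auto
  also have "\<dots> = t powr p + (p - 1) * s powr p" using assms by (simp add: distrib_left)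
  finally show ?thesis by (simp add: mult_ac)
qed

text \<open>Jensen's inequality for the probability density \<open>mollifier e (x - y)\<close>: the
  tangent inequality at the point \<open>norm (mollify e g x)\<close> is integrated. It provides
  majorants for mollified gradients that themselves converge locally in L1.\<close>

lemma mollify_powr_le:
  fixes g :: "'a::euclidean_space \<Rightarrow> 'b::euclidean_space"
  assumes g: "g \<in> L_loc 1" and gp: "(\<lambda>x. norm (g x) powr p) \<in> L_loc 1" and p: "p > 1" and e: "e > 0"
  shows "norm (mollify e g x) powr p \<le> mollify e (\<lambda>x. norm (g x) powr p) x"
proof -
  define s where "s = norm (mollify e g x)"
  note m = integral_mollifier[OF e, of x] mollifier_nonneg[OF e]
  have i1: "integrable lebesgue (\<lambda>y. mollifier e (x - y) * norm (g y))"
    using integrable_norm[OF integrable_mollifier_scaleR[OF g e, of x]] by (simp add: abs_of_nonneg[OF m(3)])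
  have i2: "integrable lebesgue (\<lambda>y. mollifier e (x - y) * norm (g y) powr p)"
    using integrable_mollifier_scaleR[OF gp e, of x] by simp
  have sle: "s \<le> (LINT y|lebesgue. mollifier e (x - y) * norm (g y))"
    using integral_norm_bound[of lebesgue "\<lambda>y. mollifier e (x - y) *\<^sub>R g y"]
    by (simp add: s_def mollify_def abs_of_nonneg[OF m(3)])
  have "(LINT y|lebesgue. p * s powr (p - 1) * (mollifier e (x - y) * norm (g y)) - (p - 1) * s powr p * mollifier e (x - y))
      \<le> (LINT y|lebesgue. mollifier e (x - y) * norm (g y) powr p)"
  proof (rule integral_mono)
    show "integrable lebesgue (\<lambda>y. p * s powr (p - 1) * (mollifier e (x - y) * norm (g y)) - (p - 1) * s powr p * mollifier e (x - y))"
      by (intro Bochner_Integration.integrable_diff integrable_mult_right i1 m(1))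
    fix y
    have "p * s powr (p - 1) * norm (g y) - (p - 1) * s powr p \<le> norm (g y) powr p"
      using powr_above_tangent[OF p, of s "norm (g y)"] by (simp add: s_def)
    from mult_left_mono[OF this m(3)[of "x - y"]]
    show "p * s powr (p - 1) * (mollifier e (x - y) * norm (g y)) - (p - 1) * s powr p * mollifier e (x - y)
        \<le> mollifier e (x - y) * norm (g y) powr p"
      by (simp add: algebra_simps)
  qed (rule i2)
  also have "(LINT y|lebesgue. p * s powr (p - 1) * (mollifier e (x - y) * norm (g y)) - (p - 1) * s powr p * mollifier e (x - y))
      = p * s powr (p - 1) * (LINT y|lebesgue. mollifier e (x - y) * norm (g y)) - (p - 1) * s powr p"
    using i1 m(1,2) by (simp add: Bochner_Integration.integral_diff)
  also have "(LINT y|lebesgue. mollifier e (x - y) * norm (g y) powr p) = mollify e (\<lambda>x. norm (g x) powr p) x"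
    by (simp add: mollify_def)
  finally have "p * s powr (p - 1) * (LINT y|lebesgue. mollifier e (x - y) * norm (g y)) - (p - 1) * s powr p
      \<le> mollify e (\<lambda>x. norm (g x) powr p) x" .
  moreover have "p * s powr (p - 1) * s \<le> p * s powr (p - 1) * (LINT y|lebesgue. mollifier e (x - y) * norm (g y))"
    using sle p by (intro mult_left_mono) auto
  moreover have "p * s powr (p - 1) * s = p * s powr p"
  proof (cases "s = 0")
    case False
    then have "s > 0" by (simp add: s_def)
    then show ?thesis by (simp add: powr_diff)
  qed simp
  moreover have "(p - 1) * s powr p = p * s powr p - s powr p" by (simp add: left_diff_distrib)
  ultimately show ?thesis unfolding s_def[symmetric] by linarith
qed

lemma powr_mult_le_sum:
  fixes a b p :: real
  assumes "p > 1" "a \<ge> 0" "b \<ge> 0"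
  shows "a powr (p - 1) * b \<le> a powr p + b powr p"
proof -
  have split: "c powr (p - 1) * c = c powr p" if "c \<ge> 0" for c :: real
    using that by (cases "c = 0") (auto simp: powr_diff)
  show ?thesis
  proof (cases "a \<le> b")
    case True
    have "a powr (p - 1) * b \<le> b powr (p - 1) * b"
      using True assms by (intro mult_right_mono powr_mono2) auto
    then show ?thesis using split[OF assms(3)] by (smt (verit) powr_ge_zero)
  next
    case False
    have "a powr (p - 1) * b \<le> a powr (p - 1) * a"
      using False assms by (intro mult_left_mono) auto
    then show ?thesis using split[OF assms(2)] by (smt (verit) powr_ge_zero)
  qed
qed

section \<open>Calculus of locally integrable functions\<close>

lemma L_loc_powr_norm: "f \<in> L_loc p \<Longrightarrow> (\<lambda>x. norm (f x) powr p) \<in> L_loc 1"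
  unfolding L_loc_1_iff by (auto simp: L_loc_def)

lemma L_loc_1_bound:
  fixes f :: "'a::euclidean_space \<Rightarrow> 'b::euclidean_space" and g :: "'a \<Rightarrow> real"
  assumes g: "g \<in> L_loc 1" and f: "f \<in> borel_measurable lebesgue" and le: "AE x in lebesgue. norm (f x) \<le> g x"
  shows "f \<in> L_loc 1"
  unfolding L_loc_1_iff
proof (intro conjI allI impI f)
  fix K :: "'a set" assume K: "compact K"
  have [measurable]: "K \<in> sets lebesgue" using K by (simp add: borel_compact)
  show "set_integrable lebesgue K f" unfolding set_integrable_def
  proof (rule Bochner_Integration.integrable_bound[OF L_loc_1_indicator_integrable[OF g K]])
    show "(\<lambda>x. indicator K x *\<^sub>R f x) \<in> borel_measurable lebesgue" using f by measurable
    show "AE x in lebesgue. norm (indicator K x *\<^sub>R f x) \<le> norm (indicator K x *\<^sub>R g x)"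
      using le by eventually_elim (auto simp: indicator_def)
  qed
qed

lemma L_loc_1_const: "(\<lambda>x::'a::euclidean_space. c) \<in> L_loc 1"
  for c :: "'b::euclidean_space"
proof -
  have "integrable lebesgue (\<lambda>x::'a. indicator K x *\<^sub>R c)" if "compact K" for K
    using that by (intro integrable_scaleR_left integrable_real_indicator)
      (auto simp: borel_compact emeasure_bounded_finite[unfolded infinity_ennreal_def] compact_imp_bounded)
  then show ?thesis by (auto simp: L_loc_1_iff set_integrable_def)
qed

lemma L_loc_1_add:
  "f \<in> L_loc 1 \<Longrightarrow> g \<in> L_loc 1 \<Longrightarrow> (\<lambda>x. f x + g x) \<in> L_loc 1"
  unfolding L_loc_1_iff set_integrable_def by (auto simp: scaleR_add_right)

lemma L_loc_1_diff:
  "f \<in> L_loc 1 \<Longrightarrow> g \<in> L_loc 1 \<Longrightarrow> (\<lambda>x. f x - g x) \<in> L_loc 1"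
  unfolding L_loc_1_iff set_integrable_def by (auto simp: scaleR_diff_right)

lemma L_loc_1_mult_const: "f \<in> L_loc 1 \<Longrightarrow> (\<lambda>x. c * f x) \<in> L_loc 1" for f :: "'a::euclidean_space \<Rightarrow> real"
  unfolding L_loc_1_iff set_integrable_def by (auto simp: mult.left_commute)

lemma L_loc_1_norm: "f \<in> L_loc 1 \<Longrightarrow> (\<lambda>x. norm (f x)) \<in> L_loc 1"
  using L_loc_powr_norm[of f 1] by simp

lemma continuous_compact_support_bounded:
  fixes f :: "'a::euclidean_space \<Rightarrow> 'b::euclidean_space"
  assumes "continuous_on UNIV f" "compact K" "\<And>x. x \<notin> K \<Longrightarrow> f x = 0"
  obtains B where "B \<ge> 0" "\<And>x. norm (f x) \<le> B * indicator K x"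
proof -
  have "compact (f ` K)" using assms by (intro compact_continuous_image) (auto intro: continuous_on_subset)
  then obtain B where B: "\<And>x. x \<in> K \<Longrightarrow> norm (f x) \<le> B"
    using compact_imp_bounded[of "f ` K"] unfolding bounded_iff by blast
  show ?thesis
  proof
    show "max 0 B \<ge> 0" by simp
    show "norm (f x) \<le> max 0 B * indicator K x" for x
      using B[of x] assms(3)[of x] by (cases "x \<in> K") auto
  qed
qed

lemma L_loc_1_integrable_inner:
  fixes A D :: "'a::euclidean_space \<Rightarrow> 'b::euclidean_space"
  assumes A: "A \<in> L_loc 1" and D: "continuous_on UNIV D" "compact K" "\<And>x. x \<notin> K \<Longrightarrow> D x = 0"
  shows "integrable lebesgue (\<lambda>x. A x \<bullet> D x)"
proof -
  obtain B where B: "B \<ge> 0" "\<And>x. norm (D x) \<le> B * indicator K x"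
    using continuous_compact_support_bounded[OF D] by blast
  show ?thesis
  proof (rule Bochner_Integration.integrable_bound)
    show "integrable lebesgue (\<lambda>x. B * norm (indicator K x *\<^sub>R A x))"
      by (intro integrable_mult_right integrable_norm L_loc_1_indicator_integrable A D)
    show "(\<lambda>x. A x \<bullet> D x) \<in> borel_measurable lebesgue"
      using L_loc_measurable[OF A] continuous_imp_lebesgue_measurable[OF D(1)] by measurable
    have "norm (A x \<bullet> D x) \<le> norm (B * norm (indicator K x *\<^sub>R A x))" for x
    proof -
      have "norm (A x \<bullet> D x) \<le> norm (A x) * norm (D x)" by (simp add: Cauchy_Schwarz_ineq2)
      also have "\<dots> \<le> norm (A x) * (B * indicator K x)" using B(2) by (intro mult_left_mono) auto
      finally show ?thesis using B(1) by (simp add: mult_ac abs_mult)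
    qed
    then show "AE x in lebesgue. norm (A x \<bullet> D x) \<le> norm (B * norm (indicator K x *\<^sub>R A x))"
      by (rule AE_I2)
  qed
qed

section \<open>Nonlinear test functions\<close>

text \<open>Truncating \<open>J n\<close> at height \<open>b\<close> reduces this to ordinary dominated convergence: the truncation changes \<open>J n\<close> by at most \<open>|B n - b|\<close>.\<close>

lemma dominated_convergence_L1_varying:
  fixes J :: "nat \<Rightarrow> 'a \<Rightarrow> real"
  assumes J: "\<And>n. J n \<in> borel_measurable M" "j \<in> borel_measurable M"
    and B: "\<And>n. integrable M (B n)" "integrable M b"
    and Bb: "(\<lambda>n. LINT x|M. \<bar>B n x - b x\<bar>) \<longlonglongrightarrow> 0"
    and le: "\<And>n x. \<bar>J n x\<bar> \<le> B n x" "\<And>x. \<bar>j x\<bar> \<le> b x"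
    and lim: "AE x in M. (\<lambda>n. J n x) \<longlonglongrightarrow> j x"
  shows "integrable M j" "(\<lambda>n. LINT x|M. J n x) \<longlonglongrightarrow> (LINT x|M. j x)"
proof -
  have meas[measurable]: "b \<in> borel_measurable M" "\<And>n. B n \<in> borel_measurable M" using B by auto
  note J[measurable]
  show intj: "integrable M j"
    by (rule Bochner_Integration.integrable_bound[OF B(2) J(2)]) (use le(2) in \<open>auto intro!: AE_I2 order_trans[OF _ abs_ge_self]\<close>)
  have intJ: "integrable M (J n)" for n
    by (rule Bochner_Integration.integrable_bound[OF B(1)[of n] J(1)]) (use le(1) in \<open>auto intro!: AE_I2 order_trans[OF _ abs_ge_self]\<close>)
  define c where "c = (\<lambda>n x. max (- b x) (min (b x) (J n x)))"
  have b0: "b x \<ge> 0" for x using le(2)[of x] by linarith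
  have cm: "c n \<in> borel_measurable M" for n unfolding c_def by measurable
  have "(\<lambda>n. LINT x|M. c n x) \<longlonglongrightarrow> (LINT x|M. j x)"
  proof (rule integral_dominated_convergence[OF J(2) cm B(2)])
    show "AE x in M. (\<lambda>n. c n x) \<longlonglongrightarrow> j x"
      using lim
    proof eventually_elim
      case (elim x)
      have "(\<lambda>n. c n x) \<longlonglongrightarrow> max (- b x) (min (b x) (j x))"
        unfolding c_def by (intro tendsto_intros elim)
      moreover have "max (- b x) (min (b x) (j x)) = j x" using le(2)[of x] by linarith
      ultimately show ?case by simp
    qed
    show "AE x in M. norm (c n x) \<le> b x" for n
      using b0 by (intro AE_I2) (simp add: c_def abs_le_iff)
  qed
  moreover have "(\<lambda>n. (LINT x|M. J n x) - (LINT x|M. c n x)) \<longlonglongrightarrow> 0"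
  proof (rule Lim_null_comparison[OF _ Bb], rule always_eventually, rule allI)
    fix n
    have intc: "integrable M (c n)"
      by (rule Bochner_Integration.integrable_bound[OF B(2) cm]) (use b0 in \<open>auto intro!: AE_I2 simp: c_def abs_le_iff\<close>)
    have "norm ((LINT x|M. J n x) - (LINT x|M. c n x)) = norm (LINT x|M. J n x - c n x)"
      by (subst Bochner_Integration.integral_diff[OF intJ intc]) simp
    also have "\<dots> \<le> (LINT x|M. norm (J n x - c n x))" by (rule integral_norm_bound)
    also have "\<dots> \<le> (LINT x|M. \<bar>B n x - b x\<bar>)"
    proof (rule integral_mono)
      show "norm (J n x - c n x) \<le> \<bar>B n x - b x\<bar>" for x
        using le(1)[of n x] b0[of x] unfolding c_def real_norm_def by linarith
    qed (use intJ intc B in auto)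
    finally show "norm ((LINT x|M. J n x) - (LINT x|M. c n x)) \<le> (LINT x|M. \<bar>B n x - b x\<bar>)" .
  qed
  ultimately show "(\<lambda>n. LINT x|M. J n x) \<longlonglongrightarrow> (LINT x|M. j x)"
    using tendsto_add by fastforce
qed


text \<open>With \<open>w\<close> mollified, the test function is C^1 with a classical product rule,
  and its gradient contains the mollified weak gradient. The limit needs almost everywhere
  convergence of both and a majorant, supplied by Jensen's inequality. \<open>A\<close> and
  \<open>F\<close> are kept abstract so that the result serves both the equation of one solution and
  the difference of two.\<close>

theorem weak_equation_test_composite:
  fixes A g :: "'a::euclidean_space \<Rightarrow> 'a" and F w \<phi> a :: "'a \<Rightarrow> real" and T T' :: "real \<Rightarrow> real"
  assumes p: "p > 1" and wg: "has_weak_gradient w g" and gp: "g \<in> L_loc p"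
    and A: "A \<in> borel_measurable lebesgue" "\<And>x. norm (A x) \<le> C * a x powr (p - 1)" "C \<ge> 0"
    and a: "a \<in> L_loc p" "\<And>x. a x \<ge> 0"
    and F: "F \<in> L_loc 1"
    and eq: "\<And>\<psi>. \<psi> \<in> C1_0 \<Longrightarrow> (LINT x|lebesgue. A x \<bullet> grad \<psi> x) + (LINT x|lebesgue. F x * \<psi> x) = 0"
    and T: "\<And>s. (T has_real_derivative T' s) (at s)" "continuous_on UNIV T'"
      "\<And>s. \<bar>T s\<bar> \<le> M" "\<And>s. \<bar>T' s\<bar> \<le> M"
    and \<phi>: "\<phi> \<in> C1_0"
  defines "j \<equiv> \<lambda>x. T' (w x) * \<phi> x * (A x \<bullet> g x) + T (w x) * (A x \<bullet> grad \<phi> x) + F x * (T (w x) * \<phi> x)"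
  shows "integrable lebesgue j" "(LINT x|lebesgue. j x) = 0"
proof -
  have w: "w \<in> L_loc 1" and g: "g \<in> L_loc 1" using wg by (auto simp: has_weak_gradient_def)
  have M: "M \<ge> 0" using T(3)[of 0] by linarith
  obtain K where K: "compact K" "\<And>x. x \<notin> K \<Longrightarrow> \<phi> x = 0" "\<And>x. x \<notin> K \<Longrightarrow> grad \<phi> x = 0"
    using C1_0_support[OF \<phi>] by blast
  note c\<phi> = C1_0_continuous[OF \<phi>] and cg\<phi> = C1_0_grad_continuous[OF \<phi>]
  obtain P where P: "P \<ge> 0" "\<And>x. norm (\<phi> x) \<le> P * indicator K x"
    using continuous_compact_support_bounded[OF c\<phi> K(1,2)] by blast
  obtain Q where Q: "Q \<ge> 0" "\<And>x. norm (grad \<phi> x) \<le> Q * indicator K x"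
    using continuous_compact_support_bounded[OF cg\<phi> K(1,3)] by blast
  have T_cont: "continuous_on UNIV T"
    using T(1) by (intro continuous_at_imp_continuous_on ballI DERIV_isCont) auto
  have [measurable]: "T \<in> borel_measurable borel" "T' \<in> borel_measurable borel"
    using T(2) T_cont by (auto intro: borel_measurable_continuous_onI)
  have [measurable]: "w \<in> borel_measurable lebesgue" "g \<in> borel_measurable lebesgue" "F \<in> borel_measurable lebesgue"
    "a \<in> borel_measurable lebesgue" "A \<in> borel_measurable lebesgue"
    "\<phi> \<in> borel_measurable lebesgue" "grad \<phi> \<in> borel_measurable lebesgue" "K \<in> sets lebesgue"
    using w g F a A c\<phi> cg\<phi> K(1)
    by (auto simp: L_loc_measurable continuous_imp_lebesgue_measurable borel_compact)
  define ap where "ap = (\<lambda>x. a x powr p)"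
  define gq where "gq = (\<lambda>x. norm (g x) powr p)"
  have ap: "ap \<in> L_loc 1" using L_loc_powr_norm[OF a(1)] a(2) by (simp add: ap_def)
  have gq: "gq \<in> L_loc 1" unfolding gq_def by (rule L_loc_powr_norm[OF gp])
  have A_le: "norm (A x) \<le> C * (ap x + 1)" for x
    using order_trans[OF A(2) mult_left_mono[OF _ A(3)]] powr_mult_le_sum[OF p a(2), of 1 x] by (simp add: ap_def)
  have Ag_le: "\<bar>A x \<bullet> v\<bar> \<le> C * (ap x + norm v powr p)" for x v
  proof -
    have "\<bar>A x \<bullet> v\<bar> \<le> norm (A x) * norm v" by (rule Cauchy_Schwarz_ineq2)
    also have "\<dots> \<le> C * a x powr (p - 1) * norm v" using A(2) by (intro mult_right_mono) auto
    also have "\<dots> = C * (a x powr (p - 1) * norm v)" by simp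
    also have "\<dots> \<le> C * (ap x + norm v powr p)" unfolding ap_def
      using A(3) a(2) p by (intro mult_left_mono powr_mult_le_sum) auto
    finally show ?thesis .
  qed
  have A1: "A \<in> L_loc 1"
  proof (rule L_loc_1_bound)
    show "(\<lambda>x. C * (ap x + 1)) \<in> L_loc 1" by (intro L_loc_1_mult_const L_loc_1_add ap L_loc_1_const)
  qed (use A_le in auto)
  \<comment> \<open>One majorant for all integrands: \<open>h\<close> is the mollified
    \<open>gq\<close> along the sequence and \<open>gq\<close> itself in the limit. It is affine in
    \<open>h\<close>, so the majorants converge in L1 as soon as the mollifications of
    \<open>gq\<close> do.\<close>
  define bound where "bound = (\<lambda>h x. indicator K x * (M * P * C * (ap x + h x) + M * Q * C * (ap x + 1) + M * P * \<bar>F x\<bar>))"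
  have bound: "\<bar>t' * \<phi> x * (A x \<bullet> v) + t * (A x \<bullet> grad \<phi> x) + F x * (t * \<phi> x)\<bar> \<le> bound h x"
    if t: "\<bar>t\<bar> \<le> M" "\<bar>t'\<bar> \<le> M" and v: "norm v powr p \<le> h x" for t t' v x h
  proof (cases "x \<in> K")
    case False then show ?thesis by (simp add: K bound_def)
  next
    case True
    have \<phi>P: "\<bar>\<phi> x\<bar> \<le> P" "norm (grad \<phi> x) \<le> Q" using P(2)[of x] Q(2)[of x] True by auto
    have 1: "\<bar>t' * \<phi> x * (A x \<bullet> v)\<bar> \<le> M * P * (C * (ap x + h x))"
    proof -
      have "\<bar>A x \<bullet> v\<bar> \<le> C * (ap x + h x)"
        using Ag_le[of x v] mult_left_mono[OF add_left_mono[OF v, of "ap x"] A(3)] by linarith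
      then show ?thesis unfolding abs_mult using t(2) \<phi>P(1) M P(1) by (intro mult_mono) auto
    qed
    have 2: "\<bar>t * (A x \<bullet> grad \<phi> x)\<bar> \<le> M * (C * (ap x + 1) * Q)"
    proof -
      have "\<bar>A x \<bullet> grad \<phi> x\<bar> \<le> norm (A x) * norm (grad \<phi> x)" by (rule Cauchy_Schwarz_ineq2)
      also have "\<dots> \<le> C * (ap x + 1) * Q" using A_le[of x] \<phi>P(2) Q(1) A(3)
        by (intro mult_mono) (auto simp: ap_def)
      finally show ?thesis unfolding abs_mult using t(1) M by (intro mult_mono) auto
    qed
    have 3: "\<bar>F x * (t * \<phi> x)\<bar> \<le> \<bar>F x\<bar> * (M * P)"
      unfolding abs_mult using t(1) \<phi>P(1) M by (intro mult_left_mono mult_mono) auto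
    have "\<bar>t' * \<phi> x * (A x \<bullet> v) + t * (A x \<bullet> grad \<phi> x) + F x * (t * \<phi> x)\<bar>
        \<le> M * P * (C * (ap x + h x)) + M * (C * (ap x + 1) * Q) + \<bar>F x\<bar> * (M * P)"
      using 1 2 3 by linarith
    then show ?thesis using True by (simp add: bound_def mult_ac)
  qed
  have bound_int: "integrable lebesgue (bound h)" if h: "h \<in> L_loc 1" for h
  proof -
    have "(\<lambda>x. M * P * C * (ap x + h x) + M * Q * C * (ap x + 1) + M * P * \<bar>F x\<bar>) \<in> L_loc 1"
      using L_loc_1_norm[OF F] by (intro L_loc_1_add L_loc_1_mult_const ap h L_loc_1_const) auto
    from L_loc_1_indicator_integrable[OF this K(1)] show ?thesis by (simp add: bound_def)
  qed
  define e where "e = (\<lambda>n. inverse (real (Suc n)))"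
  have e: "e n > 0" for n by (simp add: e_def)
  obtain r1 :: "nat \<Rightarrow> nat" where r1: "strict_mono r1"
    "AE x in lebesgue. (\<lambda>n. indicator K x *\<^sub>R (mollify (e (r1 n)) w x - w x)) \<longlonglongrightarrow> 0"
    using tendsto_L1_AE_subseq[OF mollify_L1_local[OF w K(1)]] unfolding e_def by blast
  \<comment> \<open>The subsequence for \<open>g\<close> is taken from the one for \<open>w\<close>,
    so that both converge almost everywhere along the same indices.\<close>
  have g_r1: "(\<lambda>n. LINT x|lebesgue. norm (indicator K x *\<^sub>R (mollify (e (r1 n)) g x - g x))) \<longlonglongrightarrow> 0"
    using LIMSEQ_subseq_LIMSEQ[OF mollify_L1_local(2)[OF g K(1)] r1(1)] by (simp add: o_def e_def)
  obtain r2 :: "nat \<Rightarrow> nat" where r2: "strict_mono r2"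
    "AE x in lebesgue. (\<lambda>n. indicator K x *\<^sub>R (mollify (e (r1 (r2 n))) g x - g x)) \<longlonglongrightarrow> 0"
    using tendsto_L1_AE_subseq[OF _ g_r1] mollify_L1_local(1)[OF g K(1)] unfolding e_def by blast
  define r where "r = r1 \<circ> r2"
  have r: "strict_mono r" unfolding r_def using r1 r2 by (intro strict_mono_o)
  have lim_w: "AE x in lebesgue. (\<lambda>n. indicator K x *\<^sub>R (mollify (e (r n)) w x - w x)) \<longlonglongrightarrow> 0"
    using r1(2)
  proof eventually_elim
    case (elim x)
    from LIMSEQ_subseq_LIMSEQ[OF this r2(1)] show ?case by (simp add: o_def r_def)
  qed
  have lim_g: "AE x in lebesgue. (\<lambda>n. indicator K x *\<^sub>R (mollify (e (r n)) g x - g x)) \<longlonglongrightarrow> 0"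
    using r2(2) by (simp add: r_def)
  define W where "W = (\<lambda>n. mollify (e (r n)) w)"
  define G where "G = (\<lambda>n. mollify (e (r n)) g)"
  define H where "H = (\<lambda>n. mollify (e (r n)) gq)"
  define J where "J = (\<lambda>n x. T' (W n x) * \<phi> x * (A x \<bullet> G n x) + T (W n x) * (A x \<bullet> grad \<phi> x) + F x * (T (W n x) * \<phi> x))"
  have cont: "continuous_on UNIV (W n)" "continuous_on UNIV (G n)" "continuous_on UNIV (H n)" for n
    unfolding W_def G_def H_def by (intro continuous_mollify w g gq e)+
  have [measurable]: "W n \<in> borel_measurable lebesgue" "G n \<in> borel_measurable lebesgue" "H n \<in> borel_measurable lebesgue" for n
    using cont by (auto intro: continuous_imp_lebesgue_measurable)
  have H1: "H n \<in> L_loc 1" for n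
  proof -
    have "integrable lebesgue (\<lambda>x. indicator K x *\<^sub>R H n x)" if K: "compact K" for K
    proof -
      have "integrable lebesgue (\<lambda>x. indicator K x *\<^sub>R (mollify (e (r n)) gq x - gq x) + indicator K x *\<^sub>R gq x)"
        unfolding e_def
        by (rule Bochner_Integration.integrable_add[OF mollify_L1_local(1)[OF gq K] L_loc_1_indicator_integrable[OF gq K]])
      then show ?thesis by (simp add: H_def right_diff_distrib)
    qed
    then show ?thesis by (auto simp: L_loc_1_iff set_integrable_def)
  qed
  have J0: "(LINT x|lebesgue. J n x) = 0" for n
  proof -
    define \<psi> where "\<psi> = (\<lambda>x. T (W n x) * \<phi> x)"
    define D where "D = (\<lambda>x. T (W n x) *\<^sub>R grad \<phi> x + \<phi> x *\<^sub>R (T' (W n x) *\<^sub>R G n x))"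
    have GD: "GDERIV \<psi> x :> D x" for x unfolding \<psi>_def D_def
    proof (rule GDERIV_mult)
      have "GDERIV (W n) x :> G n x" unfolding W_def G_def by (rule GDERIV_mollify[OF wg e])
      then show "GDERIV (\<lambda>x. T (W n x)) x :> T' (W n x) *\<^sub>R G n x"
        using GDERIV_DERIV_compose T(1) by blast
      show "GDERIV \<phi> x :> grad \<phi> x" by (rule C1_0_GDERIV[OF \<phi>])
    qed
    have comp: "continuous_on UNIV (\<lambda>x. T (W n x))" "continuous_on UNIV (\<lambda>x. T' (W n x))"
      using continuous_on_compose2[OF T_cont cont(1)] continuous_on_compose2[OF T(2) cont(1)] by auto
    have contD: "continuous_on UNIV D"
      unfolding D_def by (intro continuous_intros comp c\<phi> cg\<phi> cont)
    have cont\<psi>: "continuous_on UNIV \<psi>"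
      unfolding \<psi>_def by (intro continuous_intros comp c\<phi>)
    have \<psi>: "\<psi> \<in> C1_0"
      by (rule C1_0I[OF GD contD _ K(1)]) (simp add: \<psi>_def K)
    have gr: "grad \<psi> x = D x" for x by (rule grad_eqI[OF GD])
    have i1: "integrable lebesgue (\<lambda>x. A x \<bullet> D x)"
      by (rule L_loc_1_integrable_inner[OF A1 contD K(1)]) (simp add: D_def K)
    have i2: "integrable lebesgue (\<lambda>x. F x * \<psi> x)"
      using L_loc_1_integrable_inner[OF F cont\<psi> K(1)] by (simp add: \<psi>_def K)
    have "J n = (\<lambda>x. A x \<bullet> D x + F x * \<psi> x)"
      by (simp add: fun_eq_iff J_def D_def \<psi>_def inner_add_right mult_ac)
    then have "(LINT x|lebesgue. J n x) = (LINT x|lebesgue. A x \<bullet> D x) + (LINT x|lebesgue. F x * \<psi> x)"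
      using Bochner_Integration.integral_add[OF i1 i2] by simp
    then show ?thesis using eq[OF \<psi>] by (simp add: gr)
  qed
  have conv: "integrable lebesgue j \<and> (\<lambda>n. LINT x|lebesgue. J n x) \<longlonglongrightarrow> (LINT x|lebesgue. j x)"
  proof -
    have 1: "J n \<in> borel_measurable lebesgue" for n unfolding J_def by measurable
    have 2: "j \<in> borel_measurable lebesgue" unfolding j_def by measurable
    have 3: "integrable lebesgue (bound (H n))" for n by (rule bound_int[OF H1])
    have 4: "integrable lebesgue (bound gq)" by (rule bound_int[OF gq])
    have 5: "\<bar>J n x\<bar> \<le> bound (H n) x" for n x unfolding J_def
    proof (rule bound)
      show "norm (G n x) powr p \<le> H n x"
        unfolding G_def H_def gq_def
        by (rule mollify_powr_le[OF g gq[unfolded gq_def] p e])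
    qed (rule T)+
    have 6: "\<bar>j x\<bar> \<le> bound gq x" for x unfolding j_def
      by (rule bound) (auto simp: T gq_def)
    have 7: "(\<lambda>n. LINT x|lebesgue. \<bar>bound (H n) x - bound gq x\<bar>) \<longlonglongrightarrow> 0"
    proof -
      have "\<bar>bound (H n) x - bound gq x\<bar> = M * P * C * norm (indicator K x *\<^sub>R (mollify (e (r n)) gq x - gq x))" for n x
      proof -
        have "bound (H n) x - bound gq x = M * P * C * (indicator K x * (mollify (e (r n)) gq x - gq x))"
          by (simp add: bound_def H_def algebra_simps)
        then show ?thesis using M P(1) A(3) by (simp add: abs_mult)
      qed
      moreover have "(\<lambda>n. M * P * C * (LINT x|lebesgue. norm (indicator K x *\<^sub>R (mollify (e (r n)) gq x - gq x)))) \<longlonglongrightarrow> 0"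
        using LIMSEQ_subseq_LIMSEQ[OF mollify_L1_local(2)[OF gq K(1)] r]
        by (intro tendsto_mult_right_zero) (simp add: o_def e_def)
      ultimately show ?thesis by simp
    qed
    have 8: "AE x in lebesgue. (\<lambda>n. J n x) \<longlonglongrightarrow> j x"
      using lim_w lim_g
    proof eventually_elim
      case (elim x)
      show ?case
      proof (cases "x \<in> K")
        case False
        then show ?thesis by (simp add: J_def j_def K)
      next
        case True
        have Wl: "(\<lambda>n. W n x) \<longlonglongrightarrow> w x" using elim(1) True by (simp add: W_def LIM_zero_iff)
        have Gl: "(\<lambda>n. G n x) \<longlonglongrightarrow> g x" using elim(2) True by (simp add: G_def LIM_zero_iff)
        have "(\<lambda>n. T (W n x)) \<longlonglongrightarrow> T (w x)" "(\<lambda>n. T' (W n x)) \<longlonglongrightarrow> T' (w x)"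
          using continuous_on_tendsto_compose[OF T_cont Wl] continuous_on_tendsto_compose[OF T(2) Wl] by auto
        then show ?thesis unfolding J_def j_def by (intro tendsto_intros Gl)
      qed
    qed
    show ?thesis
      using dominated_convergence_L1_varying[where J=J and B="\<lambda>n. bound (H n)" and b="bound gq", OF 1 2 3 4 7 5 6 8] by (rule conjI)
  qed
  show "integrable lebesgue j" using conv by simp
  have "(\<lambda>n. LINT x|lebesgue. J n x) \<longlonglongrightarrow> (LINT x|lebesgue. j x)" using conv by simp
  then show "(LINT x|lebesgue. j x) = 0" unfolding J0 using LIMSEQ_unique[OF _ tendsto_const] by blast
qed


section \<open>Energy estimate\<close>

text \<open>Fatou's lemma for real integrals; integrability of the limit is part of the conclusion
  because nothing beyond measurability is known about it beforehand.\<close>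

lemma integral_Fatou:
  fixes L :: "nat \<Rightarrow> 'a \<Rightarrow> real"
  assumes L: "\<And>n. integrable M (L n)" "\<And>n. AE x in M. 0 \<le> L n x" "\<And>n. (LINT x|M. L n x) \<le> Z"
    and l: "l \<in> borel_measurable M" and lim: "AE x in M. (\<lambda>n. L n x) \<longlonglongrightarrow> l x"
  shows "integrable M l" "(LINT x|M. l x) \<le> Z"
proof -
  have [measurable]: "\<And>n. L n \<in> borel_measurable M" using L(1) by auto
  have "AE x in M. \<forall>n. 0 \<le> L n x" using L(2) by (simp add: AE_all_countable)
  then have l0: "AE x in M. 0 \<le> l x" using lim
    by eventually_elim (auto intro: LIMSEQ_le_const)
  have "0 \<le> (LINT x|M. L 0 x)" using L(2) by (intro integral_nonneg_AE)
  then have Z: "0 \<le> Z" using L(3)[of 0] by linarith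
  have "(\<integral>\<^sup>+x. ennreal (l x) \<partial>M) = (\<integral>\<^sup>+x. liminf (\<lambda>n. ennreal (L n x)) \<partial>M)"
  proof (rule nn_integral_cong_AE)
    show "AE x in M. ennreal (l x) = liminf (\<lambda>n. ennreal (L n x))"
      using lim
    proof eventually_elim
      case (elim x)
      then have "(\<lambda>n. ennreal (L n x)) \<longlonglongrightarrow> ennreal (l x)" by (rule tendsto_ennrealI)
      then show ?case by (simp add: lim_imp_Liminf)
    qed
  qed
  also have "\<dots> \<le> liminf (\<lambda>n. \<integral>\<^sup>+x. ennreal (L n x) \<partial>M)"
    by (rule nn_integral_liminf) measurable
  also have "\<dots> \<le> ennreal Z"
  proof (rule order_trans[OF Liminf_mono])
    show "\<forall>\<^sub>F n in sequentially. (\<integral>\<^sup>+x. ennreal (L n x) \<partial>M) \<le> ennreal Z"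
      using L by (intro always_eventually allI) (simp add: nn_integral_eq_integral ennreal_leI)
  qed (simp add: Liminf_const)
  finally have le: "(\<integral>\<^sup>+x. ennreal (l x) \<partial>M) \<le> ennreal Z" .
  show i: "integrable M l"
    by (rule integrableI_nonneg[OF l l0]) (use le in \<open>auto simp: less_top[symmetric] top_unique\<close>)
  have "ennreal (LINT x|M. l x) \<le> ennreal Z"
    using le nn_integral_eq_integral[OF i l0] by simp
  then show "(LINT x|M. l x) \<le> Z" using Z by (simp add: ennreal_le_iff)
qed

lemma abs_arctan_le: "\<bar>arctan x\<bar> \<le> \<bar>x\<bar>"
proof -
  have pos: "arctan x \<le> x" if "0 \<le> x" for x :: real
  proof -
    have "x - arctan x \<ge> 0 - arctan 0"
    proof (rule DERIV_nonneg_imp_nondecreasing[OF that])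
      fix y :: real
      have "((\<lambda>x. x - arctan x) has_real_derivative (1 - inverse (1 + y\<^sup>2))) (at y)"
        by (auto intro!: derivative_eq_intros)
      moreover have "0 \<le> 1 - inverse (1 + y\<^sup>2)" by (simp add: inverse_le_1_iff)
      ultimately show "\<exists>z. ((\<lambda>x. x - arctan x) has_real_derivative z) (at y) \<and> 0 \<le> z" by blast
    qed
    then show ?thesis by simp
  qed
  show ?thesis
  proof (cases "0 \<le> x")
    case True then show ?thesis using pos by (simp add: zero_le_arctan_iff)
  next
    case False
    then show ?thesis using pos[of "- x"] by (simp add: arctan_minus)
  qed
qed

text \<open>The difference quotient at 0 of \<open>\<lambda>x. arctan (s * x)\<close>, taken along
  the reciprocals of the positive integers.\<close>

lemma arctan_rescaled_tendsto: "(\<lambda>n. real (Suc n) * arctan (s / real (Suc n))) \<longlonglongrightarrow> s"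
proof -
  have "((\<lambda>x. arctan (s * x)) has_real_derivative s) (at 0)"
    by (auto intro!: derivative_eq_intros)
  then have *: "((\<lambda>h. arctan (s * h) / h) \<longlongrightarrow> s) (at 0)" by (simp add: DERIV_def)
  have "filterlim (\<lambda>n. inverse (real (Suc n))) (at 0) sequentially"
    by (rule filterlim_atI[OF LIMSEQ_inverse_real_of_nat]) simp
  from filterlim_compose[OF * this] show ?thesis by (simp add: divide_inverse mult.commute)
qed

text \<open>No sign condition on \<open>a\<close> is needed at \<open>s = 0\<close>, because
  \<open>0 powr a\<close> is 0 for every \<open>a\<close>.\<close>

lemma powr_minus_1_mult: "0 \<le> (s::real) \<Longrightarrow> s powr (a - 1) * s = s powr a"
  by (cases "s = 0") (auto simp: powr_diff)

text \<open>Here \<open>y\<close> stands for the norm of the gradient, \<open>s\<close> for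
  \<open>\<bar>u\<bar>\<close> and \<open>b\<close> for the bump. The cross term goes into half of
  \<open>y powr p\<close> at the price of \<open>s powr p\<close>; since \<open>p < q + 1\<close>,
  that goes into half of \<open>s powr (q + 1)\<close>; the forcing term goes into the other half.
  Only a constant remains.\<close>

lemma energy_density_lower_bound:
  fixes p q H :: real and k :: nat
  assumes p: "p > 1" and q: "q > p - 1" and H: "H \<ge> 0" and k: "k \<ge> 1" "real k \<ge> p * (q + 1) / (q + 1 - p)"
  shows "\<exists>C\<ge>0. \<forall>y s b. y \<ge> 0 \<longrightarrow> s \<ge> 0 \<longrightarrow> 0 < b \<longrightarrow> b \<le> 1 \<longrightarrow>
     b ^ k * y powr p / 2 - C \<le> b ^ k * y powr p - s * y powr (p - 1) * (2 * real k * b ^ (k - 1)) + b ^ k * s powr (q + 1) - H * s * b ^ k"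
proof -
  define \<kappa> where "\<kappa> = p * (q + 1) / (q + 1 - p)"
  define \<alpha> where "\<alpha> = (q + 1) / (q + 1 - p)"
  obtain C1 where C1: "C1 \<ge> 0" "\<And>K y. K \<ge> 0 \<Longrightarrow> y \<ge> 0 \<Longrightarrow> K * y powr (p - 1) \<le> 1/2 * y powr p + C1 * K powr (p / (p - (p - 1)))"
    using young_absorb[of "p - 1" p "1/2"] p by auto
  obtain C2 where C2: "C2 \<ge> 0" "\<And>K y. K \<ge> 0 \<Longrightarrow> y \<ge> 0 \<Longrightarrow> K * y powr p \<le> 1/2 * y powr (q + 1) + C2 * K powr \<alpha>"
    using young_absorb[of p "q + 1" "1/2"] p q unfolding \<alpha>_def by auto
  obtain C3 where C3: "C3 \<ge> 0" "\<And>K y. K \<ge> 0 \<Longrightarrow> y \<ge> 0 \<Longrightarrow> K * y powr 1 \<le> 1/2 * y powr (q + 1) + C3 * K powr ((q + 1) / (q + 1 - 1))"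
    using young_absorb[of 1 "q + 1" "1/2"] p q by auto
  define C where "C = C2 * C1 powr \<alpha> * (2 * real k) powr \<kappa> + C3 * H powr ((q + 1) / q)"
  show ?thesis
  proof (intro exI[of _ C] conjI allI impI)
    show "C \<ge> 0" unfolding C_def using C2 C3 by auto
    fix y s b :: real assume y: "y \<ge> 0" and s: "s \<ge> 0" and b: "0 < b" "b \<le> 1"
    \<comment> \<open>Dividing by \<open>b ^ k\<close> reduces the claim to an inequality without a
      cut-off, with a coefficient singular in \<open>b\<close>.\<close>
    define K where "K = 2 * real k / b"
    have K: "K \<ge> 0" using b by (simp add: K_def)
    have bK: "b ^ k * K = 2 * real k * b ^ (k - 1)"
      using k b by (cases k) (auto simp: K_def)
    have 1: "s * K * y powr (p - 1) \<le> 1/2 * y powr p + C1 * (K powr p * s powr p)"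
      using C1(2)[of "s * K" y] y s K by (simp add: powr_mult mult_ac)
    have 2: "C1 * K powr p * s powr p \<le> 1/2 * s powr (q + 1) + C2 * (C1 powr \<alpha> * K powr \<kappa>)"
      using C2(2)[of "C1 * K powr p" s] s C1(1) by (simp add: powr_mult powr_powr \<alpha>_def \<kappa>_def)
    have 3: "H * s \<le> 1/2 * s powr (q + 1) + C3 * H powr ((q + 1) / q)"
      using C3(2)[of H s] H s by simp
    \<comment> \<open>The two absorptions leave the singular power
      \<open>b powr (- \<kappa>)\<close>; this is where \<open>k\<close> has to be at least
      \<open>\<kappa>\<close>.\<close>
    have Kb: "b ^ k * K powr \<kappa> \<le> (2 * real k) powr \<kappa>"
    proof -
      have "b powr real k / b powr \<kappa> = b powr (real k - \<kappa>)" by (simp add: powr_diff)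
      also have "\<dots> \<le> 1" using b k by (intro powr_le1) (auto simp: \<kappa>_def)
      finally have "(2 * real k) powr \<kappa> * (b powr real k / b powr \<kappa>) \<le> (2 * real k) powr \<kappa> * 1"
        by (rule mult_left_mono) simp
      moreover have "b ^ k * K powr \<kappa> = (2 * real k) powr \<kappa> * (b powr real k / b powr \<kappa>)"
        using b by (simp add: K_def powr_divide powr_realpow)
      ultimately show ?thesis by simp
    qed
    have "y powr p / 2 - C2 * C1 powr \<alpha> * K powr \<kappa> - C3 * H powr ((q + 1) / q)
        \<le> y powr p - s * K * y powr (p - 1) + s powr (q + 1) - H * s"
      using 1 2 3 by (simp add: mult_ac)
    then have "b ^ k * (y powr p / 2 - C2 * C1 powr \<alpha> * K powr \<kappa> - C3 * H powr ((q + 1) / q))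
        \<le> b ^ k * (y powr p - s * K * y powr (p - 1) + s powr (q + 1) - H * s)"
      using b by (intro mult_left_mono) auto
    also have "\<dots> = b ^ k * y powr p - s * y powr (p - 1) * (b ^ k * K) + b ^ k * s powr (q + 1) - H * s * b ^ k"
      by (simp add: algebra_simps)
    finally have "b ^ k * y powr p / 2 - (C2 * C1 powr \<alpha> * (b ^ k * K powr \<kappa>) + C3 * H powr ((q + 1) / q) * b ^ k)
        \<le> b ^ k * y powr p - s * y powr (p - 1) * (2 * real k * b ^ (k - 1)) + b ^ k * s powr (q + 1) - H * s * b ^ k"
      unfolding bK by (simp add: algebra_simps)
    moreover have "C2 * C1 powr \<alpha> * (b ^ k * K powr \<kappa>) + C3 * H powr ((q + 1) / q) * b ^ k \<le> C"
      unfolding C_def using C2 C3 Kb b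
      by (intro add_mono mult_left_mono) (auto simp: mult_left_le power_le_one)
    ultimately show "b ^ k * y powr p / 2 - C \<le> b ^ k * y powr p - s * y powr (p - 1) * (2 * real k * b ^ (k - 1)) + b ^ k * s powr (q + 1) - H * s * b ^ k"
      by linarith
  qed
qed

lemma norm_powr_scaleR: "norm (norm v powr (p - 2) *\<^sub>R v) = norm v powr (p - 1)"
  using powr_minus_1_mult[of "norm v" "p - 1"] by simp

text \<open>Collects the zeroth-order terms into one locally integrable function, the form that
  \<open>weak_equation_test_composite\<close> expects.\<close>

lemma weak_solutionE:
  fixes u h :: "'a::euclidean_space \<Rightarrow> real"
  assumes sol: "weak_solution p q h u" and h: "h \<in> L_infty" and q: "q > 0"
  obtains g where "u \<in> L_loc p" "has_weak_gradient u g" "g \<in> L_loc p"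
    "(\<lambda>x. \<bar>u x\<bar> powr (q - 1) * u x) \<in> L_loc 1" "h \<in> L_loc 1"
    "\<And>\<psi>. \<psi> \<in> C1_0 \<Longrightarrow> (LINT x|lebesgue. (norm (g x) powr (p - 2) *\<^sub>R g x) \<bullet> grad \<psi> x)
       + (LINT x|lebesgue. (\<bar>u x\<bar> powr (q - 1) * u x - h x) * \<psi> x) = 0"
proof -
  obtain g where g: "has_weak_gradient u g" "g \<in> L_loc p"
    and eq: "\<And>\<phi>. \<phi> \<in> C1_0 \<Longrightarrow> (LINT x|lebesgue. (norm (g x) powr (p - 2) *\<^sub>R g x) \<bullet> grad \<phi> x)
           + (LINT x|lebesgue. \<bar>u x\<bar> powr (q - 1) * u x * \<phi> x)
           = (LINT x|lebesgue. h x * \<phi> x)"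
    and u: "u \<in> L_loc p" "u \<in> L_loc q"
    using sol unfolding weak_solution_def by blast
  have [measurable]: "u \<in> borel_measurable lebesgue" using u by (simp add: L_loc_measurable)
  have u1: "(\<lambda>x. \<bar>u x\<bar> powr (q - 1) * u x) \<in> L_loc 1"
  proof (rule L_loc_1_bound[OF L_loc_powr_norm[OF u(2)]])
    show "AE x in lebesgue. norm (\<bar>u x\<bar> powr (q - 1) * u x) \<le> norm (u x) powr q"
      by (intro AE_I2) (simp add: abs_mult powr_minus_1_mult)
  qed measurable
  have h1: "h \<in> L_loc 1"
  proof -
    obtain c where "AE x in lebesgue. \<bar>h x\<bar> \<le> c" using h by (auto simp: L_infty_def)
    then show ?thesis using h by (intro L_loc_1_bound[OF L_loc_1_const[of c]]) (auto simp: L_infty_def)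
  qed
  show ?thesis
  proof (rule that[OF u(1) g u1 h1])
    fix \<psi> :: "'a \<Rightarrow> real" assume \<psi>: "\<psi> \<in> C1_0"
    obtain K where K: "compact K" "\<And>x. x \<notin> K \<Longrightarrow> \<psi> x = 0" "\<And>x. x \<notin> K \<Longrightarrow> grad \<psi> x = 0"
      by (rule C1_0_support[OF \<psi>]) (rule that)
    have "(LINT x|lebesgue. (\<bar>u x\<bar> powr (q - 1) * u x - h x) * \<psi> x)
        = (LINT x|lebesgue. \<bar>u x\<bar> powr (q - 1) * u x * \<psi> x) - (LINT x|lebesgue. h x * \<psi> x)"
      unfolding left_diff_distrib
      using L_loc_1_integrable_inner[OF u1 C1_0_continuous[OF \<psi>] K(1,2)]
        L_loc_1_integrable_inner[OF h1 C1_0_continuous[OF \<psi>] K(1,2)]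
      by (intro Bochner_Integration.integral_diff) auto
    then show "(LINT x|lebesgue. (norm (g x) powr (p - 2) *\<^sub>R g x) \<bullet> grad \<psi> x)
       + (LINT x|lebesgue. (\<bar>u x\<bar> powr (q - 1) * u x - h x) * \<psi> x) = 0"
      using eq[OF \<psi>] by simp
  qed
qed


text \<open>
  Truncate \<open>u\<close> by \<open>n arctan(u/n)\<close>. Adding the integrable function \<open>z\<close> makes the integrands nonnegative, so that
  Fatou's lemma yields the inequality although \<open>|u|^(q+1)\<close> is not known to be locally integrable.
\<close>

lemma weak_solution_test_self:
  fixes u h \<phi> :: "'a::euclidean_space \<Rightarrow> real" and g :: "'a \<Rightarrow> 'a"
  assumes p: "p > 1"
    and u: "u \<in> L_loc p" and wg: "has_weak_gradient u g" and g: "g \<in> L_loc p"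
    and f1: "(\<lambda>x. \<bar>u x\<bar> powr (q - 1) * u x) \<in> L_loc 1" and h1: "h \<in> L_loc 1"
    and H: "AE x in lebesgue. \<bar>h x\<bar> \<le> H"
    and eq: "\<And>\<psi>. \<psi> \<in> C1_0 \<Longrightarrow> (LINT x|lebesgue. (norm (g x) powr (p - 2) *\<^sub>R g x) \<bullet> grad \<psi> x)
       + (LINT x|lebesgue. (\<bar>u x\<bar> powr (q - 1) * u x - h x) * \<psi> x) = 0"
    and \<phi>: "\<phi> \<in> C1_0" "\<And>x. \<phi> x \<ge> 0"
  defines "j \<equiv> \<lambda>x. \<phi> x * norm (g x) powr p + u x * ((norm (g x) powr (p - 2) *\<^sub>R g x) \<bullet> grad \<phi> x)
                 + (\<bar>u x\<bar> powr (q - 1) * u x - h x) * (u x * \<phi> x)"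
  shows "integrable lebesgue j" "(LINT x|lebesgue. j x) \<le> 0"
proof -
  define A where "A = (\<lambda>x. norm (g x) powr (p - 2) *\<^sub>R g x)"
  define F where "F = (\<lambda>x. \<bar>u x\<bar> powr (q - 1) * u x - h x)"
  define T where "T = (\<lambda>n s. real (Suc n) * arctan (s / real (Suc n)))"
  define T' where "T' = (\<lambda>n s. inverse (1 + (s / real (Suc n))\<^sup>2))"
  define z where "z = (\<lambda>x. \<bar>u x\<bar> * norm (g x) powr (p - 1) * norm (grad \<phi> x) + H * \<bar>u x\<bar> * \<phi> x)"
  have u1: "u \<in> L_loc 1" using wg by (simp add: has_weak_gradient_def)
  have F1: "F \<in> L_loc 1" unfolding F_def by (intro L_loc_1_diff f1 h1)
  have [measurable]: "u \<in> borel_measurable lebesgue" "g \<in> borel_measurable lebesgue" "h \<in> borel_measurable lebesgue"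
    "\<phi> \<in> borel_measurable lebesgue" "grad \<phi> \<in> borel_measurable lebesgue"
    using u g h1 C1_0_continuous[OF \<phi>(1)] C1_0_grad_continuous[OF \<phi>(1)]
    by (auto simp: L_loc_measurable continuous_imp_lebesgue_measurable)
  have A_meas[measurable]: "A \<in> borel_measurable lebesgue" unfolding A_def by measurable
  have normA: "norm (A x) = norm (g x) powr (p - 1)" for x unfolding A_def by (rule norm_powr_scaleR)
  have Ag: "A x \<bullet> g x = norm (g x) powr p" for x
  proof -
    have "A x \<bullet> g x = norm (g x) powr (p - 1 - 1) * norm (g x) * norm (g x)"
      by (simp add: A_def dot_square_norm power2_eq_square)
    then show ?thesis by (simp only: powr_minus_1_mult norm_ge_zero)
  qed
  have gnorm: "(\<lambda>x. norm (g x)) \<in> L_loc p" using g by (auto simp: L_loc_def)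
  have T_deriv: "(T n has_real_derivative T' n s) (at s)" for n s
    unfolding T_def T'_def by (auto intro!: derivative_eq_intros)
  have T'_cont: "continuous_on UNIV (T' n)" for n
    unfolding T'_def divide_inverse
    by (intro continuous_intros) (metis add_pos_nonneg less_irrefl zero_le_power2 zero_less_one)
  have T'_bounds: "0 \<le> T' n s" "T' n s \<le> 1" for n s
    by (auto simp: T'_def inverse_le_1_iff)
  have T_bound: "\<bar>T n s\<bar> \<le> 2 * real (Suc n)" for n s
  proof -
    have "\<bar>arctan (s / real (Suc n))\<bar> \<le> 2" using arctan_bounded[of "s / real (Suc n)"] pi_less_4 by linarith
    then have "real (Suc n) * \<bar>arctan (s / real (Suc n))\<bar> \<le> real (Suc n) * 2" by (intro mult_left_mono) auto
    then show ?thesis by (simp add: T_def abs_mult)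
  qed
  have T_le: "\<bar>T n s\<bar> \<le> \<bar>s\<bar>" for n s
  proof -
    have "real (Suc n) * \<bar>arctan (s / real (Suc n))\<bar> \<le> real (Suc n) * \<bar>s / real (Suc n)\<bar>"
      by (intro mult_left_mono abs_arctan_le) auto
    then show ?thesis by (simp add: T_def abs_mult)
  qed
  have T_sgn: "0 \<le> s * T n s" for n s
    by (cases "s \<ge> 0") (auto simp: T_def zero_le_mult_iff zero_le_divide_iff divide_le_0_iff mult_le_0_iff)
  have T_lim: "(\<lambda>n. T n s) \<longlonglongrightarrow> s" for s unfolding T_def by (rule arctan_rescaled_tendsto)
  have T'_lim: "(\<lambda>n. T' n s) \<longlonglongrightarrow> 1" for s
  proof -
    have "(\<lambda>n. inverse (1 + (s * inverse (real (Suc n)))\<^sup>2)) \<longlonglongrightarrow> inverse (1 + (s * 0)\<^sup>2)"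
      by (intro tendsto_intros LIMSEQ_inverse_real_of_nat) auto
    then show ?thesis by (simp add: T'_def divide_inverse)
  qed
  define J where "J = (\<lambda>n x. T' n (u x) * \<phi> x * (A x \<bullet> g x) + T n (u x) * (A x \<bullet> grad \<phi> x) + F x * (T n (u x) * \<phi> x))"
  have J: "integrable lebesgue (J n)" "(LINT x|lebesgue. J n x) = 0" for n
  proof -
    have M: "\<bar>T' n s\<bar> \<le> 2 * real (Suc n)" for s using T'_bounds[of n s] by simp
    have nA: "norm (A x) \<le> 1 * norm (g x) powr (p - 1)" for x by (simp add: normA)
    have eq': "(LINT x|lebesgue. A x \<bullet> grad \<psi> x) + (LINT x|lebesgue. F x * \<psi> x) = 0" if "\<psi> \<in> C1_0" for \<psi>
      using eq[OF that] by (simp add: A_def F_def)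
    note * = weak_equation_test_composite[OF p wg g A_meas nA zero_le_one gnorm norm_ge_zero F1 eq' T_deriv T'_cont T_bound M \<phi>(1)]
    show "integrable lebesgue (J n)" "(LINT x|lebesgue. J n x) = 0"
      using * unfolding J_def by blast+
  qed
  obtain K where K: "compact K" "\<And>x. x \<notin> K \<Longrightarrow> \<phi> x = 0" "\<And>x. x \<notin> K \<Longrightarrow> grad \<phi> x = 0"
    by (rule C1_0_support[OF \<phi>(1)]) (rule that)
  have z: "integrable lebesgue z"
  proof -
    have "(\<lambda>x. \<bar>u x\<bar> * norm (g x) powr (p - 1)) \<in> L_loc 1"
    proof (rule L_loc_1_bound[OF L_loc_1_add[OF L_loc_powr_norm[OF g] L_loc_powr_norm[OF u]]])
      show "AE x in lebesgue. norm (\<bar>u x\<bar> * norm (g x) powr (p - 1)) \<le> norm (g x) powr p + norm (u x) powr p"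
        using powr_mult_le_sum[OF p] by (intro AE_I2) (simp add: abs_mult mult.commute)
    qed measurable
    from L_loc_1_integrable_inner[OF this, of "\<lambda>x. norm (grad \<phi> x)" K]
    have 1: "integrable lebesgue (\<lambda>x. \<bar>u x\<bar> * norm (g x) powr (p - 1) * norm (grad \<phi> x))"
      using K C1_0_grad_continuous[OF \<phi>(1)] by (simp add: continuous_on_norm)
    from L_loc_1_integrable_inner[OF L_loc_1_mult_const[OF L_loc_1_norm[OF u1]], of \<phi> K H]
    have 2: "integrable lebesgue (\<lambda>x. H * \<bar>u x\<bar> * \<phi> x)"
      using K C1_0_continuous[OF \<phi>(1)] by simp
    show ?thesis unfolding z_def by (rule Bochner_Integration.integrable_add[OF 1 2])
  qed
  define L where "L = (\<lambda>n x. J n x + z x)"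
  have L: "integrable lebesgue (L n)" "(LINT x|lebesgue. L n x) \<le> (LINT x|lebesgue. z x)" for n
    unfolding L_def using J z by auto
  have Lpos: "AE x in lebesgue. 0 \<le> L n x" for n
    using H
  proof eventually_elim
    case (elim x)
    have 1: "0 \<le> T' n (u x) * \<phi> x * (A x \<bullet> g x)" unfolding Ag using T'_bounds \<phi>(2) by auto
    have 2: "\<bar>T n (u x) * (A x \<bullet> grad \<phi> x)\<bar> \<le> \<bar>u x\<bar> * norm (g x) powr (p - 1) * norm (grad \<phi> x)"
    proof -
      have "\<bar>T n (u x)\<bar> * \<bar>A x \<bullet> grad \<phi> x\<bar> \<le> \<bar>u x\<bar> * (norm (A x) * norm (grad \<phi> x))"
        by (intro mult_mono T_le Cauchy_Schwarz_ineq2) auto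
      then show ?thesis by (simp add: abs_mult normA mult_ac)
    qed
    have 3: "0 \<le> \<bar>u x\<bar> powr (q - 1) * u x * (T n (u x) * \<phi> x)"
    proof -
      have "0 \<le> \<bar>u x\<bar> powr (q - 1) * (u x * T n (u x)) * \<phi> x"
        by (intro mult_nonneg_nonneg T_sgn \<phi>(2)) auto
      then show ?thesis by (simp only: mult.assoc)
    qed
    have 4: "\<bar>h x * (T n (u x) * \<phi> x)\<bar> \<le> H * \<bar>u x\<bar> * \<phi> x"
    proof -
      have "\<bar>h x\<bar> * (\<bar>T n (u x)\<bar> * \<phi> x) \<le> H * (\<bar>u x\<bar> * \<phi> x)"
        using elim \<phi>(2)[of x] T_le by (intro mult_mono) auto
      then show ?thesis using \<phi>(2)[of x] by (simp add: abs_mult mult_ac)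
    qed
    have "L n x = T' n (u x) * \<phi> x * (A x \<bullet> g x)
        + (T n (u x) * (A x \<bullet> grad \<phi> x) + \<bar>u x\<bar> * norm (g x) powr (p - 1) * norm (grad \<phi> x))
        + \<bar>u x\<bar> powr (q - 1) * u x * (T n (u x) * \<phi> x)
        + (H * \<bar>u x\<bar> * \<phi> x - h x * (T n (u x) * \<phi> x))"
      by (simp add: L_def J_def z_def F_def left_diff_distrib)
    then show ?case using 1 2 3 4 by linarith
  qed
  have j_eq: "j = (\<lambda>x. 1 * \<phi> x * (A x \<bullet> g x) + u x * (A x \<bullet> grad \<phi> x) + F x * (u x * \<phi> x))"
    unfolding j_def Ag by (simp add: A_def F_def)
  have lim: "AE x in lebesgue. (\<lambda>n. L n x) \<longlonglongrightarrow> j x + z x"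
    unfolding L_def J_def j_eq by (intro AE_I2 tendsto_intros T_lim T'_lim)
  have meas: "(\<lambda>x. j x + z x) \<in> borel_measurable lebesgue"
    unfolding j_def z_def by measurable
  \<comment> \<open>Each \<open>J n\<close> integrates to 0, so the integral of \<open>j + z\<close>
    is at most that of \<open>z\<close>, and subtracting \<open>z\<close> gives the sign.\<close>
  note Fatou = integral_Fatou[OF L(1) Lpos L(2) meas lim]
  have "integrable lebesgue (\<lambda>x. (j x + z x) - z x)"
    by (rule Bochner_Integration.integrable_diff[OF Fatou(1) z])
  then show ji: "integrable lebesgue j" by simp
  show "(LINT x|lebesgue. j x) \<le> 0"
    using Fatou(2) Bochner_Integration.integral_add[OF ji z] by simp
qed

text \<open>The self-tested inequality is combined with the pointwise lower bound, whose error is a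
  constant on the ball carrying the cut-off and therefore integrates to a multiple of its
  volume.\<close>

theorem weak_solution_energy:
  fixes u h :: "'a::euclidean_space \<Rightarrow> real" and g :: "'a \<Rightarrow> 'a"
  assumes p: "p > 1" and q: "q > p - 1"
    and u: "u \<in> L_loc p" and wg: "has_weak_gradient u g" and g: "g \<in> L_loc p"
    and f1: "(\<lambda>x. \<bar>u x\<bar> powr (q - 1) * u x) \<in> L_loc 1" and h1: "h \<in> L_loc 1"
    and H: "AE x in lebesgue. \<bar>h x\<bar> \<le> H"
    and eq: "\<And>\<psi>. \<psi> \<in> C1_0 \<Longrightarrow> (LINT x|lebesgue. (norm (g x) powr (p - 2) *\<^sub>R g x) \<bullet> grad \<psi> x)
       + (LINT x|lebesgue. (\<bar>u x\<bar> powr (q - 1) * u x - h x) * \<psi> x) = 0"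
  shows "\<exists>C. \<forall>R\<ge>1. (LINT x|lebesgue. indicator (cball 0 R) x * norm (g x) powr p) \<le> C * R ^ DIM('a)"
proof -
  \<comment> \<open>The ceiling meets the requirement of the pointwise bound; the added 2 makes the
    cut-off C^1.\<close>
  define k where "k = nat \<lceil>p * (q + 1) / (q + 1 - p)\<rceil> + 2"
  have k: "k \<ge> 2" "k \<ge> 1" "real k \<ge> p * (q + 1) / (q + 1 - p)" unfolding k_def by linarith+
  have "0 \<le> max 0 H" by simp
  then obtain C0 where C0: "C0 \<ge> 0" "\<And>y s b. y \<ge> 0 \<Longrightarrow> s \<ge> 0 \<Longrightarrow> 0 < b \<Longrightarrow> b \<le> 1 \<Longrightarrow>
     b ^ k * y powr p / 2 - C0 \<le> b ^ k * y powr p - s * y powr (p - 1) * (2 * real k * b ^ (k - 1)) + b ^ k * s powr (q + 1) - max 0 H * s * b ^ k"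
    using energy_density_lower_bound[OF p q _ k(2,3), of "max 0 H"] by blast
  have gq: "(\<lambda>x. norm (g x) powr p) \<in> L_loc 1" by (rule L_loc_powr_norm[OF g])
  define V where "V = unit_ball_vol (real DIM('a))"
  \<comment> \<open>\<open>(4/3) ^ k\<close> undoes the cut-off on the inner ball, 2 undoes the
    halved gradient term, and the last factor comes from the volume of the ball of radius
    \<open>2 * R\<close>.\<close>
  define C where "C = (4/3) ^ k * 2 * C0 * (V * 2 ^ DIM('a))"
  show ?thesis
  proof (intro exI[of _ C] allI impI)
    fix R :: real assume R: "R \<ge> 1"
    \<comment> \<open>Doubling the radius keeps the bump above \<open>3/4\<close> on the ball of
      radius \<open>R\<close>.\<close>
    define \<phi> where "\<phi> = (\<lambda>x::'a. bump (2 * R) x ^ k)"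
    have R2: "2 * R > 0" "2 * R \<ge> 1" using R by auto
    have \<phi>: "\<phi> \<in> C1_0" "\<And>x. \<phi> x \<ge> 0"
      unfolding \<phi>_def using bump_power_C1_0[OF k(1) R2(1)] by auto
    define j where "j = (\<lambda>x. \<phi> x * norm (g x) powr p + u x * ((norm (g x) powr (p - 2) *\<^sub>R g x) \<bullet> grad \<phi> x)
                 + (\<bar>u x\<bar> powr (q - 1) * u x - h x) * (u x * \<phi> x))"
    have j: "integrable lebesgue j" "(LINT x|lebesgue. j x) \<le> 0"
      unfolding j_def using weak_solution_test_self[OF p u wg g f1 h1 H eq \<phi>] by blast+
    have jge: "AE x in lebesgue. \<phi> x * norm (g x) powr p / 2 - C0 * indicator (cball 0 (2 * R)) x \<le> j x"
      using H
    proof eventually_elim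
      case (elim x)
      define b where "b = bump (2 * R) x"
      have \<phi>b: "\<phi> x = b ^ k" by (simp add: \<phi>_def b_def)
      have gr: "norm (grad \<phi> x) \<le> 2 * real k * b ^ (k - 1)"
      proof -
        \<comment> \<open>The gain \<open>1 / R\<close> is given up here: volume growth is all that
          the energy bound has to achieve.\<close>
        have "2 * real k / (2 * R) \<le> 2 * real k"
          using R2 divide_left_mono[of 1 "2 * R" "2 * real k"] by simp
        then have "2 * real k / (2 * R) * b ^ (k - 1) \<le> 2 * real k * b ^ (k - 1)"
          by (rule mult_right_mono) (simp add: b_def)
        then show ?thesis
          using norm_grad_bump_power_le[OF k(1) R2(1), of x] unfolding \<phi>_def b_def by linarith
      qed
      show ?case
      proof (cases "b = 0")
        case True
        then have "\<phi> x = 0" "grad \<phi> x = 0" using k gr \<phi>b by (auto simp: power_0_left split: if_splits)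
        then show ?thesis using C0(1) by (simp add: j_def)
      next
        case False
        have b: "0 < b" "b \<le> 1" using False bump_nonneg[of "2 * R" x] bump_le_1[of "2 * R" x]
          unfolding b_def by linarith+
        have xin: "x \<in> cball 0 (2 * R)"
        proof (rule ccontr)
          assume "x \<notin> cball 0 (2 * R)"
          then have "b = 0" using R2 by (simp add: b_def bump_eq_0)
          then show False using False by simp
        qed
        have 1: "\<bar>u x * ((norm (g x) powr (p - 2) *\<^sub>R g x) \<bullet> grad \<phi> x)\<bar> \<le> \<bar>u x\<bar> * norm (g x) powr (p - 1) * (2 * real k * b ^ (k - 1))"
        proof -
          have "\<bar>(norm (g x) powr (p - 2) *\<^sub>R g x) \<bullet> grad \<phi> x\<bar> \<le> norm (norm (g x) powr (p - 2) *\<^sub>R g x) * norm (grad \<phi> x)"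
            by (rule Cauchy_Schwarz_ineq2)
          also have "\<dots> \<le> norm (g x) powr (p - 1) * (2 * real k * b ^ (k - 1))"
            unfolding norm_powr_scaleR using gr by (intro mult_left_mono) auto
          finally have "\<bar>u x\<bar> * \<bar>(norm (g x) powr (p - 2) *\<^sub>R g x) \<bullet> grad \<phi> x\<bar> \<le> \<bar>u x\<bar> * (norm (g x) powr (p - 1) * (2 * real k * b ^ (k - 1)))"
            by (intro mult_left_mono) auto
          then show ?thesis unfolding abs_mult by (simp only: mult.assoc)
        qed
        have 2: "\<bar>u x\<bar> powr (q - 1) * u x * (u x * \<phi> x) = b ^ k * \<bar>u x\<bar> powr (q + 1)"
        proof -
          have "\<bar>u x\<bar> powr (q - 1) * u x * u x = \<bar>u x\<bar> powr (q - 1) * \<bar>u x\<bar> * \<bar>u x\<bar>"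
            by (simp add: mult.assoc)
          also have "\<dots> = \<bar>u x\<bar> powr (q + 1)"
            using powr_minus_1_mult[of "\<bar>u x\<bar>" q] powr_minus_1_mult[of "\<bar>u x\<bar>" "q + 1"] by simp
          finally show ?thesis using \<phi>b by (simp add: mult_ac)
        qed
        have 3: "\<bar>h x * (u x * \<phi> x)\<bar> \<le> max 0 H * \<bar>u x\<bar> * b ^ k"
        proof -
          have "\<bar>h x\<bar> * (\<bar>u x\<bar> * b ^ k) \<le> max 0 H * (\<bar>u x\<bar> * b ^ k)"
            using elim b by (intro mult_right_mono) auto
          then show ?thesis using b by (simp add: \<phi>b abs_mult mult_ac)
        qed
        have "j x = b ^ k * norm (g x) powr p + u x * ((norm (g x) powr (p - 2) *\<^sub>R g x) \<bullet> grad \<phi> x)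
            + \<bar>u x\<bar> powr (q - 1) * u x * (u x * \<phi> x) - h x * (u x * \<phi> x)"
          by (simp add: j_def \<phi>b left_diff_distrib)
        moreover have "b ^ k * norm (g x) powr p / 2 - C0 \<le> b ^ k * norm (g x) powr p - \<bar>u x\<bar> * norm (g x) powr (p - 1) * (2 * real k * b ^ (k - 1)) + b ^ k * \<bar>u x\<bar> powr (q + 1) - max 0 H * \<bar>u x\<bar> * b ^ k"
          using C0(2)[of "norm (g x)" "\<bar>u x\<bar>" b] b by simp
        ultimately have "b ^ k * norm (g x) powr p / 2 - C0 \<le> j x"
          using 1 2 3 by linarith
        then show ?thesis using xin by (simp add: \<phi>b)
      qed
    qed
    have int1: "integrable lebesgue (\<lambda>x. \<phi> x * norm (g x) powr p)"
    proof -
      obtain K where K: "compact K" "\<And>x. x \<notin> K \<Longrightarrow> \<phi> x = 0" "\<And>x. x \<notin> K \<Longrightarrow> grad \<phi> x = 0"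
        by (rule C1_0_support[OF \<phi>(1)]) (rule that)
      show ?thesis
        using L_loc_1_integrable_inner[OF gq C1_0_continuous[OF \<phi>(1)] K(1,2)] by (simp add: mult.commute)
    qed
    have "(LINT x|lebesgue. \<phi> x * norm (g x) powr p / 2 - C0 * indicator (cball 0 (2 * R)) x) \<le> (LINT x|lebesgue. j x)"
      by (rule integral_mono_AE[OF _ j(1) jge])
         (intro Bochner_Integration.integrable_diff integrable_divide int1 integrable_mult_right integrable_indicator_cball)
    then have "(LINT x|lebesgue. \<phi> x * norm (g x) powr p) / 2 - C0 * measure lebesgue (cball (0::'a) (2 * R)) \<le> 0"
      using j(2) Bochner_Integration.integral_diff[OF integrable_divide[OF int1, of 2] integrable_mult_right[OF integrable_indicator_cball, of C0 0 "2 * R"]]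
      by simp
    moreover have "measure lebesgue (cball (0::'a) (2 * R)) = V * 2 ^ DIM('a) * R ^ DIM('a)"
      using R content_cball[of "2 * R" "0::'a"] by (simp add: V_def power_mult_distrib)
    ultimately have e1: "(LINT x|lebesgue. \<phi> x * norm (g x) powr p) \<le> 2 * C0 * (V * 2 ^ DIM('a)) * R ^ DIM('a)"
      by (simp add: mult_ac)
    have "(LINT x|lebesgue. indicator (cball 0 R) x * norm (g x) powr p) \<le> (LINT x|lebesgue. (4/3) ^ k * (\<phi> x * norm (g x) powr p))"
    proof (rule integral_mono)
      show "integrable lebesgue (\<lambda>x. indicator (cball 0 R) x * norm (g x) powr p)"
        using L_loc_1_indicator_integrable[OF gq compact_cball[of 0 R]] by simp
      show "integrable lebesgue (\<lambda>x. (4/3) ^ k * (\<phi> x * norm (g x) powr p))"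
        by (intro integrable_mult_right int1)
      fix x
      have "indicator (cball 0 R) x \<le> (4/3) ^ k * \<phi> x"
      proof (cases "x \<in> cball 0 R")
        case True
        have "(3/4) ^ k \<le> \<phi> x" unfolding \<phi>_def
          using True R by (intro power_mono bump_ge) auto
        then have "(4/3) ^ k * (3/4) ^ k \<le> (4/3) ^ k * \<phi> x" by (intro mult_left_mono) auto
        moreover have "(4/3::real) ^ k * (3/4) ^ k = 1" by (simp add: power_mult_distrib[symmetric])
        ultimately show ?thesis using True by simp
      next
        case False then show ?thesis using \<phi>(2)[of x] by simp
      qed
      then have "indicator (cball 0 R) x * norm (g x) powr p \<le> (4/3) ^ k * \<phi> x * norm (g x) powr p"
        by (intro mult_right_mono) auto
      then show "indicator (cball 0 R) x * norm (g x) powr p \<le> (4/3) ^ k * (\<phi> x * norm (g x) powr p)"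
        by (simp only: mult.assoc)
    qed
    also have "\<dots> = (4/3) ^ k * (LINT x|lebesgue. \<phi> x * norm (g x) powr p)" by simp
    also have "\<dots> \<le> (4/3) ^ k * (2 * C0 * (V * 2 ^ DIM('a)) * R ^ DIM('a))"
      by (intro mult_left_mono e1) auto
    also have "\<dots> = C * R ^ DIM('a)" by (simp add: C_def)
    finally show "(LINT x|lebesgue. indicator (cball 0 R) x * norm (g x) powr p) \<le> C * R ^ DIM('a)" .
  qed
qed


section \<open>Comparison of two solutions\<close>

lemma abs_powr_tendsto_0: "c > 0 \<Longrightarrow> ((\<lambda>h::real. \<bar>h\<bar> powr c) \<longlongrightarrow> 0) (at 0)"
proof -
  assume c: "c > 0"
  have "((\<lambda>h::real. \<bar>h\<bar> powr c) \<longlongrightarrow> \<bar>0\<bar> powr c) (at 0)"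
    by (intro tendsto_powr' tendsto_intros) (use c in auto)
  then show ?thesis by simp
qed

text \<open>
  With \<open>\<sigma> = 1 - 2/p\<close> and \<open>\<tau> = 2 q/p - 1\<close> the function \<open>T\<close> below is, for positive arguments, the bounded
  solution of the equation \<open>T^2 / T' = (s^q T)^(2/p) / m\<close> with \<open>m = \<tau>/\<sigma>\<close>: this is exactly the relation needed
  to absorb the error term \<open>T^2 / T'\<close> into the term \<open>s^q T\<close> coming from the nonlinearity.
\<close>

locale one_sided_cutoff =
  fixes \<sigma> \<tau> :: real
  assumes \<sigma>: "\<sigma> > 0" and \<tau>: "\<tau> > \<sigma>"
begin

definition T :: "real \<Rightarrow> real" where
  "T s = (if s \<le> 0 then 0 else (1 + s powr - \<tau>) powr (- 1 / \<sigma>))"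

definition T' :: "real \<Rightarrow> real" where
  "T' s = (if s \<le> 0 then 0 else \<tau> / \<sigma> * (1 + s powr - \<tau>) powr (- 1 / \<sigma> - 1) * s powr (- \<tau> - 1))"

lemma exponent_gt_1: "\<tau> / \<sigma> > 1"
  using \<sigma> \<tau> by simp

lemma base_neq_0 [simp]: "1 + s powr - \<tau> \<noteq> 0"
  using powr_ge_zero[of s "- \<tau>"] by linarith

lemma T_pos: "s > 0 \<Longrightarrow> T s > 0"
  by (simp add: T_def add_pos_nonneg)

lemma T'_pos: "s > 0 \<Longrightarrow> T' s > 0"
  using \<sigma> \<tau> by (simp add: T'_def add_pos_nonneg)

lemma T_nonneg: "0 \<le> T s"
  by (simp add: T_def)

lemma T'_nonneg: "0 \<le> T' s"
  using \<sigma> \<tau> by (simp add: T'_def)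

lemma T_le_1: "T s \<le> 1"
proof (cases "s \<le> 0")
  case False
  have "(1 + s powr - \<tau>) powr (- 1 / \<sigma>) \<le> (1 + s powr - \<tau>) powr 0"
    using \<sigma> by (intro powr_mono) auto
  also have "\<dots> = 1" by simp
  finally show ?thesis using False by (simp add: T_def)
qed (simp add: T_def)

text \<open>Dropping the 1 in the base gives the order of vanishing at 0. The exponent exceeds 1,
  which is what makes the extension by zero differentiable there.\<close>

lemma T_le_powr: "s > 0 \<Longrightarrow> T s \<le> s powr (\<tau> / \<sigma>)"
proof -
  assume s: "s > 0"
  have "(1 + s powr - \<tau>) powr (- 1 / \<sigma>) \<le> (s powr - \<tau>) powr (- 1 / \<sigma>)"
    using s \<sigma> by (intro powr_mono2') auto
  also have "\<dots> = s powr (\<tau> / \<sigma>)" by (simp add: powr_powr)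
  finally show ?thesis using s by (simp add: T_def)
qed

text \<open>The separable differential equation behind the formula: it integrates to
  \<open>T s powr (- \<sigma>) = s powr (- \<tau>) + const\<close>, and the constant 1 is the one
  with \<open>T\<close> tending to 1 at infinity.\<close>

lemma T'_eq: "s > 0 \<Longrightarrow> T' s = \<tau> / \<sigma> * T s powr (1 + \<sigma>) * s powr (- \<tau> - 1)"
proof -
  assume s: "s > 0"
  have "T s powr (1 + \<sigma>) = (1 + s powr - \<tau>) powr (- 1 / \<sigma> * (1 + \<sigma>))"
    using s by (simp add: T_def powr_powr)
  also have "- 1 / \<sigma> * (1 + \<sigma>) = - 1 / \<sigma> - 1" using \<sigma> by (simp add: field_simps)
  finally show ?thesis using s by (simp add: T'_def)
qed

text \<open>The logarithmic derivative is \<open>\<tau> / \<sigma> / s\<close> times a fraction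
  below 1. This controls \<open>T'\<close> for large arguments, while \<open>T'_le_powr\<close>
  controls it near 0.\<close>

lemma T'_le_T: "s > 0 \<Longrightarrow> T' s \<le> \<tau> / \<sigma> * (T s / s)"
proof -
  assume s: "s > 0"
  have pos: "0 < 1 + s powr - \<tau>" by (simp add: add_pos_nonneg)
  have "T' s = \<tau> / \<sigma> * (T s / s) * (s powr - \<tau> / (1 + s powr - \<tau>))"
    using s pos by (simp add: T'_def T_def powr_diff)
  also have "\<dots> \<le> \<tau> / \<sigma> * (T s / s) * 1"
    using s pos \<sigma> \<tau> T_nonneg[of s] by (intro mult_left_mono) auto
  finally show ?thesis by simp
qed

lemma T'_le_powr: "T' s \<le> \<tau> / \<sigma> * \<bar>s\<bar> powr (\<tau> / \<sigma> - 1)"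
proof (cases "s > 0")
  case True
  have "T s / s \<le> s powr (\<tau> / \<sigma>) / s" using T_le_powr[OF True] True by (intro divide_right_mono) auto
  also have "\<dots> = s powr (\<tau> / \<sigma> - 1)" using True by (simp add: powr_diff)
  finally have "\<tau> / \<sigma> * (T s / s) \<le> \<tau> / \<sigma> * s powr (\<tau> / \<sigma> - 1)"
    using \<sigma> \<tau> by (intro mult_left_mono) auto
  then show ?thesis using T'_le_T[OF True] True by simp
next
  case False
  then show ?thesis using \<sigma> \<tau> by (simp add: T'_def)
qed

lemma T'_le: "T' s \<le> \<tau> / \<sigma>"
proof -
  have c: "\<tau> / \<sigma> * x \<le> \<tau> / \<sigma>" if "x \<le> 1" for x
    using mult_left_mono[OF that, of "\<tau> / \<sigma>"] \<sigma> \<tau> by simp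
  consider "s \<le> 0" | "0 < s" "s \<le> 1" | "s > 1" by linarith
  then show ?thesis
  proof cases
    case 1 then show ?thesis using \<sigma> \<tau> by (simp add: T'_def)
  next
    case 2
    have "\<bar>s\<bar> powr (\<tau> / \<sigma> - 1) \<le> 1" using 2 exponent_gt_1 by (intro powr_le1) auto
    from order_trans[OF T'_le_powr c[OF this]] show ?thesis .
  next
    case 3
    have "T s / s \<le> 1" using 3 T_le_1[of s] by simp
    from order_trans[OF T'_le_T c[OF this]] show ?thesis using 3 by simp
  qed
qed

lemma T_deriv: "(T has_real_derivative T' s) (at s)"
proof -
  consider "s < 0" | "s = 0" | "s > 0" by linarith
  then show ?thesis
  proof cases
    case 1
    have "((\<lambda>_. 0) has_real_derivative 0) (at s)" by simp
    then have "(T has_real_derivative 0) (at s)"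
      by (rule has_field_derivative_transform_within_open[where S="{..<0}"]) (use 1 in \<open>auto simp: T_def\<close>)
    then show ?thesis using 1 by (simp add: T'_def)
  next
    case 2
    have "((\<lambda>h. T h / h) \<longlongrightarrow> 0) (at 0)"
    proof (rule Lim_null_comparison[OF always_eventually abs_powr_tendsto_0[of "\<tau> / \<sigma> - 1"]], rule allI)
      fix h :: real
      show "norm (T h / h) \<le> \<bar>h\<bar> powr (\<tau> / \<sigma> - 1)"
      proof (cases "h > 0")
        case True
        have "T h / h \<le> h powr (\<tau> / \<sigma>) / h" using T_le_powr[OF True] True by (intro divide_right_mono) auto
        also have "\<dots> = h powr (\<tau> / \<sigma> - 1)" using True by (simp add: powr_diff)
        finally show ?thesis using True T_nonneg[of h] by simp
      qed (simp add: T_def)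
    qed (use exponent_gt_1 in simp)
    then show ?thesis using 2 by (simp add: DERIV_def T_def T'_def)
  next
    case 3
    have pos: "0 < 1 + s powr - \<tau>" by (simp add: add_pos_nonneg)
    have "((\<lambda>s. (1 + s powr - \<tau>) powr (- 1 / \<sigma>)) has_real_derivative
        (- 1 / \<sigma>) * (1 + s powr - \<tau>) powr (- 1 / \<sigma> - 1) * (- \<tau> * s powr (- \<tau> - 1))) (at s)"
      using 3 pos by (auto intro!: derivative_eq_intros)
    then have "(T has_real_derivative (- 1 / \<sigma>) * (1 + s powr - \<tau>) powr (- 1 / \<sigma> - 1) * (- \<tau> * s powr (- \<tau> - 1))) (at s)"
      by (rule has_field_derivative_transform_within_open[where S="{0<..}"]) (use 3 in \<open>auto simp: T_def\<close>)
    then show ?thesis using 3 by (simp add: T'_def mult_ac)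
  qed
qed

lemma T'_continuous: "continuous_on UNIV T'"
proof -
  have "isCont T' s" for s
  proof -
    consider "s < 0" | "s = 0" | "s > 0" by linarith
    then show ?thesis
    proof cases
      case 1
      have "\<forall>\<^sub>F x in nhds s. T' x = 0"
        by (rule eventually_nhds_in_open[of "{..<0}" s, THEN eventually_mono]) (use 1 in \<open>auto simp: T'_def\<close>)
      then show ?thesis using isCont_cong[of T' "\<lambda>_. 0" s] by simp
    next
      case 2
      have "(T' \<longlongrightarrow> 0) (at 0)"
      proof (rule Lim_null_comparison[OF always_eventually], rule allI)
        show "norm (T' h) \<le> \<tau> / \<sigma> * \<bar>h\<bar> powr (\<tau> / \<sigma> - 1)" for h
          using T'_le_powr[of h] T'_nonneg[of h] by simp
        show "((\<lambda>h. \<tau> / \<sigma> * \<bar>h\<bar> powr (\<tau> / \<sigma> - 1)) \<longlongrightarrow> 0) (at 0)"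
          using exponent_gt_1 by (intro tendsto_mult_right_zero abs_powr_tendsto_0) simp
      qed
      then show ?thesis using 2 by (simp add: isCont_def T'_def)
    next
      case 3
      have ev: "\<forall>\<^sub>F x in nhds s. T' x = \<tau> / \<sigma> * (1 + x powr - \<tau>) powr (- 1 / \<sigma> - 1) * x powr (- \<tau> - 1)"
        by (rule eventually_nhds_in_open[of "{0<..}" s, THEN eventually_mono]) (use 3 in \<open>auto simp: T'_def\<close>)
      have "isCont (\<lambda>x. \<tau> / \<sigma> * (1 + x powr - \<tau>) powr (- 1 / \<sigma> - 1) * x powr (- \<tau> - 1)) s"
        unfolding isCont_def by (intro tendsto_intros) (use 3 in auto)
      then show ?thesis using isCont_cong[OF ev] by simp
    qed
  qed
  then show ?thesis by (simp add: continuous_at_imp_continuous_on)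
qed

text \<open>For \<open>\<sigma> = 1 - 2/p\<close> and \<open>\<tau> = 2 * q/p - 1\<close> the
  exponents are \<open>2 / p\<close> and \<open>2 * q / p\<close>, so the numerator is the power
  \<open>2 / p\<close> of \<open>T s * s powr q\<close>.\<close>

lemma T_square_div: "s > 0 \<Longrightarrow> (T s)\<^sup>2 / T' s = T s powr (1 - \<sigma>) * s powr (\<tau> + 1) / (\<tau> / \<sigma>)"
proof -
  assume s: "s > 0"
  have "(T s)\<^sup>2 = T s powr (1 + \<sigma>) * T s powr (1 - \<sigma>)"
    using T_pos[OF s] by (simp add: powr_add[symmetric])
  then have "(T s)\<^sup>2 / T' s = T s powr (1 + \<sigma>) * T s powr (1 - \<sigma>) / (\<tau> / \<sigma> * T s powr (1 + \<sigma>) * s powr (- \<tau> - 1))"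
    by (simp add: T'_eq[OF s])
  also have "\<dots> = T s powr (1 - \<sigma>) / (\<tau> / \<sigma> * s powr (- \<tau> - 1))"
    using T_pos[OF s] by simp
  also have "\<dots> = T s powr (1 - \<sigma>) * s powr (\<tau> + 1) / (\<tau> / \<sigma>)"
  proof -
    have "s powr (- \<tau> - 1) = inverse (s powr (\<tau> + 1))" by (simp add: powr_minus[symmetric])
    then show ?thesis by (simp add: divide_inverse mult_ac)
  qed
  finally show ?thesis .
qed

end

text \<open>Here \<open>d\<close> stands for the norm of the gradient of the difference,
  \<open>t\<close>, \<open>t'\<close> for the values of \<open>T\<close>, \<open>T'\<close> and
  \<open>X\<close> for \<open>T\<close> times the power \<open>q\<close> of the difference. AM-GM
  uses up the whole gradient term; its remainder, \<open>W\<close> times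
  \<open>X powr (2 / p)\<close>, is split by Young with exponents \<open>p / 2\<close> and
  \<open>p / (p - 2)\<close> and takes half of the \<open>X\<close> term.\<close>

lemma comparison_density_lower_bound:
  fixes p q m :: real and k :: nat
  assumes p: "p > 2" and m: "m > 0" and k: "k \<ge> 1" "real k \<ge> 2 * (p / (p - 2))"
  shows "\<exists>C\<ge>0. \<forall>W d t t' X b R. W \<ge> 0 \<longrightarrow> t' > 0 \<longrightarrow> X \<ge> 0 \<longrightarrow> 0 < b \<longrightarrow> b \<le> 1 \<longrightarrow> R > 0 \<longrightarrow>
     t\<^sup>2 / t' = X powr (2 / p) / m \<longrightarrow>
     2 powr (- q) / 2 * X * b ^ k - C * R powr (- (2 * (p / (p - 2)))) * W powr (p / (p - 2))
       \<le> W / 2 * d\<^sup>2 * (t' * b ^ k) - (p - 1) * W * d * (t * (2 * real k / R * b ^ (k - 1))) + 2 powr (- q) * X * b ^ k"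
proof -
  define \<theta> where "\<theta> = p / (p - 2)"
  have \<theta>: "\<theta> > 0" using p by (simp add: \<theta>_def)
  have \<theta>': "1 / (1 - 2 / p) = \<theta>" using p by (simp add: \<theta>_def field_simps)
  obtain C1 where C1: "C1 \<ge> 0" "\<And>K X. K \<ge> 0 \<Longrightarrow> X \<ge> 0 \<Longrightarrow> K * X powr (2 / p) \<le> 2 powr (- q) / 2 * X powr 1 + C1 * K powr (1 / (1 - 2 / p))"
    using young_absorb[of "2 / p" 1 "2 powr (- q) / 2"] p by auto
  define D where "D = (2 * real k * (p - 1))\<^sup>2 / (2 * m)"
  have D: "D \<ge> 0" using m by (simp add: D_def)
  show ?thesis
  proof (intro exI[of _ "C1 * D powr \<theta>"] conjI allI impI)
    show "C1 * D powr \<theta> \<ge> 0" using C1 by simp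
    fix W d t t' X b R :: real
    assume W: "W \<ge> 0" and t': "t' > 0" and X: "X \<ge> 0" and b: "0 < b" "b \<le> 1" and R: "R > 0"
      and tt: "t\<^sup>2 / t' = X powr (2 / p) / m"
    \<comment> \<open>As in the energy bound, \<open>b ^ k\<close> is factored out of the cross
      term. \<open>K\<close> below is \<open>W * c\<^sup>2 / (2 * m)\<close>, with the numerical
      constants collected in \<open>D\<close>.\<close>
    define c where "c = (p - 1) * (2 * real k / R) / b"
    define K where "K = D / R\<^sup>2 * W / b\<^sup>2"
    have K: "K \<ge> 0" using D W by (simp add: K_def)
    \<comment> \<open>The square is weighted by \<open>t'\<close>, so that its first part,
      multiplied by \<open>W\<close>, is exactly the available gradient term.\<close>
    have amgm: "c * d * t \<le> d\<^sup>2 * t' / 2 + c\<^sup>2 * (t\<^sup>2 / t') / 2"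
    proof -
      have "0 \<le> (d * t' - c * t)\<^sup>2 / (2 * t')" using t' by simp
      also have "\<dots> = d\<^sup>2 * t' / 2 + c\<^sup>2 * (t\<^sup>2 / t') / 2 - c * d * t"
        using t' by (simp add: power2_eq_square field_simps)
      finally show ?thesis by simp
    qed
    have "W * (c * d * t) \<le> W * (d\<^sup>2 * t' / 2 + c\<^sup>2 * (t\<^sup>2 / t') / 2)"
      using amgm W by (rule mult_left_mono)
    also have "\<dots> = W / 2 * d\<^sup>2 * t' + (W * c\<^sup>2 / 2 / m) * X powr (2 / p)"
      unfolding tt by (simp add: algebra_simps)
    also have "W * c\<^sup>2 / 2 / m = K"
      unfolding K_def D_def c_def by (simp add: power_mult_distrib power_divide mult_ac)
    finally have s1: "W * (c * d * t) \<le> W / 2 * d\<^sup>2 * t' + (2 powr (- q) / 2 * X + C1 * K powr \<theta>)"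
      using C1(2)[OF K X] X \<theta>' by simp
    \<comment> \<open>\<open>K\<close> is of order \<open>b powr (- 2)\<close>, so the singularity
      has order \<open>2 * \<theta>\<close>, the lower bound imposed on \<open>k\<close>. The same
      square produces the decay in \<open>R\<close>.\<close>
    have "b ^ k * K powr \<theta> \<le> D powr \<theta> * R powr (- (2 * \<theta>)) * W powr \<theta>"
    proof -
      have R2: "(R\<^sup>2) powr \<theta> = R powr (2 * \<theta>)" "(b\<^sup>2) powr \<theta> = b powr (2 * \<theta>)"
        using R b by (simp_all add: powr_powr flip: powr_numeral)
      have "K powr \<theta> = D powr \<theta> * R powr (- (2 * \<theta>)) * W powr \<theta> / b powr (2 * \<theta>)"
        using D W R b by (simp add: K_def powr_mult powr_divide R2 powr_minus_divide)
      then have "b ^ k * K powr \<theta> = D powr \<theta> * R powr (- (2 * \<theta>)) * W powr \<theta> * (b powr real k / b powr (2 * \<theta>))"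
        using b by (simp add: powr_realpow)
      also have "\<dots> \<le> D powr \<theta> * R powr (- (2 * \<theta>)) * W powr \<theta> * 1"
      proof (rule mult_left_mono)
        have "b powr (real k - 2 * \<theta>) \<le> 1" using b k by (intro powr_le1) (auto simp: \<theta>_def)
        then show "b powr real k / b powr (2 * \<theta>) \<le> 1" by (simp add: powr_diff)
      qed simp
      finally show ?thesis by simp
    qed
    then have s2: "C1 * (b ^ k * K powr \<theta>) \<le> C1 * (D powr \<theta> * R powr (- (2 * \<theta>)) * W powr \<theta>)"
      using C1(1) by (rule mult_left_mono)
    have bk: "b ^ k * c = (p - 1) * (2 * real k / R * b ^ (k - 1))"
      using k b by (cases k) (auto simp: c_def)
    have "b ^ k * (W * (c * d * t)) \<le> b ^ k * (W / 2 * d\<^sup>2 * t' + (2 powr (- q) / 2 * X + C1 * K powr \<theta>))"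
      using s1 b by (intro mult_left_mono) auto
    then have "(b ^ k * c) * (W * d * t) \<le> W / 2 * d\<^sup>2 * (t' * b ^ k) + 2 powr (- q) / 2 * X * b ^ k + C1 * (b ^ k * K powr \<theta>)"
      by (simp add: algebra_simps)
    moreover have "(b ^ k * c) * (W * d * t) = (p - 1) * W * d * (t * (2 * real k / R * b ^ (k - 1)))"
      unfolding bk by (simp add: mult_ac)
    ultimately have "(p - 1) * W * d * (t * (2 * real k / R * b ^ (k - 1)))
        \<le> W / 2 * d\<^sup>2 * (t' * b ^ k) + 2 powr (- q) / 2 * X * b ^ k + C1 * (D powr \<theta> * R powr (- (2 * \<theta>)) * W powr \<theta>)"
      using s2 by linarith
    moreover have "2 powr (- q) * X * b ^ k = 2 powr (- q) / 2 * X * b ^ k + 2 powr (- q) / 2 * X * b ^ k" by simp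
    moreover have "C1 * D powr \<theta> * R powr (- (2 * (p / (p - 2)))) * W powr (p / (p - 2)) = C1 * (D powr \<theta> * R powr (- (2 * \<theta>)) * W powr \<theta>)"
      by (simp add: \<theta>_def)
    ultimately show "2 powr (- q) / 2 * X * b ^ k - C1 * D powr \<theta> * R powr (- (2 * (p / (p - 2)))) * W powr (p / (p - 2))
       \<le> W / 2 * d\<^sup>2 * (t' * b ^ k) - (p - 1) * W * d * (t * (2 * real k / R * b ^ (k - 1))) + 2 powr (- q) * X * b ^ k"
      by linarith
  qed
qed

text \<open>One-dimensional case of \<open>powr_vector_monotone\<close>, with the weight bounded
  below because one of \<open>\<bar>s\<bar>\<close>, \<open>\<bar>t\<bar>\<close> is at least
  \<open>(s - t) / 2\<close>. The powers of 2 combine to \<open>2 powr (- q)\<close>.\<close>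

lemma powr_diff_lower_bound:
  fixes s t q :: real
  assumes q: "q > 1" and st: "t < s"
  shows "2 powr (- q) * (s - t) powr q \<le> \<bar>s\<bar> powr (q - 1) * s - \<bar>t\<bar> powr (q - 1) * t"
proof -
  let ?B = "\<bar>s\<bar> powr (q - 1) * s - \<bar>t\<bar> powr (q - 1) * t"
  have "(\<bar>s\<bar> powr (q - 1) + \<bar>t\<bar> powr (q - 1)) / 2 * (s - t)\<^sup>2 \<le> ?B * (s - t)"
    using powr_vector_monotone[of "q - 1" s t] q by simp
  moreover have "((s - t) / 2) powr (q - 1) \<le> \<bar>s\<bar> powr (q - 1) + \<bar>t\<bar> powr (q - 1)"
  proof (cases "\<bar>s\<bar> \<le> \<bar>t\<bar>")
    case True
    have "((s - t) / 2) powr (q - 1) \<le> \<bar>t\<bar> powr (q - 1)" using True st q by (intro powr_mono2) auto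
    then show ?thesis by (simp add: add_increasing)
  next
    case False
    have "((s - t) / 2) powr (q - 1) \<le> \<bar>s\<bar> powr (q - 1)" using False st q by (intro powr_mono2) auto
    then show ?thesis by (simp add: add_increasing2)
  qed
  then have "((s - t) / 2) powr (q - 1) / 2 * (s - t)\<^sup>2 \<le> (\<bar>s\<bar> powr (q - 1) + \<bar>t\<bar> powr (q - 1)) / 2 * (s - t)\<^sup>2"
    by (intro mult_right_mono divide_right_mono) auto
  moreover have "((s - t) / 2) powr (q - 1) / 2 * (s - t)\<^sup>2 = 2 powr (- q) * (s - t) powr q * (s - t)"
  proof -
    have "(s - t) powr (q - 1) * (s - t) = (s - t) powr q" using st by (intro powr_minus_1_mult) auto
    moreover have "inverse (2 powr (q - 1)) / 2 = 2 powr (- q)" by (simp add: powr_diff powr_minus_divide)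
    moreover have "((s - t) / 2) powr (q - 1) / 2 * (s - t)\<^sup>2
        = (inverse (2 powr (q - 1)) / 2) * ((s - t) powr (q - 1) * (s - t)) * (s - t)"
    proof -
      have "((s - t) / 2) powr (q - 1) = (s - t) powr (q - 1) / 2 powr (q - 1)"
        by (rule powr_divide)
      moreover have "y / z / 2 * d\<^sup>2 = (inverse z / 2) * (y * d) * d" for y z d :: real
        by (simp add: power2_eq_square inverse_eq_divide)
      ultimately show ?thesis by (simp only:)
    qed
    ultimately show ?thesis by (simp only:)
  qed
  ultimately have "2 powr (- q) * (s - t) powr q * (s - t) \<le> ?B * (s - t)" by linarith
  then show ?thesis using st by (simp only: mult_le_cancel_right_pos diff_gt_0_iff_gt)
qed

text \<open>Turns the power of the weight left by Young's inequality into energy density: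
  \<open>p - 2\<close> times \<open>p / (p - 2)\<close> is \<open>p\<close>.\<close>

lemma sum_powr_le:
  fixes x y p :: real
  assumes p: "p > 2" and xy: "x \<ge> 0" "y \<ge> 0"
  shows "(x powr (p - 2) + y powr (p - 2)) powr (p / (p - 2)) \<le> 2 powr (p / (p - 2)) * (x powr p + y powr p)"
proof -
  define z where "z = max x y"
  have z: "z \<ge> 0" "x \<le> z" "y \<le> z" using xy by (auto simp: z_def)
  have "x powr (p - 2) + y powr (p - 2) \<le> 2 * z powr (p - 2)"
    using powr_mono2[of "p - 2" x z] powr_mono2[of "p - 2" y z] p z xy by simp
  then have "(x powr (p - 2) + y powr (p - 2)) powr (p / (p - 2)) \<le> (2 * z powr (p - 2)) powr (p / (p - 2))"
    using p by (intro powr_mono2) auto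
  also have "\<dots> = 2 powr (p / (p - 2)) * z powr p" using p by (simp add: powr_mult powr_powr)
  also have "z powr p \<le> x powr p + y powr p" by (auto simp: z_def max_def)
  finally show ?thesis by simp
qed

lemma bump_mono: "0 < R \<Longrightarrow> R \<le> R' \<Longrightarrow> bump R x \<le> bump R' x"
  unfolding bump_def by (intro max.mono diff_mono divide_left_mono power_mono) auto


section \<open>Differences of Sobolev functions, and the comparison argument\<close>

lemma L_locI: "f \<in> borel_measurable lebesgue \<Longrightarrow> (\<lambda>x. norm (f x) powr p) \<in> L_loc 1 \<Longrightarrow> f \<in> L_loc p"
  unfolding L_loc_1_iff by (simp add: L_loc_def)

lemma L_loc_bound_sum:
  fixes f g :: "'a::euclidean_space \<Rightarrow> 'b::euclidean_space" and h :: "'a \<Rightarrow> 'c::euclidean_space"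
  assumes p: "p > 0" and f: "f \<in> L_loc p" and g: "g \<in> L_loc p" and h: "h \<in> borel_measurable lebesgue"
    and le: "\<And>x. norm (h x) \<le> norm (f x) + norm (g x)"
  shows "h \<in> L_loc p"
proof (rule L_locI[OF h])
  show "(\<lambda>x. norm (h x) powr p) \<in> L_loc 1"
  proof (rule L_loc_1_bound[OF L_loc_1_mult_const[OF L_loc_1_add[OF L_loc_powr_norm[OF f] L_loc_powr_norm[OF g]], of "2 powr p"]])
    have "norm (h x) powr p \<le> 2 powr p * (norm (f x) powr p + norm (g x) powr p)" for x
    proof -
      have "norm (h x) powr p \<le> (2 * max (norm (f x)) (norm (g x))) powr p"
        using le[of x] p by (intro powr_mono2) auto
      also have "\<dots> = 2 powr p * max (norm (f x)) (norm (g x)) powr p" by (simp add: powr_mult)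
      also have "\<dots> \<le> 2 powr p * (norm (f x) powr p + norm (g x) powr p)"
        by (intro mult_left_mono) (auto simp: max_def)
      finally show ?thesis .
    qed
    then show "AE x in lebesgue. norm (norm (h x) powr p) \<le> 2 powr p * (norm (f x) powr p + norm (g x) powr p)"
      by (intro AE_I2) simp
  qed (use h in measurable)
qed

lemma has_weak_gradient_diff:
  fixes u v :: "'a::euclidean_space \<Rightarrow> real"
  assumes u: "has_weak_gradient u gu" and v: "has_weak_gradient v gv"
  shows "has_weak_gradient (\<lambda>x. u x - v x) (\<lambda>x. gu x - gv x)"
  unfolding has_weak_gradient_def
proof (intro conjI ballI)
  have L: "u \<in> L_loc 1" "v \<in> L_loc 1" "gu \<in> L_loc 1" "gv \<in> L_loc 1"
    using u v by (auto simp: has_weak_gradient_def)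
  show "(\<lambda>x. u x - v x) \<in> L_loc 1" "(\<lambda>x. gu x - gv x) \<in> L_loc 1" by (intro L_loc_1_diff L)+
  fix \<phi> :: "'a \<Rightarrow> real" assume \<phi>: "\<phi> \<in> C1_0"
  obtain K where K: "compact K" "\<And>x. x \<notin> K \<Longrightarrow> \<phi> x = 0" "\<And>x. x \<notin> K \<Longrightarrow> grad \<phi> x = 0"
    by (rule C1_0_support[OF \<phi>]) (rule that)
  obtain P where P: "P \<ge> 0" "\<And>x. norm (\<phi> x) \<le> P * indicator K x"
    using continuous_compact_support_bounded[OF C1_0_continuous[OF \<phi>] K(1,2)] by blast
  obtain Q where Q: "Q \<ge> 0" "\<And>x. norm (grad \<phi> x) \<le> Q * indicator K x"
    using continuous_compact_support_bounded[OF C1_0_grad_continuous[OF \<phi>] K(1,3)] by blast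
  have meas[measurable]: "\<phi> \<in> borel_measurable lebesgue" "grad \<phi> \<in> borel_measurable lebesgue"
    using \<phi> by (auto intro!: continuous_imp_lebesgue_measurable C1_0_continuous C1_0_grad_continuous)
  have "\<bar>\<phi> x\<bar> \<le> P" for x using P(1) P(2)[of x] by (cases "x \<in> K") auto
  then have i1: "integrable lebesgue (\<lambda>x. \<phi> x *\<^sub>R f x)" if "f \<in> L_loc 1" for f :: "'a \<Rightarrow> 'a"
    using K meas(1) by (intro L_loc_1_integrable_mult[OF that _ _ K(1,2)]) auto
  have i2: "integrable lebesgue (\<lambda>x. f x *\<^sub>R grad \<phi> x)" if f: "f \<in> L_loc 1" for f :: "'a \<Rightarrow> real"
  proof (rule Bochner_Integration.integrable_bound)
    show "integrable lebesgue (\<lambda>x. Q * norm (indicator K x *\<^sub>R f x))"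
      by (intro integrable_mult_right integrable_norm L_loc_1_indicator_integrable f K)
    show "(\<lambda>x. f x *\<^sub>R grad \<phi> x) \<in> borel_measurable lebesgue"
      using L_loc_measurable[OF f] by measurable
    show "AE x in lebesgue. norm (f x *\<^sub>R grad \<phi> x) \<le> norm (Q * norm (indicator K x *\<^sub>R f x))"
    proof (rule AE_I2)
      fix x
      have "\<bar>f x\<bar> * norm (grad \<phi> x) \<le> \<bar>f x\<bar> * (Q * indicator K x)" using Q(2) by (intro mult_left_mono) auto
      then show "norm (f x *\<^sub>R grad \<phi> x) \<le> norm (Q * norm (indicator K x *\<^sub>R f x))"
        using Q(1) by (simp add: abs_mult mult_ac)
    qed
  qed
  have "(LINT x|lebesgue. (u x - v x) *\<^sub>R grad \<phi> x) = (LINT x|lebesgue. u x *\<^sub>R grad \<phi> x) - (LINT x|lebesgue. v x *\<^sub>R grad \<phi> x)"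
    unfolding scaleR_diff_left by (rule Bochner_Integration.integral_diff[OF i2[OF L(1)] i2[OF L(2)]])
  also have "\<dots> = - ((LINT x|lebesgue. \<phi> x *\<^sub>R gu x) - (LINT x|lebesgue. \<phi> x *\<^sub>R gv x))"
    using u v \<phi> by (simp add: has_weak_gradient_def)
  also have "\<dots> = - (LINT x|lebesgue. \<phi> x *\<^sub>R (gu x - gv x))"
    unfolding scaleR_diff_right by (subst Bochner_Integration.integral_diff[OF i1[OF L(3)] i1[OF L(4)]]) simp
  finally show "(LINT x|lebesgue. (u x - v x) *\<^sub>R grad \<phi> x) = - (LINT x|lebesgue. \<phi> x *\<^sub>R (gu x - gv x))" .
qed

theorem weak_solution_le:
  fixes u v h :: "'a::euclidean_space \<Rightarrow> real"
  assumes p: "p > 2" and q: "q > p - 1" and h: "h \<in> L_infty"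
    and dim: "real DIM('a) < 2 * (p / (p - 2))"
    and u: "weak_solution p q h u" and v: "weak_solution p q h v"
  shows "AE x in lebesgue. u x \<le> v x"
proof -
  define \<theta> where "\<theta> = p / (p - 2)"
  define \<sigma> where "\<sigma> = 1 - 2 / p"
  define \<tau> where "\<tau> = 2 * q / p - 1"
  have p1: "p > 1" and q1: "q > 1" and q0: "q > 0" using p q by auto
  interpret one_sided_cutoff \<sigma> \<tau>
  proof
    show "\<sigma> > 0" using p by (simp add: \<sigma>_def)
    \<comment> \<open>The requirement \<open>\<tau> > \<sigma>\<close> of the cut-off is the
      hypothesis \<open>q > p - 1\<close> in disguise.\<close>
    have "\<tau> - \<sigma> = (2 * q + 2 - 2 * p) / p"
      using p by (simp add: \<sigma>_def \<tau>_def add_divide_distrib diff_divide_distrib)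
    also have "\<dots> > 0" using p q by simp
    finally show "\<tau> > \<sigma>" by simp
  qed
  define m where "m = \<tau> / \<sigma>"
  have m: "m > 1" unfolding m_def by (rule exponent_gt_1)
  obtain gu where u_p: "u \<in> L_loc p" and wgu: "has_weak_gradient u gu" and gu: "gu \<in> L_loc p"
    and fu: "(\<lambda>x. \<bar>u x\<bar> powr (q - 1) * u x) \<in> L_loc 1" and h1: "h \<in> L_loc 1"
    and equ: "\<And>\<psi>. \<psi> \<in> C1_0 \<Longrightarrow> (LINT x|lebesgue. (norm (gu x) powr (p - 2) *\<^sub>R gu x) \<bullet> grad \<psi> x)
       + (LINT x|lebesgue. (\<bar>u x\<bar> powr (q - 1) * u x - h x) * \<psi> x) = 0"
    by (rule weak_solutionE[OF u h q0]) (rule that)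
  obtain gv where v_p: "v \<in> L_loc p" and wgv: "has_weak_gradient v gv" and gv: "gv \<in> L_loc p"
    and fv: "(\<lambda>x. \<bar>v x\<bar> powr (q - 1) * v x) \<in> L_loc 1"
    and eqv: "\<And>\<psi>. \<psi> \<in> C1_0 \<Longrightarrow> (LINT x|lebesgue. (norm (gv x) powr (p - 2) *\<^sub>R gv x) \<bullet> grad \<psi> x)
       + (LINT x|lebesgue. (\<bar>v x\<bar> powr (q - 1) * v x - h x) * \<psi> x) = 0"
    by (rule weak_solutionE[OF v h q0]) (rule that)
  obtain H where H: "AE x in lebesgue. \<bar>h x\<bar> \<le> H" using h by (auto simp: L_infty_def)
  obtain Cu where Cu: "\<And>R. R \<ge> 1 \<Longrightarrow> (LINT x|lebesgue. indicator (cball 0 R) x * norm (gu x) powr p) \<le> Cu * R ^ DIM('a)"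
    using weak_solution_energy[OF p1 q u_p wgu gu fu h1 H equ] by blast
  obtain Cv where Cv: "\<And>R. R \<ge> 1 \<Longrightarrow> (LINT x|lebesgue. indicator (cball 0 R) x * norm (gv x) powr p) \<le> Cv * R ^ DIM('a)"
    using weak_solution_energy[OF p1 q v_p wgv gv fv h1 H eqv] by blast
  define w where "w = (\<lambda>x. u x - v x)"
  define g where "g = (\<lambda>x. gu x - gv x)"
  define A where "A = (\<lambda>x. norm (gu x) powr (p - 2) *\<^sub>R gu x - norm (gv x) powr (p - 2) *\<^sub>R gv x)"
  define F where "F = (\<lambda>x. \<bar>u x\<bar> powr (q - 1) * u x - \<bar>v x\<bar> powr (q - 1) * v x)"
  define a where "a = (\<lambda>x. norm (gu x) + norm (gv x))"
  define W where "W = (\<lambda>x. norm (gu x) powr (p - 2) + norm (gv x) powr (p - 2))"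
  define E where "E = (\<lambda>x. norm (gu x) powr p + norm (gv x) powr p)"
  \<comment> \<open>\<open>X\<close> vanishes for \<open>w x \<le> 0\<close> because
    \<open>T\<close> does; the absolute value only keeps the base of \<open>powr\<close>
    nonnegative.\<close>
  define X where "X = (\<lambda>x. T (w x) * \<bar>w x\<bar> powr q)"
  have [measurable]: "u \<in> borel_measurable lebesgue" "v \<in> borel_measurable lebesgue" "gu \<in> borel_measurable lebesgue"
    "gv \<in> borel_measurable lebesgue" "h \<in> borel_measurable lebesgue"
    using u_p v_p gu gv h1 by (auto simp: L_loc_measurable)
  have T_cont: "continuous_on UNIV T"
    using T_deriv by (intro continuous_at_imp_continuous_on ballI DERIV_isCont)
  then have [measurable]: "T \<in> borel_measurable borel" by (rule borel_measurable_continuous_onI)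
  have wg: "has_weak_gradient w g" unfolding w_def g_def by (rule has_weak_gradient_diff[OF wgu wgv])
  have A_meas[measurable]: "A \<in> borel_measurable lebesgue" unfolding A_def by measurable
  have w_meas[measurable]: "w \<in> borel_measurable lebesgue" unfolding w_def by measurable
  have g_p: "g \<in> L_loc p" unfolding g_def
    by (rule L_loc_bound_sum[OF _ gu gv]) (use p norm_triangle_ineq4 in auto)
  have a_p: "a \<in> L_loc p" unfolding a_def
    by (rule L_loc_bound_sum[OF _ gu gv]) (use p in auto)
  have a_nonneg: "0 \<le> a x" for x by (simp add: a_def)
  \<comment> \<open>Plain growth is enough to admit the test function; the weighted bound on the
    flux enters only in the pointwise estimate.\<close>
  have A_le: "norm (A x) \<le> 2 * a x powr (p - 1)" for x
  proof -
    have "norm (A x) \<le> norm (gu x) powr (p - 1) + norm (gv x) powr (p - 1)"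
      unfolding A_def using norm_triangle_ineq4 by (metis norm_powr_scaleR)
    also have "\<dots> \<le> a x powr (p - 1) + a x powr (p - 1)"
      using p by (intro add_mono powr_mono2) (auto simp: a_def)
    finally show ?thesis by simp
  qed
  have F1: "F \<in> L_loc 1" unfolding F_def by (rule L_loc_1_diff[OF fu fv])
  have eq: "(LINT x|lebesgue. A x \<bullet> grad \<psi> x) + (LINT x|lebesgue. F x * \<psi> x) = 0" if \<psi>: "\<psi> \<in> C1_0" for \<psi>
  proof -
    obtain K where K: "compact K" "\<And>x. x \<notin> K \<Longrightarrow> \<psi> x = 0" "\<And>x. x \<notin> K \<Longrightarrow> grad \<psi> x = 0"
      by (rule C1_0_support[OF \<psi>]) (rule that)
    have AL: "(\<lambda>x. norm (f x) powr (p - 2) *\<^sub>R f x) \<in> L_loc 1" if f: "f \<in> L_loc p" for f :: "'a \<Rightarrow> 'a"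
    proof (rule L_loc_1_bound[OF L_loc_1_add[OF L_loc_powr_norm[OF f] L_loc_1_const[of 1]]])
      show "(\<lambda>x. norm (f x) powr (p - 2) *\<^sub>R f x) \<in> borel_measurable lebesgue"
        using L_loc_measurable[OF f] by measurable
      show "AE x in lebesgue. norm (norm (f x) powr (p - 2) *\<^sub>R f x) \<le> norm (f x) powr p + 1"
      proof (rule AE_I2)
        fix x show "norm (norm (f x) powr (p - 2) *\<^sub>R f x) \<le> norm (f x) powr p + 1"
          unfolding norm_powr_scaleR using powr_mult_le_sum[OF p1, of "norm (f x)" 1] by simp
      qed
    qed
    have "(LINT x|lebesgue. A x \<bullet> grad \<psi> x) = (LINT x|lebesgue. (norm (gu x) powr (p - 2) *\<^sub>R gu x) \<bullet> grad \<psi> x)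
        - (LINT x|lebesgue. (norm (gv x) powr (p - 2) *\<^sub>R gv x) \<bullet> grad \<psi> x)"
      unfolding A_def inner_diff_left
      by (rule Bochner_Integration.integral_diff[OF L_loc_1_integrable_inner[OF AL[OF gu] C1_0_grad_continuous[OF \<psi>] K(1,3)]
            L_loc_1_integrable_inner[OF AL[OF gv] C1_0_grad_continuous[OF \<psi>] K(1,3)]])
    moreover have "(LINT x|lebesgue. F x * \<psi> x) = (LINT x|lebesgue. (\<bar>u x\<bar> powr (q - 1) * u x - h x) * \<psi> x)
        - (LINT x|lebesgue. (\<bar>v x\<bar> powr (q - 1) * v x - h x) * \<psi> x)"
    proof -
      have "F x * \<psi> x = (\<bar>u x\<bar> powr (q - 1) * u x - h x) * \<psi> x - (\<bar>v x\<bar> powr (q - 1) * v x - h x) * \<psi> x" for x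
        by (simp add: F_def algebra_simps)
      moreover have "integrable lebesgue (\<lambda>x. (\<bar>u x\<bar> powr (q - 1) * u x - h x) * \<psi> x)"
        using L_loc_1_integrable_inner[OF L_loc_1_diff[OF fu h1] C1_0_continuous[OF \<psi>] K(1,2)] by simp
      moreover have "integrable lebesgue (\<lambda>x. (\<bar>v x\<bar> powr (q - 1) * v x - h x) * \<psi> x)"
        using L_loc_1_integrable_inner[OF L_loc_1_diff[OF fv h1] C1_0_continuous[OF \<psi>] K(1,2)] by simp
      ultimately show ?thesis by (simp only: Bochner_Integration.integral_diff)
    qed
    ultimately show ?thesis using equ[OF \<psi>] eqv[OF \<psi>] by simp
  qed
  define k where "k = nat \<lceil>2 * \<theta>\<rceil> + 2"
  have k: "k \<ge> 2" "k \<ge> 1" "real k \<ge> 2 * (p / (p - 2))" unfolding k_def \<theta>_def by linarith+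
  obtain C where C: "C \<ge> 0" "\<And>W d t t' X b R. W \<ge> 0 \<Longrightarrow> t' > 0 \<Longrightarrow> X \<ge> 0 \<Longrightarrow> 0 < b \<Longrightarrow> b \<le> 1 \<Longrightarrow> R > 0 \<Longrightarrow>
     t\<^sup>2 / t' = X powr (2 / p) / m \<Longrightarrow>
     2 powr (- q) / 2 * X * b ^ k - C * R powr (- (2 * \<theta>)) * W powr \<theta>
       \<le> W / 2 * d\<^sup>2 * (t' * b ^ k) - (p - 1) * W * d * (t * (2 * real k / R * b ^ (k - 1))) + 2 powr (- q) * X * b ^ k"
    using comparison_density_lower_bound[OF p _ k(2,3), of m q] m unfolding \<theta>_def by fastforce
  have X_nonneg: "0 \<le> X x" for x by (simp add: X_def T_nonneg)
  have TX: "(T (w x))\<^sup>2 / T' (w x) = X x powr (2 / p) / m" if "w x > 0" for x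
  proof -
    have "T (w x) powr (1 - \<sigma>) * w x powr (\<tau> + 1) = X x powr (2 / p)"
      using that T_nonneg[of "w x"] by (simp add: X_def \<sigma>_def \<tau>_def powr_mult powr_powr mult_ac)
    then show ?thesis using T_square_div[OF that] by (simp add: m_def)
  qed
  have E_int: "integrable lebesgue (\<lambda>x. indicator (cball 0 R) x * E x)" for R
    using L_loc_1_indicator_integrable[OF L_loc_1_add[OF L_loc_powr_norm[OF gu] L_loc_powr_norm[OF gv]] compact_cball[of 0 R]]
    by (simp add: E_def)
  have E_le: "(LINT x|lebesgue. indicator (cball 0 R) x * E x) \<le> (Cu + Cv) * R ^ DIM('a)" if "R \<ge> 1" for R
  proof -
    have "integrable lebesgue (\<lambda>x. indicator (cball 0 R) x * norm (gu x) powr p)"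
      "integrable lebesgue (\<lambda>x. indicator (cball 0 R) x * norm (gv x) powr p)"
      using L_loc_1_indicator_integrable[OF L_loc_powr_norm[OF gu] compact_cball[of 0 R]]
        L_loc_1_indicator_integrable[OF L_loc_powr_norm[OF gv] compact_cball[of 0 R]] by simp_all
    then have "(LINT x|lebesgue. indicator (cball 0 R) x * E x)
        = (LINT x|lebesgue. indicator (cball 0 R) x * norm (gu x) powr p) + (LINT x|lebesgue. indicator (cball 0 R) x * norm (gv x) powr p)"
      unfolding E_def distrib_left by (rule Bochner_Integration.integral_add)
    then show ?thesis using Cu[OF that] Cv[OF that] by (simp add: distrib_right)
  qed
  define c where "c = 2 powr (- q) / 2"
  have c: "c > 0" by (simp add: c_def)
  \<comment> \<open>\<open>C\<close> comes from the pointwise bound, \<open>2 powr \<theta>\<close>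
    from \<open>sum_powr_le\<close>, the sum from the two energy estimates, and \<open>c\<close> is
    the part of the \<open>X\<close> coefficient that survives absorption.\<close>
  define B where "B = C * 2 powr \<theta> * (Cu + Cv) / c"
  have main: "integrable lebesgue (\<lambda>x. X x * bump R x ^ k) \<and> (LINT x|lebesgue. X x * bump R x ^ k) \<le> B * R powr (real DIM('a) - 2 * \<theta>)"
    if R: "R \<ge> 1" for R
  proof -
    have R0: "R > 0" using R by simp
    define \<phi> where "\<phi> = (\<lambda>x::'a. bump R x ^ k)"
    have \<phi>: "\<phi> \<in> C1_0" unfolding \<phi>_def by (rule bump_power_C1_0[OF k(1) R0])
    define j where "j = (\<lambda>x. T' (w x) * \<phi> x * (A x \<bullet> g x) + T (w x) * (A x \<bullet> grad \<phi> x) + F x * (T (w x) * \<phi> x))"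
    have Tm: "\<bar>T s\<bar> \<le> max 1 m" "\<bar>T' s\<bar> \<le> max 1 m" for s
      using T_le_1[of s] T_nonneg[of s] T'_le[of s] T'_nonneg[of s] by (auto simp: m_def)
    have j: "integrable lebesgue j" "(LINT x|lebesgue. j x) = 0"
      unfolding j_def
      using weak_equation_test_composite[OF p1 wg g_p A_meas A_le _ a_p a_nonneg F1 eq T_deriv T'_continuous Tm \<phi>] by auto
    define y where "y = (\<lambda>x. C * R powr (- (2 * \<theta>)) * 2 powr \<theta> * (indicator (cball 0 R) x * E x))"
    have y: "integrable lebesgue y" unfolding y_def by (intro integrable_mult_right E_int)
    have y_nonneg: "0 \<le> y x" for x using C(1) by (simp add: y_def E_def)
    have pw: "c * (X x * \<phi> x) \<le> j x + y x" for x
    \<comment> \<open>The pointwise bound divides by \<open>T' (w x)\<close> and by the bump. Where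
      either vanishes, so do \<open>X x * \<phi> x\<close> and \<open>j x\<close>: \<open>T\<close>
      and \<open>T'\<close> are 0 for \<open>w x \<le> 0\<close>, and \<open>\<phi>\<close> and its
      gradient are 0 where the bump is.\<close>
    proof (cases "w x > 0 \<and> bump R x > 0")
      case False
      have "X x * \<phi> x = 0 \<and> j x = 0"
      proof (cases "w x > 0")
        case True
        then have b0: "bump R x = 0" using False bump_nonneg[of R x] by linarith
        then have "\<phi> x = 0" using k by (simp add: \<phi>_def)
        moreover have "grad \<phi> x = 0"
          using norm_grad_bump_power_le[OF k(1) R0, of x] k unfolding \<phi>_def b0 by (simp add: power_0_left split: if_splits)
        ultimately show ?thesis by (simp add: j_def)
      next
        case False
        then show ?thesis by (simp add: X_def j_def T_def T'_def)
      qed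
      then show ?thesis using y_nonneg[of x] by auto
    next
      case True
      define b where "b = bump R x"
      have b: "0 < b" "b \<le> 1" using True by (auto simp: b_def)
      have \<phi>b: "\<phi> x = b ^ k" by (simp add: \<phi>_def b_def)
      have gr: "norm (grad \<phi> x) \<le> 2 * real k / R * b ^ (k - 1)"
        using norm_grad_bump_power_le[OF k(1) R0, of x] unfolding \<phi>_def b_def .
      have W0: "W x \<ge> 0" by (simp add: W_def)
      have xin: "x \<in> cball 0 R"
      proof (rule ccontr)
        assume "x \<notin> cball 0 R"
        then have "b = 0" using R0 by (simp add: b_def bump_eq_0)
        then show False using b by simp
      qed
      have 1: "W x / 2 * (norm (g x))\<^sup>2 * (T' (w x) * b ^ k) \<le> T' (w x) * \<phi> x * (A x \<bullet> g x)"
      proof -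
        have "W x / 2 * (norm (g x))\<^sup>2 \<le> A x \<bullet> g x"
          using powr_vector_monotone[of "p - 2" "gu x" "gv x"] p by (simp add: A_def g_def W_def)
        then have "T' (w x) * \<phi> x * (W x / 2 * (norm (g x))\<^sup>2) \<le> T' (w x) * \<phi> x * (A x \<bullet> g x)"
          using b T'_nonneg by (intro mult_left_mono) (auto simp: \<phi>b)
        then show ?thesis by (simp add: \<phi>b mult_ac)
      qed
      have 2: "- ((p - 1) * W x * norm (g x) * (T (w x) * (2 * real k / R * b ^ (k - 1)))) \<le> T (w x) * (A x \<bullet> grad \<phi> x)"
      proof -
        have "norm (A x) \<le> (p - 1) * W x * norm (g x)"
          using powr_vector_lipschitz[of "p - 2" "gu x" "gv x"] p by (simp add: A_def g_def W_def)
        then have "norm (A x) * norm (grad \<phi> x) \<le> (p - 1) * W x * norm (g x) * (2 * real k / R * b ^ (k - 1))"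
          using gr p W0 by (intro mult_mono) auto
        then have "\<bar>A x \<bullet> grad \<phi> x\<bar> \<le> (p - 1) * W x * norm (g x) * (2 * real k / R * b ^ (k - 1))"
          using Cauchy_Schwarz_ineq2[of "A x" "grad \<phi> x"] by linarith
        then have "T (w x) * \<bar>A x \<bullet> grad \<phi> x\<bar> \<le> T (w x) * ((p - 1) * W x * norm (g x) * (2 * real k / R * b ^ (k - 1)))"
          using T_nonneg by (intro mult_left_mono)
        moreover have "- (T (w x) * \<bar>A x \<bullet> grad \<phi> x\<bar>) \<le> T (w x) * (A x \<bullet> grad \<phi> x)"
          using mult_left_mono[OF abs_ge_minus_self[of "A x \<bullet> grad \<phi> x"] T_nonneg[of "w x"]] by simp
        moreover have "T (w x) * ((p - 1) * W x * norm (g x) * (2 * real k / R * b ^ (k - 1)))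
            = (p - 1) * W x * norm (g x) * (T (w x) * (2 * real k / R * b ^ (k - 1)))" by (simp only: mult_ac)
        ultimately show ?thesis by linarith
      qed
      have 3: "2 powr (- q) * X x * b ^ k \<le> F x * (T (w x) * \<phi> x)"
      proof -
        have "2 powr (- q) * w x powr q \<le> F x"
          using powr_diff_lower_bound[OF q1, of "v x" "u x"] True by (simp add: F_def w_def)
        then have "2 powr (- q) * w x powr q * (T (w x) * b ^ k) \<le> F x * (T (w x) * b ^ k)"
          using T_nonneg b by (intro mult_right_mono) auto
        then show ?thesis using True by (simp add: \<phi>b X_def mult_ac)
      qed
      have 4: "2 powr (- q) / 2 * X x * b ^ k - C * R powr (- (2 * \<theta>)) * W x powr \<theta>
       \<le> W x / 2 * (norm (g x))\<^sup>2 * (T' (w x) * b ^ k) - (p - 1) * W x * norm (g x) * (T (w x) * (2 * real k / R * b ^ (k - 1))) + 2 powr (- q) * X x * b ^ k"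
        by (rule C(2)[OF W0 T'_pos X_nonneg b R0 TX]) (use True in auto)
      have 5: "C * R powr (- (2 * \<theta>)) * W x powr \<theta> \<le> y x"
      proof -
        have "W x powr \<theta> \<le> 2 powr \<theta> * E x"
          unfolding W_def E_def \<theta>_def by (rule sum_powr_le[OF p]) auto
        then have "C * R powr (- (2 * \<theta>)) * W x powr \<theta> \<le> C * R powr (- (2 * \<theta>)) * (2 powr \<theta> * E x)"
          using C(1) by (intro mult_left_mono) auto
        then show ?thesis using xin by (simp add: y_def mult_ac)
      qed
      have "c * (X x * \<phi> x) = 2 powr (- q) / 2 * X x * b ^ k" by (simp add: c_def \<phi>b)
      then show ?thesis using 1 2 3 4 5 unfolding j_def by linarith
    qed
    have X_meas: "(\<lambda>x. X x * \<phi> x) \<in> borel_measurable lebesgue"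
      using continuous_imp_lebesgue_measurable[OF C1_0_continuous[OF \<phi>]] unfolding X_def by measurable
    have jy: "integrable lebesgue (\<lambda>x. (j x + y x) / c)"
      by (intro integrable_divide Bochner_Integration.integrable_add j y)
    have X\<phi>: "0 \<le> X x * \<phi> x" for x using X_nonneg by (simp add: \<phi>_def)
    have pw': "X x * \<phi> x \<le> (j x + y x) / c" for x
      using pw[of x] c by (simp add: pos_le_divide_eq mult.commute)
    have int: "integrable lebesgue (\<lambda>x. X x * \<phi> x)"
    proof (rule Bochner_Integration.integrable_bound[OF jy X_meas], rule AE_I2)
      fix x show "norm (X x * \<phi> x) \<le> norm ((j x + y x) / c)"
        using pw'[of x] X\<phi>[of x] unfolding real_norm_def by linarith
    qed
    have "(LINT x|lebesgue. X x * \<phi> x) \<le> (LINT x|lebesgue. (j x + y x) / c)"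
      by (rule integral_mono[OF int jy pw'])
    also have "\<dots> = (LINT x|lebesgue. y x) / c"
      using Bochner_Integration.integral_add[OF j(1) y] j(2) by simp
    also have "(LINT x|lebesgue. y x) = C * R powr (- (2 * \<theta>)) * 2 powr \<theta> * (LINT x|lebesgue. indicator (cball 0 R) x * E x)"
      by (simp only: y_def integral_mult_right_zero)
    also have "\<dots> / c \<le> C * R powr (- (2 * \<theta>)) * 2 powr \<theta> * ((Cu + Cv) * R ^ DIM('a)) / c"
      using c C(1) by (intro divide_right_mono mult_left_mono E_le R) auto
    also have "\<dots> = B * (R powr real DIM('a) * R powr (- (2 * \<theta>)))"
      using R0 by (simp add: B_def powr_realpow)
    also have "R powr real DIM('a) * R powr (- (2 * \<theta>)) = R powr (real DIM('a) - 2 * \<theta>)"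
      by (simp add: powr_add[symmetric])
    finally show ?thesis using int unfolding \<phi>_def by blast
  qed
  have zero: "AE x in lebesgue. X x * bump (real (Suc n)) x ^ k = 0" for n
  proof -
    let ?I = "\<lambda>R. LINT x|lebesgue. X x * bump R x ^ k"
    have "?I (real (Suc n)) \<le> B * (real (Suc i)) powr (real DIM('a) - 2 * \<theta>)" if "i \<ge> n" for i
    proof -
      \<comment> \<open>The bump grows with its radius, so the integral at a fixed radius is below
        those at all larger radii, whose bounds tend to 0.\<close>
      have "?I (real (Suc n)) \<le> ?I (real (Suc i))"
      proof (rule integral_mono)
        show "X x * bump (real (Suc n)) x ^ k \<le> X x * bump (real (Suc i)) x ^ k" for x
          using that X_nonneg by (intro mult_left_mono power_mono bump_mono) auto
      qed (use main in auto)
      then show ?thesis using main[of "real (Suc i)"] by linarith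
    qed
    moreover have "(\<lambda>i. B * (real (Suc i)) powr (real DIM('a) - 2 * \<theta>)) \<longlonglongrightarrow> 0"
    proof -
      have "((\<lambda>i. (real (Suc i)) powr (real DIM('a) - 2 * \<theta>)) \<longlonglongrightarrow> 0)"
        using dim by (intro tendsto_neg_powr filterlim_compose[OF filterlim_real_sequentially filterlim_Suc]) (simp add: \<theta>_def)
      then show ?thesis by (rule tendsto_mult_right_zero)
    qed
    ultimately have "?I (real (Suc n)) \<le> 0" by (intro LIMSEQ_le_const) auto
    moreover have "?I (real (Suc n)) \<ge> 0" using X_nonneg by (intro integral_nonneg_AE AE_I2) auto
    ultimately have "?I (real (Suc n)) = 0" by simp
    then show ?thesis
      using integral_nonneg_eq_0_iff_AE[of lebesgue "\<lambda>x. X x * bump (real (Suc n)) x ^ k"] main[of "real (Suc n)"] X_nonneg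
      by auto
  qed
  then have "AE x in lebesgue. \<forall>n. X x * bump (real (Suc n)) x ^ k = 0"
    unfolding AE_all_countable by (rule allI)
  then show ?thesis
  proof eventually_elim
    case (elim x)
    show "u x \<le> v x"
    proof (rule ccontr)
      assume "\<not> u x \<le> v x"
      then have "w x > 0" by (simp add: w_def)
      then have "X x > 0" using T_pos by (simp add: X_def)
      moreover obtain n where n: "2 * norm x \<le> real n" using real_arch_simple by blast
      moreover have "bump (real (Suc n)) x \<ge> 3 / 4" using n by (intro bump_ge) auto
      ultimately have "X x * bump (real (Suc n)) x ^ k > 0" by simp
      then show False using elim by (metis less_irrefl)
    qed
  qed
qed

theorem corollary1p3:
  fixes p q :: real and h u v :: "real ^ 'n \<Rightarrow> real"
  assumes "CARD('n) \<ge> 2"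
    and "q > p - 1" and "p - 1 > 1"
    and "h \<in> L_infty"
    and "2 < p" and "p < 2 * real CARD('n) / (real CARD('n) - 1)"
    and "weak_solution p q h u" and "weak_solution p q h v"
  shows "AE x in lebesgue. u x = v x"
proof -
  have N: "real CARD('n) > 1" using assms(1) by simp
  have "p * (real CARD('n) - 1) < 2 * real CARD('n)"
    using assms(6) N by (simp add: pos_less_divide_eq)
  \<comment> \<open>The restriction on \<open>p\<close> is solved for the dimension; it makes the
    exponent of \<open>R\<close> in the final bound negative.\<close>
  then have "real CARD('n) * (p - 2) < p" by (simp add: algebra_simps)
  then have "real CARD('n) < p / (p - 2)" using assms(5) by (simp add: pos_less_divide_eq)
  then have dim: "real DIM(real ^ 'n) < 2 * (p / (p - 2))" using N by simp
  have "AE x in lebesgue. u x \<le> v x" "AE x in lebesgue. v x \<le> u x"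
    by (rule weak_solution_le[OF assms(5,2,4) dim]; fact)+
  then show ?thesis by eventually_elim simp
qed

end
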